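(* Let $n\geq 1$ and let $X\subseteq\mathbb{R}^n$ be such that every nonempty $\langle \mathbb{R},+,<,1,X\rangle$-definable relation contains a point with rational components. Then $X$ is $\langle \mathbb{R},+,<,1\rangle$-definable if and only if every generalized projection of $X$ has finitely many quasi-singular points.
   Context: Definable means first-order definable without parameters. $\mathbb{R}^m$ carries the norm $|x|=\max_i|x_i|$, and $B(x,r)$ is the open ball of center $x$ and radius $r>0$. Generalized projections: let $0\le r\le n$, let $s=(s_1,\dots,s_r)$ be integers with $1\leq s_1<\dots<s_r\leq n$ and $a=(a_1,\dots,a_r)\in\mathbb{R}^r$. The generalized section $X_{s,a}$ is $\{(x_1,\dots,x_n)\in X\mid x_{s_1}=a_1,\dots,x_{s_r}=a_r\}$ (for $r=0$, $X_{s,a}=X$). Removing the $r$ fixed components $x_{s_1},\dots,x_{s_r}$, $X_{s,a}$ is seen as a subset of $\mathbb{R}^{n-r}$, called a generalized projection of $X$. (For $r=n$ it is a subset of the one-point space $\mathbb{R}^0$, and there is nothing to check.) Quasi-singular points: let $Y\subseteq\mathbb{R}^m$, $x\in\mathbb{R}^m$ and $0<s<r$ reals. A vector $v\in\mathbb{R}^m$ is an $(r,s)$-quasi-stratum of $x$ (relative to $Y$) if $|v|\leq s$ and ($y\in Y\leftrightarrow y+v\in Y$) holds for all $y\in\mathbb{R}^m$ such that $y,y+v\in B(x,r)$. The point $x$ is $Y$-quasi-singular if it does not satisfy the following property: there exist reals $0<s<r$ such that the set of $(r,s)$-quasi-strata of $x$ contains a nonzero vector, is closed, and is stable under $v\mapsto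 v/2$. The quasi-singular points of a generalized projection $Y$ of $X$ are the $Y$-quasi-singular points. *)

theory Defs
  imports "HOL-Analysis.Analysis"
begin

section \<open>The spaces of real vectors\<close>

text \<open>
  The dimension varies inside the statement, so the space of real m-vectors is the carrier of
  the library topology \<^const>\<open>Euclidean_space\<close>: functions \<open>nat \<Rightarrow> real\<close> vanishing at all
  indices \<open>\<ge> m\<close>. Coordinates are numbered from 0.
\<close>

abbreviation Rvec :: "nat \<Rightarrow> (nat \<Rightarrow> real) set" where
  "Rvec m \<equiv> topspace (Euclidean_space m)"

definition vec_of_list :: "real list \<Rightarrow> nat \<Rightarrow> real" where
  "vec_of_list xs = (\<lambda>i. if i < length xs then xs ! i else 0)"

text \<open>The inserted 0 only matters for \<open>m = 0\<close>, where the maximum would be over the empty set.\<close>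

definition max_norm :: "nat \<Rightarrow> (nat \<Rightarrow> real) \<Rightarrow> real" where
  "max_norm m x = Max (insert 0 ((\<lambda>i. \<bar>x i\<bar>) ` {..<m}))"

definition max_ball :: "nat \<Rightarrow> (nat \<Rightarrow> real) \<Rightarrow> real \<Rightarrow> (nat \<Rightarrow> real) set" where
  "max_ball m x r = {y \<in> Rvec m. max_norm m (\<lambda>i. y i - x i) < r}"


section \<open>First-order definability\<close>

text \<open>Variables are de Bruijn indices; \<open>Rel ts\<close> is the atom stating that the tuple of values of
  \<open>ts\<close> belongs to the distinguished relation.\<close>

datatype tm = Var nat | One | Plus tm tm

datatype fm = Eq tm tm | Less tm tm | Rel "tm list" | Neg fm | Conj fm fm | Ex fm

fun eval_tm :: "(nat \<Rightarrow> real) \<Rightarrow> tm \<Rightarrow> real" where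
  "eval_tm e (Var i) = e i"
| "eval_tm e One = 1"
| "eval_tm e (Plus t u) = eval_tm e t + eval_tm e u"

fun sat :: "(nat \<Rightarrow> real) set \<Rightarrow> (nat \<Rightarrow> real) \<Rightarrow> fm \<Rightarrow> bool" where
  "sat X e (Eq t u) \<longleftrightarrow> eval_tm e t = eval_tm e u"
| "sat X e (Less t u) \<longleftrightarrow> eval_tm e t < eval_tm e u"
| "sat X e (Rel ts) \<longleftrightarrow> vec_of_list (map (eval_tm e) ts) \<in> X"
| "sat X e (Neg p) \<longleftrightarrow> \<not> sat X e p"
| "sat X e (Conj p q) \<longleftrightarrow> sat X e p \<and> sat X e q"
| "sat X e (Ex p) \<longleftrightarrow> (\<exists>a. sat X (case_nat a e) p)"

fun tm_vars :: "tm \<Rightarrow> nat set" where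
  "tm_vars (Var i) = {i}"
| "tm_vars One = {}"
| "tm_vars (Plus t u) = tm_vars t \<union> tm_vars u"

fun free_vars :: "fm \<Rightarrow> nat set" where
  "free_vars (Eq t u) = tm_vars t \<union> tm_vars u"
| "free_vars (Less t u) = tm_vars t \<union> tm_vars u"
| "free_vars (Rel ts) = (\<Union>t\<in>set ts. tm_vars t)"
| "free_vars (Neg p) = free_vars p"
| "free_vars (Conj p q) = free_vars p \<union> free_vars q"
| "free_vars (Ex p) = {i. Suc i \<in> free_vars p}"

text \<open>The arities with which the relation symbol is used. A formula is in the language of
  \<open>\<langle>\<real>, +, <, 1, X\<rangle>\<close> with \<open>X\<close> n-ary iff these all equal \<open>n\<close>, and in that of
  \<open>\<langle>\<real>, +, <, 1\<rangle>\<close> iff there are none.\<close>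

fun rel_arities :: "fm \<Rightarrow> nat set" where
  "rel_arities (Eq t u) = {}"
| "rel_arities (Less t u) = {}"
| "rel_arities (Rel ts) = {length ts}"
| "rel_arities (Neg p) = rel_arities p"
| "rel_arities (Conj p q) = rel_arities p \<union> rel_arities q"
| "rel_arities (Ex p) = rel_arities p"

definition definable_with :: "nat \<Rightarrow> (nat \<Rightarrow> real) set \<Rightarrow> nat \<Rightarrow> (nat \<Rightarrow> real) set \<Rightarrow> bool" where
  "definable_with n X k S \<longleftrightarrow>
     (\<exists>p. rel_arities p \<subseteq> {n} \<and> free_vars p \<subseteq> {..<k} \<and> S = {x \<in> Rvec k. sat X x p})"

text \<open>The empty set passed to \<^const>\<open>sat\<close> is a dummy: no relation atom occurs in the formula.\<close>

definition definable :: "nat \<Rightarrow> (nat \<Rightarrow> real) set \<Rightarrow> bool" where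
  "definable k S \<longleftrightarrow>
     (\<exists>p. rel_arities p = {} \<and> free_vars p \<subseteq> {..<k} \<and> S = {x \<in> Rvec k. sat {} x p})"


section \<open>Generalized projections\<close>

text \<open>The indices in \<open>s\<close> are 0-based: the conditions \<open>s\<^sub>1 < \<dots> < s\<^sub>r\<close> in
  \<open>{1..n}\<close> on the fixed components become \<open>sorted_wrt (<) s\<close> and \<open>set s \<subseteq> {..<n}\<close>, with \<open>r = length s\<close>.\<close>

definition generalized_section ::
    "(nat \<Rightarrow> real) set \<Rightarrow> nat list \<Rightarrow> real list \<Rightarrow> (nat \<Rightarrow> real) set" where
  "generalized_section X s a = {x \<in> X. \<forall>j<length s. x (s ! j) = a ! j}"

definition remove_components :: "nat \<Rightarrow> nat list \<Rightarrow> (nat \<Rightarrow> real) \<Rightarrow> nat \<Rightarrow> real" where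
  "remove_components n s x = vec_of_list (map x (filter (\<lambda>i. i \<notin> set s) [0..<n]))"

definition generalized_projection ::
    "nat \<Rightarrow> (nat \<Rightarrow> real) set \<Rightarrow> nat list \<Rightarrow> real list \<Rightarrow> (nat \<Rightarrow> real) set" where
  "generalized_projection n X s a = remove_components n s ` generalized_section X s a"


section \<open>Quasi-singular points\<close>

definition quasi_strata ::
    "nat \<Rightarrow> (nat \<Rightarrow> real) set \<Rightarrow> (nat \<Rightarrow> real) \<Rightarrow> real \<Rightarrow> real \<Rightarrow> (nat \<Rightarrow> real) set" where
  "quasi_strata m Y x r s =
     {v \<in> Rvec m. max_norm m v \<le> s \<and>
        (\<forall>y \<in> Rvec m. y \<in> max_ball m x r \<and> (\<lambda>i. y i + v i) \<in> max_ball m x r \<longrightarrow>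
           (y \<in> Y \<longleftrightarrow> (\<lambda>i. y i + v i) \<in> Y))}"

definition quasi_singular :: "nat \<Rightarrow> (nat \<Rightarrow> real) set \<Rightarrow> (nat \<Rightarrow> real) \<Rightarrow> bool" where
  "quasi_singular m Y x \<longleftrightarrow>
     \<not> (\<exists>r s. 0 < s \<and> s < r \<and>
          (\<exists>v \<in> quasi_strata m Y x r s. v \<noteq> (\<lambda>i. 0)) \<and>
          closedin (Euclidean_space m) (quasi_strata m Y x r s) \<and>
          (\<forall>v \<in> quasi_strata m Y x r s. (\<lambda>i. v i / 2) \<in> quasi_strata m Y x r s))"

end

theory Submission
  imports Defs "HOL-Library.Function_Algebras"
begin

text \<open>
  A point that is not quasi-singular has a nonzero stratum: a direction along which the set is
  locally invariant. The strata at \<open>x\<close> form a subspace, and the flat of \<open>x\<close> is the translate of it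
  through \<open>x\<close>.

  If all generalized projections have finitely many quasi-singular points, then there are only
  finitely many flats, by induction on the dimension of the section and of the flat: a
  point can be moved along its stratum until it reaches one of finitely many axis-parallel
  hyperplanes, and inside such a hyperplane the flat only depends on the sign class of the point with
  respect to the flats of the section and the flats of smaller dimension. Hence membership
  in \<open>X\<close> only depends on the signs of finitely many real affine forms. Consequently \<open>X\<close> is a cone near each
  point, the quasi-strata of a small rational ball are exactly the small strata at the
  apex, and the flats are pinned down by first-order definable sets. As nonempty definable
  sets have rational points, the flats and thus the affine forms are rational.

  Conversely, quantifier elimination shows that a definable set and its generalized projections
  are unions of sign classes of finitely many affine forms, and a quasi-singular point is the only
  common zero of the forms that vanish there.
\<close>

text \<open>The obstacle to rationality is that the definition of \<open>strata\<close> is not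
  first-order over addition and order: it multiplies \<open>v\<close> by a real \<open>t\<close>.
  The quasi-stratum condition for a fixed box multiplies nothing, but it is known to agree with
  \<open>strata\<close> only where the set is a cone. Therefore finiteness of the flats is exploited
  twice: once with real equations, which yields the cones, and once more with rational equations,
  found by means of the cones. Definability being without parameters, the apex of a cone cannot be
  named in a formula either; a box with a nearby rational center replaces it. Sections with
  arbitrary real values are needed because the induction fixes one coordinate at a time, at values
  over which there is no control. All dimensions share the type
  \<open>nat \<Rightarrow> real\<close>, made a real vector space by the instance below, so that a
  section is a translate of a coordinate subspace and coordinates are renumbered only when comparing
  with generalized projections.\<close>

instantiation "fun" :: (type, real_vector) real_vector
begin

definition scaleR_fun_def: "c *\<^sub>R f = (\<lambda>x. c *\<^sub>R f x)"

instance
  by standard (auto simp: scaleR_fun_def fun_eq_iff algebra_simps)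

end

lemma scaleR_fun_apply [simp]: "(c *\<^sub>R f) x = c *\<^sub>R f x"
  by (simp add: scaleR_fun_def)

lemma sum_fun_apply [simp]: "(\<Sum>i\<in>A. f i) x = (\<Sum>i\<in>A. f i x)"
  for f :: "'a \<Rightarrow> 'b \<Rightarrow> 'c::comm_monoid_add"
  by (induction A rule: infinite_finite_induct) auto

type_synonym vec = "nat \<Rightarrow> real"

section \<open>Coordinate subspaces and boxes\<close>

definition coord_space :: "nat set \<Rightarrow> vec set" where
  "coord_space K = {v. \<forall>j. j \<notin> K \<longrightarrow> v j = 0}"

text \<open>The open max-norm box around 0, without reference to a dimension: on
  \<open>coord_space K\<close> the coordinates outside \<open>K\<close> contribute only the
  condition \<open>e > 0\<close>.\<close>

definition small :: "real \<Rightarrow> vec \<Rightarrow> bool" where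
  "small e u \<longleftrightarrow> (\<forall>i. \<bar>u i\<bar> < e)"

lemma subspace_coord_space: "subspace (coord_space K)"
  by (auto simp: subspace_def coord_space_def)

lemmas coord_space_add = subspace_add[OF subspace_coord_space]
lemmas coord_space_diff = subspace_diff[OF subspace_coord_space]
lemmas coord_space_scale = subspace_scale[OF subspace_coord_space]
lemmas coord_space_0 = subspace_0[OF subspace_coord_space]
lemmas coord_space_neg = subspace_neg[OF subspace_coord_space]
lemmas coord_space_closed =
  coord_space_add coord_space_diff coord_space_scale coord_space_0 coord_space_neg

lemma Rvec_eq_coord_space: "Rvec n = coord_space {..<n}"
  by (auto simp: topspace_Euclidean_space coord_space_def)

lemma coord_space_mono: "K \<subseteq> L \<Longrightarrow> coord_space K \<subseteq> coord_space L"
  by (auto simp: coord_space_def)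

lemma coord_space_bounded:
  assumes "finite K" "v \<in> coord_space K"
  obtains M where "M > 0" "\<And>i. \<bar>v i\<bar> < M"
proof
  let ?M = "1 + (\<Sum>i\<in>K. \<bar>v i\<bar>)"
  have nonneg: "0 \<le> (\<Sum>i\<in>K. \<bar>v i\<bar>)" by (simp add: sum_nonneg)
  then show "?M > 0" by linarith
  show "\<bar>v i\<bar> < ?M" for i
  proof (cases "i \<in> K")
    case True
    then have "\<bar>v i\<bar> \<le> (\<Sum>i\<in>K. \<bar>v i\<bar>)"
      using assms(1) by (intro member_le_sum) auto
    then show ?thesis by simp
  next
    case False
    then have "v i = 0" using assms(2) by (simp add: coord_space_def)
    then show ?thesis using nonneg by linarith
  qed
qed

lemma small_zero [simp]: "small e 0 \<longleftrightarrow> e > 0"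
  by (simp add: small_def)

lemma small_pos: "small e u \<Longrightarrow> e > 0"
  by (meson abs_ge_zero le_less_trans small_def)

lemma small_mono: "small e u \<Longrightarrow> e \<le> e' \<Longrightarrow> small e' u"
  by (auto simp: small_def intro: less_le_trans)

lemma small_minus [simp]: "small e (- u) \<longleftrightarrow> small e u"
  by (simp add: small_def)

lemma small_add: "small a u \<Longrightarrow> small b v \<Longrightarrow> a + b \<le> c \<Longrightarrow> small c (u + v)"
  unfolding small_def plus_fun_apply
  by (meson abs_triangle_ineq add_strict_mono le_less_trans order_less_le_trans)

lemma small_scale:
  assumes "small e u" "\<bar>c\<bar> \<le> 1"
  shows "small e (c *\<^sub>R u)"
  unfolding small_def
proof
  fix i
  have "\<bar>c\<bar> * \<bar>u i\<bar> \<le> 1 * \<bar>u i\<bar>" using assms(2) by (intro mult_right_mono) auto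
  then show "\<bar>(c *\<^sub>R u) i\<bar> < e"
    using assms(1) by (simp add: small_def abs_mult) (meson le_less_trans)
qed

lemma ex_small_scale:
  assumes "finite K" "v \<in> coord_space K" "e > 0"
  obtains d where "d > 0" "\<And>t. \<bar>t\<bar> < d \<Longrightarrow> small e (t *\<^sub>R v)"
proof -
  obtain M where M: "M > 0" "\<And>i. \<bar>v i\<bar> < M"
    using coord_space_bounded[OF assms(1,2)] by blast
  have "small e (t *\<^sub>R v)" if "\<bar>t\<bar> < e / M" for t
    unfolding small_def
  proof
    fix i
    have "\<bar>t\<bar> * \<bar>v i\<bar> \<le> \<bar>t\<bar> * M" using M(2)[of i] by (intro mult_left_mono) auto
    also have "\<dots> < e" using that M(1) by (simp add: field_simps)
    finally show "\<bar>(t *\<^sub>R v) i\<bar> < e" by (simp add: abs_mult)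
  qed
  then show thesis using that M(1) assms(3) by (meson divide_pos_pos)
qed

section \<open>Strata and germs\<close>

text \<open>The generalized projections of \<open>X\<close> are treated inside the ambient space: \<open>K\<close> is the set of
  free components, and the section through \<open>x\<close> is \<open>x + coord_space K\<close>. The definition uses a small box
  and small multiples of \<open>v\<close> instead of one ball, which makes the strata a subspace.\<close>

definition strata :: "vec set \<Rightarrow> nat set \<Rightarrow> vec \<Rightarrow> vec set" where
  "strata X K x = {v \<in> coord_space K. \<exists>e>0. \<forall>u\<in>coord_space K. \<forall>t.
     small e u \<longrightarrow> \<bar>t\<bar> < e \<longrightarrow> (x + u \<in> X \<longleftrightarrow> x + u + t *\<^sub>R v \<in> X)}"

text \<open>Germs of \<open>X\<close> at two points, compared by translation within the free
  directions. Membership in \<open>X\<close> and strata are invariants of this relation, so it is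
  what gets transported along a stratum.\<close>

definition germ_eq :: "vec set \<Rightarrow> nat set \<Rightarrow> vec \<Rightarrow> vec \<Rightarrow> bool" where
  "germ_eq X K x y \<longleftrightarrow>
     (\<exists>e>0. \<forall>u\<in>coord_space K. small e u \<longrightarrow> (x + u \<in> X \<longleftrightarrow> y + u \<in> X))"

definition flat :: "vec set \<Rightarrow> nat set \<Rightarrow> vec \<Rightarrow> vec set" where
  "flat X K x = (\<lambda>v. x + v) ` strata X K x"

lemma mem_flat_iff: "y \<in> flat X K x \<longleftrightarrow> y - x \<in> strata X K x"
proof
  assume "y - x \<in> strata X K x"
  then show "y \<in> flat X K x" unfolding flat_def by (rule rev_image_eqI) simp
qed (auto simp: flat_def)

lemma strataE:
  assumes "v \<in> strata X K x"
  obtains e where "e > 0" "\<And>u t. u \<in> coord_space K \<Longrightarrow> small e u \<Longrightarrow> \<bar>t\<bar> < e \<Longrightarrow>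
    x + u \<in> X \<longleftrightarrow> x + u + t *\<^sub>R v \<in> X"
  using assms unfolding strata_def by blast

lemma strataI:
  assumes "v \<in> coord_space K" "e > 0"
    and "\<And>u t. u \<in> coord_space K \<Longrightarrow> small e u \<Longrightarrow> \<bar>t\<bar> < e \<Longrightarrow>
      x + u \<in> X \<longleftrightarrow> x + u + t *\<^sub>R v \<in> X"
  shows "v \<in> strata X K x"
  unfolding strata_def using assms by blast

lemma strata_coord_space: "v \<in> strata X K x \<Longrightarrow> v \<in> coord_space K"
  by (simp add: strata_def)

text \<open>For a sum, the point reached after translating by \<open>t v\<close> must still be in
  the box where \<open>w\<close> is valid; for a multiple, the factor \<open>c\<close> is absorbed
  into the bound on \<open>t\<close>.\<close>

lemma subspace_strata:
  assumes "finite K"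
  shows "subspace (strata X K x)"
  unfolding subspace_def
proof (intro conjI ballI allI)
  show "0 \<in> strata X K x"
    by (rule strataI[of _ _ 1]) (auto simp: coord_space_0)
next
  fix v w assume v: "v \<in> strata X K x" and w: "w \<in> strata X K x"
  obtain e1 where e1: "e1 > 0" "\<And>u t. u \<in> coord_space K \<Longrightarrow> small e1 u \<Longrightarrow> \<bar>t\<bar> < e1 \<Longrightarrow>
    x + u \<in> X \<longleftrightarrow> x + u + t *\<^sub>R v \<in> X" using strataE[OF v] by blast
  obtain e2 where e2: "e2 > 0" "\<And>u t. u \<in> coord_space K \<Longrightarrow> small e2 u \<Longrightarrow> \<bar>t\<bar> < e2 \<Longrightarrow>
    x + u \<in> X \<longleftrightarrow> x + u + t *\<^sub>R w \<in> X" using strataE[OF w] by blast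
  obtain d where d: "d > 0" "\<And>t. \<bar>t\<bar> < d \<Longrightarrow> small (e2/2) (t *\<^sub>R v)"
    using ex_small_scale[OF assms strata_coord_space[OF v], of "e2/2"] e2(1) by auto
  define e where "e = min d (min e1 (e2/2))"
  have "x + u \<in> X \<longleftrightarrow> x + u + t *\<^sub>R (v + w) \<in> X"
    if u: "u \<in> coord_space K" "small e u" "\<bar>t\<bar> < e" for u t
  proof -
    have s: "small e1 u" "small (e2/2) u" using u(2) by (auto intro: small_mono simp: e_def)
    have t: "\<bar>t\<bar> < d" "\<bar>t\<bar> < e1" "\<bar>t\<bar> < e2" using u(3) e2(1) by (auto simp: e_def)
    have "x + u \<in> X \<longleftrightarrow> x + (u + t *\<^sub>R v) \<in> X"
      using e1(2)[OF u(1) s(1) t(2)] by (simp add: add.assoc)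
    also have "\<dots> \<longleftrightarrow> x + (u + t *\<^sub>R v) + t *\<^sub>R w \<in> X"
      using strata_coord_space[OF v] u(1) t
      by (intro e2(2) small_add[OF s(2) d(2)] coord_space_add coord_space_scale) auto
    finally show ?thesis by (simp add: algebra_simps)
  qed
  then show "v + w \<in> strata X K x"
    by (rule strataI[of _ _ e, rotated 2])
      (use d(1) e1(1) e2(1) v w in \<open>auto simp: e_def coord_space_add strata_coord_space\<close>)
next
  fix c v assume v: "v \<in> strata X K x"
  obtain e1 where e1: "e1 > 0" "\<And>u t. u \<in> coord_space K \<Longrightarrow> small e1 u \<Longrightarrow> \<bar>t\<bar> < e1 \<Longrightarrow>
    x + u \<in> X \<longleftrightarrow> x + u + t *\<^sub>R v \<in> X" using strataE[OF v] by blast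
  define e where "e = e1 / (1 + \<bar>c\<bar>)"
  have e: "e > 0" "e \<le> e1"
    using e1(1) by (auto simp: e_def divide_le_eq intro: mult_right_le_one_le)
  have "x + u \<in> X \<longleftrightarrow> x + u + t *\<^sub>R (c *\<^sub>R v) \<in> X"
    if u: "u \<in> coord_space K" "small e u" "\<bar>t\<bar> < e" for u t
  proof -
    have "\<bar>t\<bar> * (1 + \<bar>c\<bar>) < e1" using u(3) by (simp add: e_def field_simps)
    then have "\<bar>t * c\<bar> < e1" by (simp add: abs_mult algebra_simps)
    then show ?thesis using e1(2)[OF u(1) small_mono[OF u(2) e(2)]] by simp
  qed
  then show "c *\<^sub>R v \<in> strata X K x"
    by (rule strataI[OF coord_space_scale[OF strata_coord_space[OF v]] e(1)])
qed

lemma germ_eq_refl [simp]: "germ_eq X K x x"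
  unfolding germ_eq_def by (auto intro: exI[of _ 1])

lemma germ_eq_sym: "germ_eq X K x y \<Longrightarrow> germ_eq X K y x"
  unfolding germ_eq_def by blast

lemma germ_eq_trans:
  assumes "germ_eq X K x y" "germ_eq X K y z"
  shows "germ_eq X K x z"
proof -
  obtain e1 where e1: "e1 > 0"
    "\<forall>u\<in>coord_space K. small e1 u \<longrightarrow> (x + u \<in> X \<longleftrightarrow> y + u \<in> X)"
    using assms(1) unfolding germ_eq_def by blast
  obtain e2 where e2: "e2 > 0"
    "\<forall>u\<in>coord_space K. small e2 u \<longrightarrow> (y + u \<in> X \<longleftrightarrow> z + u \<in> X)"
    using assms(2) unfolding germ_eq_def by blast
  show ?thesis unfolding germ_eq_def
  proof (intro exI[of _ "min e1 e2"] conjI ballI impI)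
    fix u assume "u \<in> coord_space K" "small (min e1 e2) u"
    moreover from this have "small e1 u" "small e2 u" by (auto intro: small_mono)
    ultimately show "x + u \<in> X \<longleftrightarrow> z + u \<in> X" using e1(2) e2(2) by blast
  qed (use e1(1) e2(1) in simp)
qed

lemma germ_eq_class:
  assumes "germ_eq X K x y"
  shows "{z. germ_eq X K x z} = {z. germ_eq X K y z}"
  using germ_eq_trans[OF germ_eq_sym[OF assms]] germ_eq_trans[OF assms] by blast

lemma germ_eq_mem: "germ_eq X K x y \<Longrightarrow> x \<in> X \<longleftrightarrow> y \<in> X"
  unfolding germ_eq_def using coord_space_0[of K] by (metis add_0_right small_zero)

lemma germ_eq_shift:
  assumes "germ_eq X K x y"
  obtains e where "e > 0" "\<And>u. u \<in> coord_space K \<Longrightarrow> small e u \<Longrightarrow> germ_eq X K (x + u) (y + u)"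
proof -
  obtain e where e: "e > 0" "\<And>u. u\<in>coord_space K \<Longrightarrow> small e u \<Longrightarrow> (x + u \<in> X \<longleftrightarrow> y + u \<in> X)"
    using assms unfolding germ_eq_def by blast
  have "germ_eq X K (x + u) (y + u)" if u: "u \<in> coord_space K" "small (e/2) u" for u
    unfolding germ_eq_def
  proof (intro exI[of _ "e/2"] conjI ballI impI)
    fix w assume "w \<in> coord_space K" "small (e/2) w"
    then show "x + u + w \<in> X \<longleftrightarrow> y + u + w \<in> X"
      using e(2)[of "u + w"] u by (simp add: add.assoc coord_space_add small_add)
  qed (use e in simp)
  then show thesis using that[of "e/2"] e(1) by simp
qed

text \<open>Openness of strata: half of the radius is spent on \<open>u\<close>, the other half is
  left for the germ at the shifted point.\<close>

lemma stratum_shift: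
  assumes "w \<in> strata X K x"
  obtains e where "e > 0"
    "\<And>u t. u \<in> coord_space K \<Longrightarrow> small e u \<Longrightarrow> \<bar>t\<bar> < e \<Longrightarrow> germ_eq X K (x + u) (x + u + t *\<^sub>R w)"
    "\<And>u. u \<in> coord_space K \<Longrightarrow> small e u \<Longrightarrow> w \<in> strata X K (x + u)"
proof -
  obtain e where e: "e > 0" "\<And>u t. u \<in> coord_space K \<Longrightarrow> small e u \<Longrightarrow> \<bar>t\<bar> < e \<Longrightarrow>
    x + u \<in> X \<longleftrightarrow> x + u + t *\<^sub>R w \<in> X" using strataE[OF assms] by blast
  have *: "x + u + u' \<in> X \<longleftrightarrow> x + u + u' + t *\<^sub>R w \<in> X"
    if u: "u \<in> coord_space K" "small (e/2) u" and u': "u' \<in> coord_space K" "small (e/2) u'"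
      and t: "\<bar>t\<bar> < e/2" for u u' t
    using e(2)[of "u + u'" t] u u' t
    by (simp add: add.assoc coord_space_add small_add)
  show thesis
  proof
    show "e/2 > 0" using e(1) by simp
    show "w \<in> strata X K (x + u)" if "u \<in> coord_space K" "small (e/2) u" for u
      by (rule strataI[OF strata_coord_space[OF assms] \<open>e/2 > 0\<close> *[OF that]])
    show "germ_eq X K (x + u) (x + u + t *\<^sub>R w)"
      if u: "u \<in> coord_space K" "small (e/2) u" and t: "\<bar>t\<bar> < e/2" for u t
      unfolding germ_eq_def
    proof (intro exI[of _ "e/2"] conjI ballI impI)
      fix u' assume "u' \<in> coord_space K" "small (e/2) u'"
      then have "x + u + u' \<in> X \<longleftrightarrow> x + u + u' + t *\<^sub>R w \<in> X" using * u t by blast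
      then show "x + u + u' \<in> X \<longleftrightarrow> x + u + t *\<^sub>R w + u' \<in> X"
        by (simp add: algebra_simps)
    qed (use \<open>e/2 > 0\<close> in simp)
  qed
qed

lemma germ_eq_strata:
  assumes "finite K" "germ_eq X K x y"
  shows "strata X K x = strata X K y"
proof -
  have sub: "strata X K x \<subseteq> strata X K y" if g: "germ_eq X K x y" for x y
  proof
    fix v assume v: "v \<in> strata X K x"
    obtain e1 where e1: "e1 > 0" "\<And>u t. u \<in> coord_space K \<Longrightarrow> small e1 u \<Longrightarrow> \<bar>t\<bar> < e1 \<Longrightarrow>
      x + u \<in> X \<longleftrightarrow> x + u + t *\<^sub>R v \<in> X" using strataE[OF v] by blast
    obtain e2 where e2: "e2 > 0" "\<And>u. u\<in>coord_space K \<Longrightarrow> small e2 u \<Longrightarrow> (x + u \<in> X \<longleftrightarrow> y + u \<in> X)"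
      using g unfolding germ_eq_def by blast
    obtain d where d: "d > 0" "\<And>t. \<bar>t\<bar> < d \<Longrightarrow> small (e2/2) (t *\<^sub>R v)"
      using ex_small_scale[OF assms(1) strata_coord_space[OF v], of "e2/2"] e2(1) by auto
    define e where "e = min d (min e1 (e2/2))"
    have "y + u \<in> X \<longleftrightarrow> y + u + t *\<^sub>R v \<in> X"
      if u: "u \<in> coord_space K" "small e u" "\<bar>t\<bar> < e" for u t
    proof -
      have s: "small e1 u" "small (e2/2) u" using u(2) by (auto intro: small_mono simp: e_def)
      have t: "\<bar>t\<bar> < d" "\<bar>t\<bar> < e1" using u(3) by (auto simp: e_def)
      have "y + u \<in> X \<longleftrightarrow> x + u \<in> X"
        using e2(2)[OF u(1)] small_mono[OF s(2), of e2] e2(1) by auto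
      also have "\<dots> \<longleftrightarrow> x + (u + t *\<^sub>R v) \<in> X"
        using e1(2)[OF u(1) s(1) t(2)] by (simp add: add.assoc)
      also have "\<dots> \<longleftrightarrow> y + (u + t *\<^sub>R v) \<in> X"
        using strata_coord_space[OF v] u(1) t
        by (intro e2(2) small_add[OF s(2) d(2)] coord_space_add coord_space_scale) auto
      finally show ?thesis by (simp add: add.assoc)
    qed
    moreover have "e > 0" using d(1) e1(1) e2(1) by (simp add: e_def)
    ultimately show "v \<in> strata X K y"
      using strataI[OF strata_coord_space[OF v], of e] by blast
  qed
  show ?thesis using sub assms(2) germ_eq_sym by blast
qed

lemma self_in_flat: "finite K \<Longrightarrow> x \<in> flat X K x"
  by (simp add: mem_flat_iff subspace_0[OF subspace_strata])

text \<open>Equal germs only make the two flats parallel; the third hypothesis puts \<open>y\<close>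
  on the flat of \<open>x\<close>.\<close>

lemma germ_eq_flat:
  assumes "finite K" "germ_eq X K x y" "y - x \<in> strata X K x"
  shows "flat X K x = flat X K y"
proof -
  have eq: "strata X K x = strata X K y" by (rule germ_eq_strata[OF assms(1,2)])
  note sub = subspace_strata[OF assms(1), of X x]
  have "z - x \<in> strata X K x \<longleftrightarrow> z - y \<in> strata X K x" for z
    using subspace_add[OF sub, of "z - y" "y - x"] subspace_diff[OF sub, of "z - x" "y - x"]
      assms(3) by auto
  then show ?thesis by (auto simp: mem_flat_iff eq)
qed

text \<open>In the second case \<open>b\<close> is the first exit from \<open>T\<close>, the infimum
  of a closed set.\<close>

lemma open_interval_cases:
  fixes T :: "real set"
  assumes "open T" "0 \<in> T"
  obtains "\<And>t. t \<ge> 0 \<Longrightarrow> t \<in> T" | b where "b > 0" "b \<notin> T" "\<And>t. 0 \<le> t \<Longrightarrow> t < b \<Longrightarrow> t \<in> T"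
proof (cases "\<forall>t\<ge>0. t \<in> T")
  case False
  define S where "S = {0..} - T"
  have S: "closed S" "S \<noteq> {}" "bdd_below S"
    using False assms(1) by (auto simp: S_def intro: closed_Diff)
  define b where "b = Inf S"
  have "b \<in> S" unfolding b_def by (rule closed_contains_Inf[OF S(2,3,1)])
  moreover have "t \<in> T" if "0 \<le> t" "t < b" for t
  proof (rule ccontr)
    assume "t \<notin> T"
    then have "t \<in> S" using that by (simp add: S_def)
    then have "b \<le> t" unfolding b_def using S(3) by (rule cInf_lower)
    then show False using that by simp
  qed
  moreover have "b > 0" using \<open>b \<in> S\<close> assms(2) by (cases "b = 0") (auto simp: S_def)
  ultimately show thesis using that(2)[of b] by (auto simp: S_def)
qed (use that in blast)

text \<open>The germ class as a function of the parameter is locally constant by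
  \<open>stratum_shift\<close>, and an interval is connected.\<close>

lemma germ_eq_segment:
  assumes "finite K" "w \<in> coord_space K" "a \<le> b"
    and "\<And>t. a \<le> t \<Longrightarrow> t \<le> b \<Longrightarrow> w \<in> strata X K (x + t *\<^sub>R w)"
  shows "germ_eq X K (x + a *\<^sub>R w) (x + b *\<^sub>R w)"
proof -
  define f where "f t = {y. germ_eq X K (x + t *\<^sub>R w) y}" for t
  have "f a = f b"
  proof (rule connected_local_const[of "{a..b}"])
    show "connected {a..b}" by simp
    show "\<forall>t\<in>{a..b}. eventually (\<lambda>t'. f t = f t') (at t within {a..b})"
    proof
      fix t assume t: "t \<in> {a..b}"
      then have w: "w \<in> strata X K (x + t *\<^sub>R w)" using assms(4) by simp
      obtain e where e: "e > 0" "\<And>u t'. u \<in> coord_space K \<Longrightarrow> small e u \<Longrightarrow> \<bar>t'\<bar> < e \<Longrightarrow>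
        germ_eq X K (x + t *\<^sub>R w + u) (x + t *\<^sub>R w + u + t' *\<^sub>R w)"
        by (rule stratum_shift[OF w]) (rule that)
      have "f t = f t'" if "dist t' t < e" for t'
      proof -
        have "germ_eq X K (x + t *\<^sub>R w) (x + t *\<^sub>R w + (t' - t) *\<^sub>R w)"
          using e(2)[of 0 "t' - t"] that e(1) by (simp add: coord_space_0 dist_real_def)
        moreover have "x + t *\<^sub>R w + (t' - t) *\<^sub>R w = x + t' *\<^sub>R w"
          by (simp add: algebra_simps)
        ultimately have "germ_eq X K (x + t *\<^sub>R w) (x + t' *\<^sub>R w)" by simp
        then show ?thesis unfolding f_def by (rule germ_eq_class)
      qed
      then show "eventually (\<lambda>t'. f t = f t') (at t within {a..b})"
        unfolding eventually_at using e(1) by blast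
    qed
  qed (use assms in auto)
  moreover have "x + b *\<^sub>R w \<in> f b" by (simp add: f_def)
  ultimately have "x + b *\<^sub>R w \<in> f a" by simp
  then show ?thesis by (simp add: f_def)
qed

lemma open_strata_line:
  assumes "finite K" "v \<in> coord_space K"
  shows "open {t. w \<in> strata X K (x + t *\<^sub>R v)}"
  unfolding open_dist
proof
  fix t assume "t \<in> {t. w \<in> strata X K (x + t *\<^sub>R v)}"
  then have w: "w \<in> strata X K (x + t *\<^sub>R v)" by simp
  obtain e where e: "e > 0" "\<And>u. u \<in> coord_space K \<Longrightarrow> small e u \<Longrightarrow>
     w \<in> strata X K (x + t *\<^sub>R v + u)" by (rule stratum_shift[OF w]) (rule that)
  obtain d where d: "d > 0" "\<And>t. \<bar>t\<bar> < d \<Longrightarrow> small e (t *\<^sub>R v)"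
    using ex_small_scale[OF assms e(1)] by blast
  have "w \<in> strata X K (x + t' *\<^sub>R v)" if "dist t' t < d" for t'
  proof -
    have "w \<in> strata X K (x + t *\<^sub>R v + (t' - t) *\<^sub>R v)"
      using that assms(2) by (intro e(2) d(2)) (auto simp: coord_space_scale dist_real_def)
    moreover have "x + t *\<^sub>R v + (t' - t) *\<^sub>R v = x + t' *\<^sub>R v" by (simp add: algebra_simps)
    ultimately show ?thesis by simp
  qed
  then show "\<exists>d>0. \<forall>t'. dist t' t < d \<longrightarrow> t' \<in> {t. w \<in> strata X K (x + t *\<^sub>R v)}"
    using d(1) by blast
qed

section \<open>Pivots of a subspace\<close>

text \<open>The number of pivots plays the role of the dimension.\<close>

definition pivots :: "vec set \<Rightarrow> nat set" where
  "pivots V = {j. \<exists>v\<in>V. v j \<noteq> 0 \<and> (\<forall>i>j. v i = 0)}"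

lemma pivots_subset: "V \<subseteq> coord_space K \<Longrightarrow> pivots V \<subseteq> K"
  by (auto simp: pivots_def coord_space_def)

lemma pivots_mono: "V \<subseteq> W \<Longrightarrow> pivots V \<subseteq> pivots W"
  by (auto simp: pivots_def)

text \<open>Gaussian elimination from the last nonzero coordinate: subtracting a multiple of an
  element of \<open>V\<close> with the same pivot lowers the bound \<open>k\<close> on the support
  of \<open>w\<close>.\<close>

lemma pivots_inject:
  assumes V: "subspace V" and W: "subspace W" "W \<subseteq> coord_space K" "finite K"
    and VW: "V \<subseteq> W" "pivots V = pivots W"
  shows "V = W"
proof -
  have "\<forall>w\<in>W. (\<forall>i\<ge>k. w i = 0) \<longrightarrow> w \<in> V" for k
  proof (induction k)
    case 0
    have "w = 0" if "\<forall>i\<ge>0. w i = 0" for w :: vec using that by (auto simp: fun_eq_iff)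
    then show ?case using subspace_0[OF V] by blast
  next
    case (Suc k)
    show ?case
    proof (intro ballI impI)
      fix w assume w: "w \<in> W" "\<forall>i\<ge>Suc k. w i = 0"
      show "w \<in> V"
      proof (cases "w k = 0")
        case True
        then have "\<forall>i\<ge>k. w i = 0" using w(2) by (metis le_antisym not_less_eq_eq)
        then show ?thesis using Suc w(1) by blast
      next
        case False
        then have "k \<in> pivots W" using w by (auto simp: pivots_def Suc_le_eq)
        then obtain v where v: "v \<in> V" "v k \<noteq> 0" "\<forall>i>k. v i = 0"
          unfolding VW(2)[symmetric] by (auto simp: pivots_def)
        define u where "u = w - (w k / v k) *\<^sub>R v"
        have "u \<in> W" unfolding u_def
          using v(1) w(1) VW(1) W(1) by (intro subspace_diff subspace_scale) auto
        moreover have "u i = 0" if "i \<ge> k" for i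
          using w(2) v(2,3) that by (cases "i = k") (auto simp: u_def)
        ultimately have "u \<in> V" using Suc by blast
        then have "u + (w k / v k) *\<^sub>R v \<in> V"
          using v(1) V by (intro subspace_add subspace_scale) auto
        then show ?thesis by (simp add: u_def)
      qed
    qed
  qed
  moreover have "\<exists>k. \<forall>i\<ge>k. w i = 0" if "w \<in> W" for w
  proof -
    obtain k where "\<forall>i\<in>K. i < k" using W(3) finite_nat_set_iff_bounded by blast
    then have "\<forall>i\<ge>k. i \<notin> K" by auto
    moreover have "\<forall>i. i \<notin> K \<longrightarrow> w i = 0" using W(2) that by (auto simp: coord_space_def)
    ultimately show ?thesis by blast
  qed
  ultimately show ?thesis using VW(1) by blast
qed

lemma card_pivots_less:
  assumes "subspace V" "subspace W" "W \<subseteq> coord_space K" "finite K" "V \<subset> W"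
  shows "card (pivots V) < card (pivots W)"
proof (rule psubset_card_mono)
  show "finite (pivots W)" using assms pivots_subset finite_subset by metis
  show "pivots V \<subset> pivots W"
    using pivots_mono pivots_inject[OF assms(1-4)] assms(5) by blast
qed

lemma pivots_empty:
  assumes "subspace V" "V \<subseteq> coord_space K" "finite K" "pivots V = {}"
  shows "V = {0}"
proof -
  have "pivots {0} = {}" by (auto simp: pivots_def)
  then have "{0} = V"
    using assms subspace_0[OF assms(1)] by (intro pivots_inject[OF _ assms(1-3)]) auto
  then show ?thesis ..
qed

text \<open>Back substitution from the largest pivot down: a vector with last nonzero coordinate
  \<open>?j\<close> corrects the value at \<open>?j\<close> without touching the larger
  pivots.\<close>

lemma pivots_interpolate:
  assumes V: "subspace V" "V \<subseteq> coord_space K" "finite K"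
  obtains v where "v \<in> V" "\<And>i. i \<in> pivots V \<Longrightarrow> v i = c i"
proof -
  obtain n where n: "\<forall>i\<in>pivots V. i < n"
    using finite_nat_set_iff_bounded pivots_subset[OF V(2)] V(3) finite_subset by metis
  have "\<exists>v\<in>V. \<forall>i\<in>pivots V. n - k \<le> i \<longrightarrow> v i = c i" for k
  proof (induction k)
    case 0
    then show ?case using subspace_0[OF V(1)] n by (intro bexI[of _ 0]) auto
  next
    case (Suc k)
    then obtain v where v: "v \<in> V" "\<forall>i\<in>pivots V. n - k \<le> i \<longrightarrow> v i = c i" by blast
    show ?case
    \<comment> \<open>For \<open>k \<ge> n\<close> the truncated differences \<open>n - k\<close>
      and \<open>n - Suc k\<close> are both 0, so the bound does not move.\<close>
    proof (cases "n - Suc k \<in> pivots V \<and> k < n")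
      case False
      have "n - k \<le> i" if "i \<in> pivots V" "n - Suc k \<le> i" for i
        using that False by (cases "i = n - Suc k") auto
      then show ?thesis using v by blast
    next
      case True
      let ?j = "n - Suc k"
      obtain u where u: "u \<in> V" "u ?j \<noteq> 0" "\<forall>i>?j. u i = 0" using True by (auto simp: pivots_def)
      let ?w = "v + ((c ?j - v ?j) / u ?j) *\<^sub>R u"
      have "?w \<in> V" using u(1) v(1) V(1) by (intro subspace_add subspace_scale)
      moreover have "?w i = c i" if "i \<in> pivots V" "?j \<le> i" for i
      proof (cases "i = ?j")
        case False
        then have "u i = 0" "n - k \<le> i" using u(3) that(2) True by auto
        then show ?thesis using v(2) that(1) by simp
      qed (use u(2) in simp)
      ultimately show ?thesis by blast
    qed
  qed
  from this[of n] show thesis using that by auto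
qed

lemma pivots_zero:
  assumes "v \<in> V" "V \<subseteq> coord_space K" "finite K" "\<And>i. i \<in> pivots V \<Longrightarrow> v i = 0"
  shows "v = 0"
proof (rule ccontr)
  assume "v \<noteq> 0"
  define S where "S = {i. v i \<noteq> 0}"
  have "S \<subseteq> K" using assms(1,2) by (auto simp: S_def coord_space_def)
  then have S: "finite S" "S \<noteq> {}"
    using \<open>v \<noteq> 0\<close> finite_subset[OF _ assms(3)] by (auto simp: S_def fun_eq_iff)
  have "Max S \<in> S" using S by (rule Max_in)
  moreover have "v i = 0" if "i > Max S" for i
    using that Max_ge[OF S(1), of i] by (auto simp: S_def)
  ultimately have "Max S \<in> pivots V" "v (Max S) \<noteq> 0"
    using assms(1) unfolding pivots_def S_def by blast+
  then show False using assms(4) by blast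
qed

text \<open>The reduced echelon basis: it is dual to the pivot coordinates, so the coefficient of
  \<open>b j\<close> in \<open>v\<close> is just \<open>v j\<close>.\<close>

lemma pivots_basis:
  assumes V: "subspace V" "V \<subseteq> coord_space K" "finite K"
  obtains b where "\<And>j. b j \<in> V" "\<And>i j. i \<in> pivots V \<Longrightarrow> b j i = (if i = j then 1 else 0)"
    "\<And>v. v \<in> V \<longleftrightarrow> v = (\<Sum>j\<in>pivots V. v j *\<^sub>R b j)"
proof -
  have "\<exists>v. v \<in> V \<and> (\<forall>i\<in>pivots V. v i = (if i = j then 1 else 0))" for j
    using pivots_interpolate[OF assms, of "\<lambda>i. if i = j then 1 else 0"] by metis
  then obtain b where b: "\<And>j. b j \<in> V"
    "\<And>i j. i \<in> pivots V \<Longrightarrow> b j i = (if i = j then 1 else 0)" by metis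
  have fin: "finite (pivots V)" using V(3) pivots_subset[OF V(2)] finite_subset by blast
  have "v = (\<Sum>j\<in>pivots V. v j *\<^sub>R b j)" if "v \<in> V" for v
  proof -
    let ?u = "v - (\<Sum>j\<in>pivots V. v j *\<^sub>R b j)"
    have "?u \<in> V" using that b(1) V(1) by (intro subspace_diff subspace_sum subspace_scale) auto
    moreover have "?u i = 0" if "i \<in> pivots V" for i
    proof -
      have "(\<Sum>j\<in>pivots V. v j * b j i) = (\<Sum>j\<in>pivots V. if j = i then v j else 0)"
        using b(2)[OF that] by (intro sum.cong) auto
      then show ?thesis using fin that by (simp add: sum.delta)
    qed
    ultimately have "?u = 0" using pivots_zero[OF _ V(2,3)] by blast
    then show ?thesis by simp
  qed
  moreover have "(\<Sum>j\<in>pivots V. v j *\<^sub>R b j) \<in> V" for v :: vec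
    using b(1) V(1) by (intro subspace_sum subspace_scale) auto
  ultimately have "v \<in> V \<longleftrightarrow> v = (\<Sum>j\<in>pivots V. v j *\<^sub>R b j)" for v by metis
  with b show thesis by (intro that[of b])
qed

section \<open>Affine forms and sign classes\<close>

definition affine_form :: "(vec \<Rightarrow> real) \<Rightarrow> bool" where
  "affine_form g \<longleftrightarrow> (\<exists>k c a. g = (\<lambda>e. c + (\<Sum>i<k. a i * e i)))"

lemma affine_formE:
  assumes "affine_form g"
  obtains k c a where "g = (\<lambda>e. c + (\<Sum>i<k. a i * e i))"
  using assms unfolding affine_form_def by blast

lemma affine_form_const [simp]: "affine_form (\<lambda>e. c)"
  unfolding affine_form_def by (intro exI[of _ 0] exI[of _ c]) auto

lemma affine_form_coord [simp]: "affine_form (\<lambda>e. e i)"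
  unfolding affine_form_def
proof (intro exI ext)
  fix e :: vec
  have "(\<Sum>j<Suc i. (if j = i then 1 else 0) * e j) = (\<Sum>j<Suc i. if j = i then e j else 0)"
    by (intro sum.cong) auto
  then show "e i = 0 + (\<Sum>j<Suc i. (if j = i then 1 else 0) * e j)" by simp
qed

lemma affine_form_extend:
  "(\<Sum>i<k. a i * e i) = (\<Sum>i<k + l. (if i < k then a i else 0) * e i)" for a e :: vec
  by (rule sum.mono_neutral_cong_left) auto

lemma affine_form_add:
  assumes "affine_form f" "affine_form g"
  shows "affine_form (\<lambda>e. f e + g e)"
proof -
  obtain k c a where f: "f = (\<lambda>e. c + (\<Sum>i<k. a i * e i))"
    using assms(1) by (rule affine_formE)
  obtain l d b where g: "g = (\<lambda>e. d + (\<Sum>i<l. b i * e i))"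
    using assms(2) by (rule affine_formE)
  show ?thesis unfolding affine_form_def
  proof (intro exI ext)
    fix e :: vec
    show "f e + g e = (c + d) +
      (\<Sum>i<k + l. ((if i < k then a i else 0) + (if i < l then b i else 0)) * e i)"
      unfolding f g affine_form_extend[of a e k l] affine_form_extend[of b e l k]
      by (simp only: sum.distrib distrib_right add.commute[of l k] add.assoc add.left_commute)
  qed
qed

lemma affine_form_scale:
  assumes "affine_form f"
  shows "affine_form (\<lambda>e. r * f e)"
proof -
  obtain k c a where *: "f = (\<lambda>e. c + (\<Sum>i<k. a i * e i))"
    using assms by (rule affine_formE)
  show ?thesis unfolding affine_form_def
  proof (intro exI ext)
    fix e :: vec
    show "r * f e = r * c + (\<Sum>i<k. (r * a i) * e i)"
      unfolding * by (simp only: distrib_left sum_distrib_left mult.assoc)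
  qed
qed

lemma affine_form_diff:
  assumes "affine_form f" "affine_form g"
  shows "affine_form (\<lambda>e. f e - g e)"
proof -
  have "(\<lambda>e. f e - g e) = (\<lambda>e. f e + (-1) * g e)" by (intro ext) simp
  then show ?thesis using affine_form_add[OF assms(1) affine_form_scale[OF assms(2), of "-1"]]
    by (simp only:)
qed

lemma affine_form_sum:
  assumes "\<And>j. j \<in> J \<Longrightarrow> affine_form (f j)"
  shows "affine_form (\<lambda>e. \<Sum>j\<in>J. f j e)"
  using assms
proof (induction J rule: infinite_finite_induct)
  case (insert j J)
  then have "affine_form (\<lambda>e. f j e + (\<Sum>j\<in>J. f j e))"
    by (intro affine_form_add) blast+
  then show ?case using insert(1,2) by simp
qed auto

lemmas affine_form_intros = affine_form_const affine_form_coord affine_form_add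
  affine_form_scale affine_form_diff affine_form_sum

text \<open>The linear part of \<open>g\<close> is written as \<open>g (x + w) - g x\<close>, which
  avoids naming the coefficients.\<close>

lemma affine_form_line:
  assumes "affine_form g"
  shows "g (x + t *\<^sub>R w) = g x + t * (g (x + w) - g x)"
proof -
  obtain k c a where g: "g = (\<lambda>e. c + (\<Sum>i<k. a i * e i))"
    using assms by (rule affine_formE)
  have "(\<Sum>i<k. a i * (x i + s * w i)) = (\<Sum>i<k. a i * x i) + s * (\<Sum>i<k. a i * w i)" for s
    unfolding sum_distrib_left sum.distrib[symmetric] by (rule sum.cong) (auto simp: algebra_simps)
  from this[of t] this[of 1] show ?thesis by (simp add: g)
qed

lemma affine_form_segment_sgn:
  assumes "affine_form g" "sgn (g x) = sgn (g (x + w))" "0 \<le> t" "t \<le> 1"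
  shows "sgn (g (x + t *\<^sub>R w)) = sgn (g x)"
proof -
  have eq: "g (x + t *\<^sub>R w) = (1 - t) * g x + t * g (x + w)"
    by (simp add: affine_form_line[OF assms(1)] algebra_simps)
  consider "t = 0" | "t = 1" | "0 < t" "t < 1" using assms(3,4) by (metis less_eq_real_def)
  then show ?thesis
  proof cases
    case 3
    consider "g x > 0" "g (x + w) > 0" | "g x = 0" "g (x + w) = 0" | "g x < 0" "g (x + w) < 0"
      using assms(2) by (metis linorder_neqE_linordered_idom sgn_0_0 sgn_greater sgn_less)
    then show ?thesis
    proof cases
      case 1
      then have "g (x + t *\<^sub>R w) > 0" using 3 unfolding eq by (intro add_pos_pos mult_pos_pos) auto
      then show ?thesis using 1 by simp
    next
      case 3
      then have "g (x + t *\<^sub>R w) < 0"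
        using \<open>0 < t\<close> \<open>t < 1\<close> unfolding eq by (intro add_neg_neg mult_pos_neg) auto
      then show ?thesis using 3 by simp
    next
      case 2
      then show ?thesis unfolding eq by simp
    qed
  next
    case 1
    then show ?thesis by simp
  next
    case 2
    then show ?thesis using assms(2) by simp
  qed
qed

lemma affine_form_lipschitz:
  assumes "affine_form g"
  obtains M where "M > 0" "\<And>x u e. small e u \<Longrightarrow> \<bar>g (x + u) - g x\<bar> \<le> M * e"
proof -
  obtain k c a where *: "g = (\<lambda>e. c + (\<Sum>i<k. a i * e i))"
    using assms by (rule affine_formE)
  define M where "M = 1 + (\<Sum>i<k. \<bar>a i\<bar>)"
  have "\<bar>g (x + u) - g x\<bar> \<le> M * e" if "small e u" for x u e
  proof -
    have "g (x + u) - g x = (\<Sum>i<k. a i * u i)"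
      by (simp only: * plus_fun_apply distrib_left sum.distrib)
    also have "\<bar>\<dots>\<bar> \<le> (\<Sum>i<k. \<bar>a i * u i\<bar>)" by (rule sum_abs)
    also have "\<dots> \<le> (\<Sum>i<k. \<bar>a i\<bar> * e)"
    proof (rule sum_mono)
      fix i
      have "\<bar>u i\<bar> \<le> e" using that by (simp add: small_def less_imp_le)
      then show "\<bar>a i * u i\<bar> \<le> \<bar>a i\<bar> * e" by (simp add: abs_mult mult_left_mono)
    qed
    also have "\<dots> \<le> M * e"
      using small_pos[OF that] by (simp only: M_def distrib_right sum_distrib_right)
    finally show ?thesis .
  qed
  moreover have "0 \<le> (\<Sum>i<k. \<bar>a i\<bar>)" by (simp add: sum_nonneg)
  then have "M > 0" unfolding M_def by linarith
  ultimately show thesis using that by blast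
qed

definition sign_invariant :: "(vec \<Rightarrow> real) set \<Rightarrow> vec set \<Rightarrow> vec set \<Rightarrow> bool" where
  "sign_invariant F D S \<longleftrightarrow>
     (\<forall>x\<in>D. \<forall>y\<in>D. (\<forall>g\<in>F. sgn (g x) = sgn (g y)) \<longrightarrow> (x \<in> S \<longleftrightarrow> y \<in> S))"

lemma finite_sign_patterns:
  fixes F :: "(vec \<Rightarrow> real) set"
  assumes "finite F"
  shows "finite (range (\<lambda>x. restrict (\<lambda>g. sgn (g x)) F))"
proof (rule finite_subset)
  show "range (\<lambda>x. restrict (\<lambda>g. sgn (g x)) F) \<subseteq> PiE F (\<lambda>_. {-1, 0, 1})"
  proof (intro image_subsetI PiE_I)
    show "restrict (\<lambda>g. sgn (g x)) F g \<in> {-1, 0, 1}" if "g \<in> F" for x g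
      using that by (simp add: sgn_real_def)
  qed (simp only: restrict_def if_False)
  show "finite (PiE F (\<lambda>_. {-1, 0, 1 :: real}))" using assms by (intro finite_PiE) auto
qed

text \<open>A sign class is a function from \<open>F\<close> to three values, so finitely many
  occur; a chosen representative of each class yields the value of \<open>h\<close> on it.\<close>

lemma finite_image_sign_classes:
  fixes F :: "(vec \<Rightarrow> real) set"
  assumes "finite F"
    and "\<And>x y. x \<in> S \<Longrightarrow> y \<in> S \<Longrightarrow> (\<And>g. g \<in> F \<Longrightarrow> sgn (g x) = sgn (g y)) \<Longrightarrow> h x = h y"
  shows "finite (h ` S)"
proof -
  define p where "p x = restrict (\<lambda>g. sgn (g x)) F" for x :: vec
  have fin: "finite (p ` S)"
    unfolding p_def by (rule finite_subset[OF _ finite_sign_patterns[OF assms(1)]]) blast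
  have *: "h x = h y" if "x \<in> S" "y \<in> S" "p x = p y" for x y
    using that(1,2)
  proof (rule assms(2))
    show "sgn (g x) = sgn (g y)" if "g \<in> F" for g
      using fun_cong[OF \<open>p x = p y\<close>, of g] that by (simp add: p_def)
  qed
  have "h ` S \<subseteq> (\<lambda>q. h (SOME x. x \<in> S \<and> p x = q)) ` (p ` S)"
  proof (intro image_subsetI)
    fix x assume x: "x \<in> S"
    define y where "y = (SOME y. y \<in> S \<and> p y = p x)"
    have y: "y \<in> S \<and> p y = p x" unfolding y_def by (rule someI[of _ x]) (use x in simp)
    have "h x = h y" by (rule *[OF x conjunct1[OF y] conjunct2[OF y, symmetric]])
    then show "h x \<in> (\<lambda>q. h (SOME x. x \<in> S \<and> p x = q)) ` (p ` S)"
      using x unfolding y_def by (intro image_eqI[of _ _ "p x"] imageI)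
  qed
  then show ?thesis by (rule finite_surj[OF fin])
qed

text \<open>In the reduced echelon basis each coordinate of a member is a fixed combination of its
  pivot coordinates, which gives one equation for each index in \<open>K\<close>.\<close>

lemma subspace_equations:
  assumes V: "subspace V" "V \<subseteq> coord_space K" "finite K"
  obtains F where "finite F" "\<And>g. g \<in> F \<Longrightarrow> affine_form g"
    "\<And>x. x - x0 \<in> coord_space K \<Longrightarrow> x - x0 \<in> V \<longleftrightarrow> (\<forall>g\<in>F. g x = 0)"
proof -
  obtain b where b: "\<And>v. v \<in> V \<longleftrightarrow> v = (\<Sum>j\<in>pivots V. v j *\<^sub>R b j)"
    using pivots_basis[OF assms] by metis
  define f where "f i x = (x i - x0 i) - (\<Sum>j\<in>pivots V. b j i * (x j - x0 j))" for i and x :: vec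
  show thesis
  proof
    show "finite (f ` K)" using V(3) by simp
    have "affine_form (f i)" for i
      unfolding f_def by (intro affine_form_intros)
    then show "affine_form g" if "g \<in> f ` K" for g using that by auto
    show "x - x0 \<in> V \<longleftrightarrow> (\<forall>g\<in>f ` K. g x = 0)" if x: "x - x0 \<in> coord_space K" for x
    proof -
      let ?s = "\<Sum>j\<in>pivots V. (x - x0) j *\<^sub>R b j"
      have "f i x = 0 \<longleftrightarrow> (x - x0) i = ?s i" for i
        by (simp add: f_def mult.commute)
      then have *: "(\<forall>g\<in>f ` K. g x = 0) \<longleftrightarrow> (\<forall>i\<in>K. (x - x0) i = ?s i)" by auto
      show ?thesis
      proof
        assume "x - x0 \<in> V"
        then show "\<forall>g\<in>f ` K. g x = 0" unfolding * using b[of "x - x0"] by metis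
      next
        assume "\<forall>g\<in>f ` K. g x = 0"
        then have eq: "\<forall>i\<in>K. (x - x0) i = ?s i" unfolding * .
        obtain w where w: "w \<in> V" "\<And>i. i \<in> pivots V \<Longrightarrow> w i = (x - x0) i"
          using pivots_interpolate[OF V] by metis
        have "w = (\<Sum>j\<in>pivots V. w j *\<^sub>R b j)" using b w(1) by blast
        also have "\<dots> = ?s" using w(2) by (intro sum.cong) auto
        finally have "w = ?s" .
        have "x - x0 = w"
        proof
          fix i show "(x - x0) i = w i"
            using eq x w(1) V(2) \<open>w = ?s\<close> by (cases "i \<in> K") (auto simp: coord_space_def)
        qed
        then show "x - x0 \<in> V" using w(1) by simp
      qed
    qed
  qed
qed

section \<open>Moving along strata\<close>

lemma strata_subset_coord_space: "strata X K x \<subseteq> coord_space K"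
  by (auto simp: strata_coord_space)

text \<open>Slide along \<open>v\<close> onto the hyperplane through \<open>x\<close>, translate by
  \<open>t w\<close> inside it, and slide back.\<close>

lemma transversal_strata:
  assumes "finite K" "v \<in> strata X K x" "v i = 1" "w \<in> strata X (K - {i}) x"
  shows "w \<in> strata X K x"
proof -
  have v: "v \<in> coord_space K" and w: "w \<in> coord_space (K - {i})"
    using assms(2,4) by (auto simp: strata_coord_space)
  then have wK: "w \<in> coord_space K" using coord_space_mono[of "K - {i}" K] by blast
  obtain e1 where e1: "e1 > 0" "\<And>u t. u \<in> coord_space K \<Longrightarrow> small e1 u \<Longrightarrow> \<bar>t\<bar> < e1 \<Longrightarrow>
    x + u \<in> X \<longleftrightarrow> x + u + t *\<^sub>R v \<in> X" using strataE[OF assms(2)] by blast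
  obtain e2 where e2: "e2 > 0" "\<And>u t. u \<in> coord_space (K - {i}) \<Longrightarrow> small e2 u \<Longrightarrow> \<bar>t\<bar> < e2 \<Longrightarrow>
    x + u \<in> X \<longleftrightarrow> x + u + t *\<^sub>R w \<in> X" using strataE[OF assms(4)] by blast
  \<comment> \<open>Three displacements, by \<open>u\<close>, by a multiple of \<open>v\<close> and
    by \<open>t w\<close>, have to fit into the box of radius \<open>e1\<close>.\<close>
  define m where "m = min e1 e2 / 3"
  have m: "m > 0" "m < e1" "m < e2" "m + m \<le> e2" "m + m + m \<le> e1"
    using e1(1) e2(1) by (auto simp: m_def)
  obtain d1 where d1: "d1 > 0" "\<And>t. \<bar>t\<bar> < d1 \<Longrightarrow> small m (t *\<^sub>R v)"
    using ex_small_scale[OF assms(1) v m(1)] by blast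
  obtain d2 where d2: "d2 > 0" "\<And>t. \<bar>t\<bar> < d2 \<Longrightarrow> small m (t *\<^sub>R w)"
    using ex_small_scale[OF assms(1) wK m(1)] by blast
  define e where "e = min m (min d1 d2)"
  show ?thesis
  proof (rule strataI[OF wK])
    show "e > 0" using m(1) d1(1) d2(1) by (simp add: e_def)
    fix u t assume u: "u \<in> coord_space K" "small e u" and t: "\<bar>t\<bar> < e"
    \<comment> \<open>The projection of \<open>u\<close> along \<open>v\<close>; its
      \<open>i\<close>-th coordinate is 0 because \<open>v i = 1\<close>.\<close>
    define u' where "u' = u - u i *\<^sub>R v"
    have ui: "\<bar>u i\<bar> < e" using u(2) by (simp add: small_def)
    have su: "small m u" using u(2) by (rule small_mono) (simp add: e_def)
    have sv: "small m (- (u i *\<^sub>R v))" using d1(2)[of "u i"] ui by (simp add: e_def)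
    have sw: "small m (t *\<^sub>R w)" using d2(2) t by (simp add: e_def)
    have su': "small e2 u'" "small (m + m) u'"
      unfolding u'_def diff_conv_add_uminus
      by (rule small_add[OF su sv m(4)], rule small_add[OF su sv order_refl])
    have u': "u' \<in> coord_space (K - {i})"
      using u(1) v assms(3) by (auto simp: u'_def coord_space_def)
    then have u'K: "u' \<in> coord_space K" using coord_space_mono[of "K - {i}" K] by blast
    have te: "\<bar>u i\<bar> < e1" "\<bar>t\<bar> < e2" using ui t m by (auto simp: e_def)
    have "x + u \<in> X \<longleftrightarrow> x + u + (- u i) *\<^sub>R v \<in> X"
      using e1(2)[OF u(1) small_mono[OF su less_imp_le[OF m(2)]], of "- u i"] te(1) by simp
    also have "x + u + (- u i) *\<^sub>R v = x + u'" by (simp add: u'_def)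
    also have "x + u' \<in> X \<longleftrightarrow> x + u' + t *\<^sub>R w \<in> X" by (rule e2(2)[OF u' su'(1) te(2)])
    also have "x + u' + t *\<^sub>R w = x + (u' + t *\<^sub>R w)" by (simp add: add.assoc)
    also have "x + (u' + t *\<^sub>R w) \<in> X \<longleftrightarrow> x + (u' + t *\<^sub>R w) + u i *\<^sub>R v \<in> X"
      by (rule e1(2)[OF coord_space_add[OF u'K coord_space_scale[OF wK]]
            small_add[OF su'(2) sw m(5)] te(1)])
    also have "x + (u' + t *\<^sub>R w) + u i *\<^sub>R v = x + u + t *\<^sub>R w" by (simp add: u'_def)
    finally show "x + u \<in> X \<longleftrightarrow> x + u + t *\<^sub>R w \<in> X" .
  qed
qed

text \<open>Strata can only shrink in a limit: \<open>v \<in> strata X K x\<close> is an open condition on \<open>x\<close>.\<close>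

lemma ray_cases:
  assumes "finite K" "v \<in> strata X K x"
  obtains "\<And>t. t \<ge> 0 \<Longrightarrow> germ_eq X K x (x + t *\<^sub>R v)"
  | b where "b > 0" "\<And>t. 0 \<le> t \<Longrightarrow> t < b \<Longrightarrow> germ_eq X K x (x + t *\<^sub>R v)"
      "v \<notin> strata X K (x + b *\<^sub>R v)" "strata X K (x + b *\<^sub>R v) \<subset> strata X K x"
proof -
  have v: "v \<in> coord_space K" using assms(2) by (rule strata_coord_space)
  define T where "T w = {t. w \<in> strata X K (x + t *\<^sub>R v)}" for w
  have T: "open (T w)" for w unfolding T_def by (rule open_strata_line[OF assms(1) v])
  have germ: "germ_eq X K x (x + t *\<^sub>R v)" if "0 \<le> t" "\<And>s. 0 \<le> s \<Longrightarrow> s \<le> t \<Longrightarrow> s \<in> T v" for t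
    using germ_eq_segment[OF assms(1) v that(1), of X x] that(2) by (simp add: T_def)
  have "0 \<in> T v" using assms(2) by (simp add: T_def)
  with T show thesis
  proof (cases rule: open_interval_cases)
    case 1
    then show ?thesis using germ that(1) by blast
  next
    case (2 b)
    have near: "germ_eq X K x (x + t *\<^sub>R v)" if "0 \<le> t" "t < b" for t
      by (rule germ[OF that(1)]) (use 2(3) that(2) in auto)
    have "strata X K (x + b *\<^sub>R v) \<subseteq> strata X K x"
    proof
      fix w assume "w \<in> strata X K (x + b *\<^sub>R v)"
      then have "b \<in> T w" by (simp add: T_def)
      then obtain e where e: "e > 0" "\<And>t. dist t b < e \<Longrightarrow> t \<in> T w"
        using T[of w] unfolding open_dist by blast
      \<comment> \<open>A parameter before \<open>b\<close>, where the germ is still that of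
        \<open>x\<close>, but so close to \<open>b\<close> that \<open>w\<close> is a stratum there
        too.\<close>
      define t where "t = b - min e b / 2"
      have "0 \<le> t" "t < b" "dist t b < e" using e(1) 2(1) by (auto simp: t_def dist_real_def)
      then have "w \<in> strata X K (x + t *\<^sub>R v)" "germ_eq X K x (x + t *\<^sub>R v)"
        using e(2)[of t] near by (auto simp: T_def)
      then show "w \<in> strata X K x" using germ_eq_strata[OF assms(1)] by blast
    qed
    moreover have "v \<notin> strata X K (x + b *\<^sub>R v)" using 2(2) by (simp add: T_def)
    ultimately show ?thesis using that(2)[OF 2(1) near] assms(2) by blast
  qed
qed

text \<open>Shortly before \<open>y\<close> on the ray the germ is that of \<open>x\<close>. As
  \<open>y\<close> and \<open>y'\<close> have equal germs, the same small step \<open>u\<close> away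
  from \<open>y'\<close> also reaches the germ of \<open>x\<close>; sliding along a stratum with
  nonzero \<open>i\<close>-th coordinate then restores the coordinate \<open>y' i\<close>.\<close>

lemma germ_eq_pull_back:
  assumes K: "finite K" and v: "v \<in> strata X K x" and b: "b > 0"
    and near: "\<And>t. 0 \<le> t \<Longrightarrow> t < b \<Longrightarrow> germ_eq X K x (x + t *\<^sub>R v)"
    and y: "y = x + b *\<^sub>R v" "strata X K y \<subseteq> strata X K x"
    and y': "germ_eq X K y y'" "y' - y \<in> strata X K y"
    and w: "w \<in> strata X K y" "w i \<noteq> 0"
  obtains x' where "x' - x \<in> strata X K x" "germ_eq X K x x'" "x' i = y' i"
proof -
  define w1 where "w1 = (1 / w i) *\<^sub>R w"
  have w1: "w1 \<in> strata X K y" "w1 i = 1"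
    using subspace_scale[OF subspace_strata[OF K] w(1)] w(2) by (auto simp: w1_def)
  then have w1': "w1 \<in> strata X K y'" using germ_eq_strata[OF K y'(1)] by simp
  obtain e1 where e1: "e1 > 0" "\<And>u. u \<in> coord_space K \<Longrightarrow> small e1 u \<Longrightarrow> germ_eq X K (y + u) (y' + u)"
    using germ_eq_shift[OF y'(1)] by blast
  obtain e2 where e2: "e2 > 0" "\<And>u t. u \<in> coord_space K \<Longrightarrow> small e2 u \<Longrightarrow> \<bar>t\<bar> < e2 \<Longrightarrow>
      germ_eq X K (y' + u) (y' + u + t *\<^sub>R w1)"
    by (rule stratum_shift[OF w1']) (rule that)
  have vK: "v \<in> coord_space K" using v by (rule strata_coord_space)
  obtain d where d: "d > 0" "\<And>t. \<bar>t\<bar> < d \<Longrightarrow> small (min e1 e2) (t *\<^sub>R v)"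
    using ex_small_scale[OF K vK, of "min e1 e2"] e1(1) e2(1) by auto
  \<comment> \<open>A step back from \<open>y\<close> that does not pass \<open>x\<close> and stays
    in the boxes of \<open>e1\<close> and \<open>e2\<close>.\<close>
  define s where "s = - (min d b / 2)"
  define u where "u = s *\<^sub>R v"
  have s: "0 \<le> b + s" "b + s < b" "\<bar>s\<bar> < d" using d(1) b by (auto simp: s_def)
  have u: "u \<in> coord_space K" "small e1 u" "small e2 u"
    using d(2)[OF s(3)] coord_space_scale[OF vK] by (auto simp: u_def intro: small_mono)
  define x' where "x' = y' + u + (- u i) *\<^sub>R w1"
  show thesis
  proof
    show "x' i = y' i" using w1(2) by (simp add: x'_def)
    have "germ_eq X K x (y + u)"
      using near[OF s(1,2)] by (simp add: y(1) u_def scaleR_add_left add.assoc)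
    moreover have "germ_eq X K (y + u) (y' + u)" by (rule e1(2)[OF u(1,2)])
    moreover have "germ_eq X K (y' + u) x'"
      unfolding x'_def using u(3) by (intro e2(2)[OF u(1,3)]) (simp add: small_def)
    ultimately show "germ_eq X K x x'" using germ_eq_trans by blast
    have "x' - x = (y' - y) + (b *\<^sub>R v + (s *\<^sub>R v + (- u i) *\<^sub>R w1))"
      by (simp add: x'_def y(1) u_def)
    then show "x' - x \<in> strata X K x"
      using subspace_strata[OF K, of X x] y(2) y'(2) v w1(1)
      by (auto intro!: subspace_add subspace_scale simp del: scaleR_minus_left)
  qed
qed

lemma ex_separating_set:
  fixes S :: "real set"
  assumes "finite S"
  obtains A where "finite A" "A \<noteq> {}" "\<And>\<alpha> \<beta>. \<alpha> \<in> S \<Longrightarrow> \<beta> \<in> S \<Longrightarrow> \<alpha> < \<beta> \<Longrightarrow> \<exists>c\<in>A. \<alpha> < c \<and> c < \<beta>"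
    "\<And>\<alpha>. \<alpha> \<in> S \<Longrightarrow> \<exists>c\<in>A. \<alpha> < c" "\<And>\<alpha>. \<alpha> \<in> S \<Longrightarrow> \<exists>c\<in>A. c < \<alpha>"
proof
  \<comment> \<open>Midpoints of pairs, a point on either side of each element, and 0 for the case
    of an empty \<open>S\<close>.\<close>
  let ?A = "insert 0 ((\<lambda>(\<alpha>, \<beta>). (\<alpha> + \<beta>) / 2) ` (S \<times> S) \<union> (\<lambda>\<alpha>. \<alpha> + 1) ` S \<union> (\<lambda>\<alpha>. \<alpha> - 1) ` S)"
  show "finite ?A" using assms by simp
  show "\<exists>c\<in>?A. \<alpha> < c \<and> c < \<beta>" if "\<alpha> \<in> S" "\<beta> \<in> S" "\<alpha> < \<beta>" for \<alpha> \<beta>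
    using that by (intro bexI[of _ "(\<alpha> + \<beta>) / 2"]) force+
  show "\<exists>c\<in>?A. \<alpha> < c" if "\<alpha> \<in> S" for \<alpha> using that by (intro bexI[of _ "\<alpha> + 1"]) auto
  show "\<exists>c\<in>?A. c < \<alpha>" if "\<alpha> \<in> S" for \<alpha> using that by (intro bexI[of _ "\<alpha> - 1"]) auto
qed simp

text \<open>A point is moved along its stratum until it reaches a hyperplane \<open>x i = c\<close> with \<open>c \<in> A\<close>.
  On the way it can only run into points with a smaller stratum. If such a stratum is still
  transversal to the hyperplanes, the point reached from there by induction has points with
  the original germ next to it; otherwise the \<open>i\<close>-th coordinate of the
  end point belongs to the finite set that \<open>A\<close> separates.\<close>

lemma reach_hyperplane:
  assumes K: "finite K"
    and A: "A \<noteq> {}" "\<And>\<alpha> \<beta>. \<alpha> \<in> S \<Longrightarrow> \<beta> \<in> S \<Longrightarrow> \<alpha> < \<beta> \<Longrightarrow> \<exists>c\<in>A. \<alpha> < c \<and> c < \<beta>"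
      "\<And>\<alpha>. \<alpha> \<in> S \<Longrightarrow> \<exists>c\<in>A. \<alpha> < c" "\<And>\<alpha>. \<alpha> \<in> S \<Longrightarrow> \<exists>c\<in>A. c < \<alpha>"
    and S: "\<And>y. y - a \<in> coord_space K \<Longrightarrow> card (pivots (strata X K y)) < d \<Longrightarrow>
      (\<And>w. w \<in> strata X K y \<Longrightarrow> w i = 0) \<Longrightarrow> y i \<in> S"
    and x: "x - a \<in> coord_space K" "card (pivots (strata X K x)) \<le> d"
      "\<exists>v\<in>strata X K x. v i \<noteq> 0"
  shows "\<exists>x'. x' - x \<in> strata X K x \<and> germ_eq X K x x' \<and> x' i \<in> A"
  using x
proof (induction "card (pivots (strata X K x))" arbitrary: x rule: less_induct)
  case less
  note sub = subspace_strata[OF K, of X]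
  obtain v0 where v0: "v0 \<in> strata X K x" "v0 i \<noteq> 0" using less.prems(3) by blast
  define v where "v = (1 / v0 i) *\<^sub>R v0"
  have v: "v \<in> strata X K x" "v i = 1" using subspace_scale[OF sub v0(1)] v0(2) by (auto simp: v_def)
  show ?case (is ?goal)
  proof (rule ccontr)
    assume neg: "\<not> ?goal"
    \<comment> \<open>The germ of \<open>x\<close> lasts along the whole ray, or up to a point whose
      \<open>i\<close>-th coordinate is in \<open>S\<close>; if that point were still transversal,
      the induction hypothesis there, pulled back to \<open>x\<close>, would contradict
      \<open>neg\<close>.\<close>
    have dir: "(\<forall>t\<ge>0. germ_eq X K x (x + t *\<^sub>R u)) \<or>
      (\<exists>b>0. (\<forall>t. 0 \<le> t \<longrightarrow> t < b \<longrightarrow> germ_eq X K x (x + t *\<^sub>R u)) \<and> (x + b *\<^sub>R u) i \<in> S)"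
      if u: "u \<in> strata X K x" for u
      using K u
    proof (cases rule: ray_cases)
      case (2 b)
      define y where "y = x + b *\<^sub>R u"
      have smaller: "card (pivots (strata X K y)) < card (pivots (strata X K x))"
        unfolding y_def using 2(4) by (intro card_pivots_less[OF sub sub strata_subset_coord_space K])
      have ya: "y - a \<in> coord_space K"
        using coord_space_add[OF less.prems(1) coord_space_scale[OF strata_coord_space[OF u]], of b]
        by (simp add: y_def algebra_simps)
      have "w i = 0" if w: "w \<in> strata X K y" for w
      proof (rule ccontr)
        assume wi: "w i \<noteq> 0"
        then obtain y' where y': "y' - y \<in> strata X K y" "germ_eq X K y y'" "y' i \<in> A"
          using less.hyps[OF smaller ya] smaller less.prems(2) w by auto
        have "strata X K y \<subseteq> strata X K x" using 2(4) by (auto simp: y_def)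
        from germ_eq_pull_back[OF K u 2(1,2) y_def this y'(2,1) w wi]
        obtain x' where "x' - x \<in> strata X K x" "germ_eq X K x x'" "x' i = y' i" by blast
        then show False using neg y'(3) by auto
      qed
      then have "y i \<in> S" by (rule S[OF ya less_le_trans[OF smaller less.prems(2)]])
      then show ?thesis using 2(1,2) unfolding y_def by blast
    qed blast
    have notin: "x i + t \<notin> A" if "germ_eq X K x (x + t *\<^sub>R v)" for t
      using neg that v subspace_scale[OF sub v(1), of t] by (auto dest: spec[of _ "x + t *\<^sub>R v"])
    have "- v \<in> strata X K x" using subspace_neg[OF sub v(1)] .
    from dir[OF this] dir[OF v(1)] have dirs:
      "(\<forall>t\<le>0. germ_eq X K x (x + t *\<^sub>R v)) \<or>
        (\<exists>b>0. (\<forall>t. - b < t \<longrightarrow> t \<le> 0 \<longrightarrow> germ_eq X K x (x + t *\<^sub>R v)) \<and> x i - b \<in> S)"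
      "(\<forall>t\<ge>0. germ_eq X K x (x + t *\<^sub>R v)) \<or>
        (\<exists>b>0. (\<forall>t. 0 \<le> t \<longrightarrow> t < b \<longrightarrow> germ_eq X K x (x + t *\<^sub>R v)) \<and> x i + b \<in> S)"
    proof -
      assume h: "(\<forall>t\<ge>0. germ_eq X K x (x + t *\<^sub>R - v)) \<or>
        (\<exists>b>0. (\<forall>t. 0 \<le> t \<longrightarrow> t < b \<longrightarrow> germ_eq X K x (x + t *\<^sub>R - v)) \<and> (x + b *\<^sub>R - v) i \<in> S)"
      have flip: "germ_eq X K x (x + t *\<^sub>R v)" if "germ_eq X K x (x + (- t) *\<^sub>R - v)" for t
        using that by simp
      show "(\<forall>t\<le>0. germ_eq X K x (x + t *\<^sub>R v)) \<or>
        (\<exists>b>0. (\<forall>t. - b < t \<longrightarrow> t \<le> 0 \<longrightarrow> germ_eq X K x (x + t *\<^sub>R v)) \<and> x i - b \<in> S)"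
        using h
      proof (elim disjE exE conjE)
        assume *: "\<forall>t\<ge>0. germ_eq X K x (x + t *\<^sub>R - v)"
        have "\<forall>t\<le>0. germ_eq X K x (x + t *\<^sub>R v)"
          by (intro allI impI flip, rule *[rule_format]) simp
        then show ?thesis by blast
      next
        fix b assume *: "b > 0" "\<forall>t. 0 \<le> t \<longrightarrow> t < b \<longrightarrow> germ_eq X K x (x + t *\<^sub>R - v)"
          "(x + b *\<^sub>R - v) i \<in> S"
        have "\<forall>t. - b < t \<longrightarrow> t \<le> 0 \<longrightarrow> germ_eq X K x (x + t *\<^sub>R v)"
          by (intro allI impI flip, rule *(2)[rule_format]) auto
        with * show ?thesis using v(2) by (intro disjI2 exI[of _ b]) simp
      qed
    qed (use v(2) in simp)
    \<comment> \<open>The germ of \<open>x\<close> holds for \<open>t\<close> in an open interval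
      around 0. Since \<open>v i = 1\<close>, the \<open>i\<close>-th coordinate maps it onto an
      interval whose finite ends are in \<open>S\<close>, so some element of \<open>A\<close> is
      met.\<close>
    have "\<exists>c\<in>A. germ_eq X K x (x + (c - x i) *\<^sub>R v)"
      using dirs
    proof (elim disjE exE conjE)
      assume lo: "\<forall>t\<le>0. germ_eq X K x (x + t *\<^sub>R v)" and up: "\<forall>t\<ge>0. germ_eq X K x (x + t *\<^sub>R v)"
      obtain c where "c \<in> A" using A(1) by blast
      then show ?thesis using lo[rule_format, of "c - x i"] up[rule_format, of "c - x i"] by (cases "c \<le> x i") auto
    next
      fix u assume "u > 0" and lo: "\<forall>t\<le>0. germ_eq X K x (x + t *\<^sub>R v)" and up: "\<forall>t. 0 \<le> t \<longrightarrow> t < u \<longrightarrow> germ_eq X K x (x + t *\<^sub>R v)" and "x i + u \<in> S"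
      then obtain c where "c \<in> A" "c < x i + u" using A(4) by blast
      then show ?thesis using lo[rule_format, of "c - x i"] up[rule_format, of "c - x i"] by (cases "c \<le> x i") auto
    next
      fix l assume "l > 0" and lo: "\<forall>t. - l < t \<longrightarrow> t \<le> 0 \<longrightarrow> germ_eq X K x (x + t *\<^sub>R v)" and up: "\<forall>t\<ge>0. germ_eq X K x (x + t *\<^sub>R v)" and "x i - l \<in> S"
      then obtain c where "c \<in> A" "x i - l < c" using A(3) by blast
      then show ?thesis using lo[rule_format, of "c - x i"] up[rule_format, of "c - x i"] by (cases "c \<le> x i") auto
    next
      fix l u assume "l > 0" "u > 0" and lo: "\<forall>t. - l < t \<longrightarrow> t \<le> 0 \<longrightarrow> germ_eq X K x (x + t *\<^sub>R v)" and up: "\<forall>t. 0 \<le> t \<longrightarrow> t < u \<longrightarrow> germ_eq X K x (x + t *\<^sub>R v)" and "x i - l \<in> S" "x i + u \<in> S"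
      then obtain c where "c \<in> A" "x i - l < c" "c < x i + u"
        using A(2)[of "x i - l" "x i + u"] by auto
      then show ?thesis using lo[rule_format, of "c - x i"] up[rule_format, of "c - x i"] by (cases "c \<le> x i") auto
    qed
    then obtain c where c: "c \<in> A" "germ_eq X K x (x + (c - x i) *\<^sub>R v)" by blast
    then show False using notin[OF c(2)] by simp
  qed
qed

section \<open>Finiteness of the set of flats\<close>

lemma flat_equations:
  assumes K: "finite K" and z: "z - a \<in> coord_space K"
  shows "\<exists>G. finite G \<and> (\<forall>g\<in>G. affine_form g) \<and>
    (\<forall>x. x - a \<in> coord_space K \<longrightarrow> (x \<in> flat X K z \<longleftrightarrow> (\<forall>g\<in>G. g x = 0)))"
proof -
  obtain G where G: "finite G" "\<And>g. g \<in> G \<Longrightarrow> affine_form g"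
    "\<And>x. x - z \<in> coord_space K \<Longrightarrow> x - z \<in> strata X K z \<longleftrightarrow> (\<forall>g\<in>G. g x = 0)"
    using subspace_equations[OF subspace_strata[OF K] strata_subset_coord_space K] by metis
  have "x \<in> flat X K z \<longleftrightarrow> (\<forall>g\<in>G. g x = 0)" if "x - a \<in> coord_space K" for x
    using G(3)[of x] coord_space_diff[OF that z] by (simp add: mem_flat_iff)
  then show ?thesis using G(1,2) by blast
qed

text \<open>On a sign class the segment from \<open>x\<close> to \<open>x + w\<close> keeps all
  signs, so a form vanishing at an intermediate point \<open>z\<close> vanishes at both ends. Both
  ends then lie on the flat of \<open>z\<close>, and their difference \<open>w\<close> is a stratum
  there.\<close>

lemma flats_sign_forms:
  assumes K: "finite K" and Z: "finite (flat X K ` Z)" "Z \<subseteq> {z. z - a \<in> coord_space K}"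
    and affine: "\<And>g. \<Phi> g \<Longrightarrow> affine_form g"
    and equations: "\<And>z. z \<in> Z \<Longrightarrow> \<exists>G. finite G \<and> (\<forall>g\<in>G. \<Phi> g) \<and>
      (\<forall>x. x - a \<in> coord_space K \<longrightarrow> (x \<in> flat X K z \<longleftrightarrow> (\<forall>g\<in>G. g x = 0)))"
  obtains F where "finite F" "\<And>g. g \<in> F \<Longrightarrow> \<Phi> g"
    "\<forall>x w t. x - a \<in> coord_space K \<longrightarrow> w \<in> coord_space K \<longrightarrow>
      (\<forall>g\<in>F. sgn (g x) = sgn (g (x + w))) \<longrightarrow> 0 \<le> t \<longrightarrow> t \<le> 1 \<longrightarrow>
      x + t *\<^sub>R w \<in> Z \<longrightarrow> w \<in> strata X K (x + t *\<^sub>R w)"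
proof -
  have "\<forall>P\<in>flat X K ` Z. \<exists>G. finite G \<and> (\<forall>g\<in>G. \<Phi> g) \<and>
    (\<forall>x. x - a \<in> coord_space K \<longrightarrow> (x \<in> P \<longleftrightarrow> (\<forall>g\<in>G. g x = 0)))"
    using equations by blast
  from bchoice[OF this] obtain G where G0: "\<forall>P\<in>flat X K ` Z. finite (G P) \<and> (\<forall>g\<in>G P. \<Phi> g) \<and>
    (\<forall>x. x - a \<in> coord_space K \<longrightarrow> (x \<in> P \<longleftrightarrow> (\<forall>g\<in>G P. g x = 0)))" ..
  then have G: "\<And>P. P \<in> flat X K ` Z \<Longrightarrow> finite (G P)"
    "\<And>P g. P \<in> flat X K ` Z \<Longrightarrow> g \<in> G P \<Longrightarrow> \<Phi> g"
    "\<And>P x. P \<in> flat X K ` Z \<Longrightarrow> x - a \<in> coord_space K \<Longrightarrow> x \<in> P \<longleftrightarrow> (\<forall>g\<in>G P. g x = 0)"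
    by blast+
  define F where "F = \<Union> (G ` flat X K ` Z)"
  show thesis
  proof
    show "finite F" unfolding F_def using Z(1) G(1) by blast
    show \<Phi>: "\<Phi> g" if "g \<in> F" for g using that G(2) unfolding F_def by blast
    show "\<forall>x w t. x - a \<in> coord_space K \<longrightarrow> w \<in> coord_space K \<longrightarrow>
      (\<forall>g\<in>F. sgn (g x) = sgn (g (x + w))) \<longrightarrow> 0 \<le> t \<longrightarrow> t \<le> 1 \<longrightarrow>
      x + t *\<^sub>R w \<in> Z \<longrightarrow> w \<in> strata X K (x + t *\<^sub>R w)"
    proof (intro allI impI)
      fix x w t
      assume x: "x - a \<in> coord_space K" and w: "w \<in> coord_space K"
        and sgn0: "\<forall>g\<in>F. sgn (g x) = sgn (g (x + w))" and t: "0 \<le> t" "t \<le> 1"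
        and zZ: "x + t *\<^sub>R w \<in> Z"
      note sgn = bspec[OF sgn0]
      define z where "z = x + t *\<^sub>R w"
      have P: "flat X K z \<in> flat X K ` Z" using zZ by (simp add: z_def)
      have xw: "(x + w) - a \<in> coord_space K"
        using coord_space_add[OF x w] by (simp add: algebra_simps)
      have zero: "g x = 0 \<and> g (x + w) = 0" if g: "g \<in> G (flat X K z)" for g
      proof -
        have gF: "g \<in> F" using g P unfolding F_def by blast
        have "g z = 0" using G(3)[OF P CollectD[OF subsetD[OF Z(2) zZ]]] self_in_flat[OF K, of z X] g by (simp add: z_def)
        moreover have "sgn (g z) = sgn (g x)"
          unfolding z_def by (rule affine_form_segment_sgn[OF affine[OF \<Phi>[OF gF]] sgn[OF gF] t])
        ultimately have "sgn (g x) = 0" by simp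
        then show ?thesis using sgn[OF gF] by (simp add: sgn_zero_iff)
      qed
      have "x \<in> flat X K z" "x + w \<in> flat X K z"
        using G(3)[OF P x] G(3)[OF P xw] zero by auto
      then have "(x + w - z) - (x - z) \<in> strata X K z"
        unfolding mem_flat_iff using subspace_diff[OF subspace_strata[OF K]] by blast
      then show "w \<in> strata X K (x + t *\<^sub>R w)" by (simp add: z_def)
    qed
  qed
qed

text \<open>For two such points in one sign class, \<open>w = y - x\<close> is a stratum inside the
  hyperplane by \<open>F2\<close>, hence in the section by transversality. A ray along
  \<open>w\<close> that lost the germ no later than at \<open>y\<close> would do so at a point of
  smaller dimension, where \<open>F1\<close> still makes \<open>w\<close> a stratum.\<close>

lemma finite_transversal_flats:
  assumes K: "finite K"
    and lower: "finite (flat X K ` {x. x - a \<in> coord_space K \<and> card (pivots (strata X K x)) < d})"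
    and hyp: "finite (flat X (K - {i}) ` {x. x - a \<in> coord_space K \<and> x i = c})"
  shows "finite (flat X K ` {x. x - a \<in> coord_space K \<and> x i = c \<and>
    card (pivots (strata X K x)) = d \<and> (\<exists>v\<in>strata X K x. v i \<noteq> 0)})"
    (is "finite (_ ` ?S)")
proof -
  note sub = subspace_strata[OF K, of X]
  have K': "finite (K - {i})" using K by simp
  let ?Z1 = "{x. x - a \<in> coord_space K \<and> card (pivots (strata X K x)) < d}"
  let ?Z2 = "{x. x - a \<in> coord_space K \<and> x i = c}"
  have Z1: "?Z1 \<subseteq> {z. z - a \<in> coord_space K}" by auto
  obtain F1 where F1: "finite F1" "\<And>g. g \<in> F1 \<Longrightarrow> affine_form g"
    "\<forall>x w t. x - a \<in> coord_space K \<longrightarrow> w \<in> coord_space K \<longrightarrow>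
      (\<forall>g\<in>F1. sgn (g x) = sgn (g (x + w))) \<longrightarrow> 0 \<le> t \<longrightarrow> t \<le> 1 \<longrightarrow>
      x + t *\<^sub>R w \<in> ?Z1 \<longrightarrow> w \<in> strata X K (x + t *\<^sub>R w)"
    by (rule flats_sign_forms[where \<Phi> = affine_form, OF K lower Z1 _ flat_equations[OF K]])
      (assumption, use Z1 in blast, rule that)
  have Z2: "?Z2 \<subseteq> {z. z - a(i := c) \<in> coord_space (K - {i})}"
    by (auto simp: coord_space_def)
  obtain F2 where F2: "finite F2" "\<And>g. g \<in> F2 \<Longrightarrow> affine_form g"
    "\<forall>x w t. x - a(i := c) \<in> coord_space (K - {i}) \<longrightarrow> w \<in> coord_space (K - {i}) \<longrightarrow>
      (\<forall>g\<in>F2. sgn (g x) = sgn (g (x + w))) \<longrightarrow> 0 \<le> t \<longrightarrow> t \<le> 1 \<longrightarrow>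
      x + t *\<^sub>R w \<in> ?Z2 \<longrightarrow> w \<in> strata X (K - {i}) (x + t *\<^sub>R w)"
    by (rule flats_sign_forms[where \<Phi> = affine_form, OF K' hyp Z2 _ flat_equations[OF K']])
      (assumption, use Z2 in blast, rule that)
  show ?thesis
  proof (rule finite_image_sign_classes)
    show "finite (F1 \<union> F2)" using F1(1) F2(1) by simp
    fix x y assume x: "x \<in> ?S" and y: "y \<in> ?S"
      and sgn: "\<And>g. g \<in> F1 \<union> F2 \<Longrightarrow> sgn (g x) = sgn (g y)"
    define w where "w = y - x"
    have yx: "y = x + w" by (simp add: w_def)
    have xa: "x - a \<in> coord_space K" and ya: "y - a \<in> coord_space K" and c: "x i = c" "y i = c"
      using x y by auto
    have wK: "w \<in> coord_space K" using coord_space_diff[OF ya xa] by (simp add: w_def)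
    then have wK': "w \<in> coord_space (K - {i})" using c by (auto simp: coord_space_def w_def)
    obtain v0 where v0: "v0 \<in> strata X K x" "v0 i \<noteq> 0" using x by blast
    define v where "v = (1 / v0 i) *\<^sub>R v0"
    have v: "v \<in> strata X K x" "v i = 1"
      using subspace_scale[OF sub v0(1)] v0(2) by (auto simp: v_def)
    have "w \<in> strata X (K - {i}) (x + 0 *\<^sub>R w)"
      by (rule F2(3)[rule_format, OF _ wK']) (use sgn yx xa c subsetD[OF Z2, of x] in auto)
    then have w: "w \<in> strata X K x" using transversal_strata[OF K v] by simp
    have "germ_eq X K x y"
      using K w
    proof (cases rule: ray_cases)
      case 1
      then show ?thesis using 1[of 1] by (simp add: yx)
    next
      case (2 b)
      show ?thesis
      proof (cases "b \<le> 1")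
        case False
        then show ?thesis using 2(2)[of 1] by (simp add: yx)
      next
        case True
        let ?z = "x + b *\<^sub>R w"
        have "card (pivots (strata X K ?z)) < card (pivots (strata X K x))"
          using 2(4) by (intro card_pivots_less[OF sub sub strata_subset_coord_space K])
        then have "card (pivots (strata X K ?z)) < d" using x by simp
        moreover have "?z - a \<in> coord_space K"
          using coord_space_add[OF xa coord_space_scale[OF wK], of b] by (simp add: algebra_simps)
        ultimately have "w \<in> strata X K ?z"
          using sgn yx 2(1) True by (intro F1(3)[rule_format, OF xa wK]) auto
        then show ?thesis using 2(3) by blast
      qed
    qed
    then show "flat X K x = flat X K y" using germ_eq_flat[OF K] w by (simp add: w_def)
  qed
qed

text \<open>Dimension 0 is the hypothesis on points with trivial strata. A point of dimension
  \<open>d > 0\<close> is moved within its flat, by \<open>reach_hyperplane\<close>, into one of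
  finitely many hyperplanes, where \<open>finite_transversal_flats\<close> applies.\<close>

lemma finite_flats_step:
  assumes K: "finite K"
    and sing: "finite {x. x - a \<in> coord_space K \<and> strata X K x = {0}}"
    and hyp: "\<And>i c. i \<in> K \<Longrightarrow> finite (flat X (K - {i}) ` {x. x - a \<in> coord_space K \<and> x i = c})"
  shows "finite (flat X K ` {x. x - a \<in> coord_space K \<and> card (pivots (strata X K x)) < d})"
proof (induction d)
  case 0
  then show ?case by simp
next
  case (Suc d)
  let ?H = "{x. x - a \<in> coord_space K}"
  let ?dim = "\<lambda>x. card (pivots (strata X K x))"
  have "finite (flat X K ` {x\<in>?H. ?dim x = d})"
  proof (cases "d = 0")
    case True
    have "strata X K x = {0}" if "?dim x = 0" for x
      using that pivots_empty[OF subspace_strata[OF K] strata_subset_coord_space K, of X x]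
        finite_subset[OF pivots_subset[OF strata_subset_coord_space] K, of X x] by simp
    then have "{x\<in>?H. ?dim x = d} \<subseteq> {x. x - a \<in> coord_space K \<and> strata X K x = {0}}"
      using True by auto
    then show ?thesis using sing finite_subset by blast
  next
    case False
    \<comment> \<open>The \<open>i\<close>-th coordinates of the lower-dimensional flats on which
      this coordinate is constant. Any chosen point of such a flat reads the value off, so
      \<open>S i\<close> is finite.\<close>
    define S where "S i = {x i | x. x \<in> ?H \<and> ?dim x < d \<and> (\<forall>w\<in>strata X K x. w i = 0)}" for i
    have finS: "finite (S i)" for i
    proof (rule finite_subset)
      let ?f = "\<lambda>P. (SOME z. z \<in> P) i"
      show "S i \<subseteq> ?f ` flat X K ` {x. x - a \<in> coord_space K \<and> ?dim x < d}"
      proof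
        fix r assume "r \<in> S i"
        then obtain x where x: "r = x i" "x \<in> ?H" "?dim x < d" "\<forall>w\<in>strata X K x. w i = 0"
          unfolding S_def by blast
        have "(SOME z. z \<in> flat X K x) \<in> flat X K x" by (rule someI[of _ x]) (rule self_in_flat[OF K])
        then have "((SOME z. z \<in> flat X K x) - x) i = 0" using x(4) unfolding mem_flat_iff by blast
        then have "r = ?f (flat X K x)" using x(1) by simp
        then show "r \<in> ?f ` flat X K ` {x. x - a \<in> coord_space K \<and> ?dim x < d}"
          using x(2,3) by blast
      qed
    qed (rule finite_imageI[OF Suc])
    have "\<exists>A. finite A \<and> (\<forall>x\<in>?H. ?dim x = d \<longrightarrow> (\<exists>v\<in>strata X K x. v i \<noteq> 0) \<longrightarrow>
      (\<exists>x'. x' - x \<in> strata X K x \<and> germ_eq X K x x' \<and> x' i \<in> A))" for i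
    proof -
      obtain A where A: "finite A" "A \<noteq> {}"
        "\<And>\<alpha> \<beta>. \<alpha> \<in> S i \<Longrightarrow> \<beta> \<in> S i \<Longrightarrow> \<alpha> < \<beta> \<Longrightarrow> \<exists>c\<in>A. \<alpha> < c \<and> c < \<beta>"
        "\<And>\<alpha>. \<alpha> \<in> S i \<Longrightarrow> \<exists>c\<in>A. \<alpha> < c" "\<And>\<alpha>. \<alpha> \<in> S i \<Longrightarrow> \<exists>c\<in>A. c < \<alpha>"
        by (rule ex_separating_set[OF finS[of i]]) (rule that)
      have inS: "y i \<in> S i" if "y - a \<in> coord_space K" "?dim y < d"
        "\<And>w. w \<in> strata X K y \<Longrightarrow> w i = 0" for y
        using that unfolding S_def by blast
      have "\<exists>x'. x' - x \<in> strata X K x \<and> germ_eq X K x x' \<and> x' i \<in> A"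
        if "x \<in> ?H" "?dim x = d" "\<exists>v\<in>strata X K x. v i \<noteq> 0" for x
        by (rule reach_hyperplane[OF K A(2-5), where a = a and d = d]) (use that inS in auto)
      then show ?thesis using A(1) by blast
    qed
    then have "\<forall>i. \<exists>A. finite A \<and> (\<forall>x\<in>?H. ?dim x = d \<longrightarrow> (\<exists>v\<in>strata X K x. v i \<noteq> 0) \<longrightarrow>
      (\<exists>x'. x' - x \<in> strata X K x \<and> germ_eq X K x x' \<and> x' i \<in> A))" ..
    from choice[OF this] obtain A where A0:
      "\<forall>i. finite (A i) \<and> (\<forall>x\<in>?H. ?dim x = d \<longrightarrow> (\<exists>v\<in>strata X K x. v i \<noteq> 0) \<longrightarrow>
        (\<exists>x'. x' - x \<in> strata X K x \<and> germ_eq X K x x' \<and> x' i \<in> A i))" ..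
    then have A: "\<And>i. finite (A i)"
      "\<And>i x. x \<in> ?H \<Longrightarrow> ?dim x = d \<Longrightarrow> \<exists>v\<in>strata X K x. v i \<noteq> 0 \<Longrightarrow>
        \<exists>x'. x' - x \<in> strata X K x \<and> germ_eq X K x x' \<and> x' i \<in> A i" by blast+
    let ?D = "\<lambda>i c. {x. x - a \<in> coord_space K \<and> x i = c \<and> ?dim x = d \<and>
      (\<exists>v\<in>strata X K x. v i \<noteq> 0)}"
    have "flat X K ` {x\<in>?H. ?dim x = d} \<subseteq> (\<Union>i\<in>K. \<Union>c\<in>A i. flat X K ` ?D i c)"
    proof (rule image_subsetI)
      fix x assume "x \<in> {x\<in>?H. ?dim x = d}"
      then have x: "x \<in> ?H" "?dim x = d" by auto
      then have "pivots (strata X K x) \<noteq> {}" using False by auto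
      then obtain i v where v: "v \<in> strata X K x" "v i \<noteq> 0" unfolding pivots_def by blast
      then have i: "i \<in> K" using strata_coord_space[OF v(1)] by (auto simp: coord_space_def)
      obtain x' where x': "x' - x \<in> strata X K x" "germ_eq X K x x'" "x' i \<in> A i"
        using A(2)[OF x] v by blast
      have eq: "strata X K x' = strata X K x" using germ_eq_strata[OF K x'(2)] by simp
      have "(x' - x) + (x - a) \<in> coord_space K"
        using strata_coord_space[OF x'(1)] x(1) by (intro coord_space_add) auto
      then have "x' \<in> ?D i (x' i)" using x(2) v eq by auto
      moreover have "flat X K x = flat X K x'" by (rule germ_eq_flat[OF K x'(2,1)])
      ultimately show "flat X K x \<in> (\<Union>i\<in>K. \<Union>c\<in>A i. flat X K ` ?D i c)"
        using i x'(3) by blast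
    qed
    moreover have "finite (\<Union>i\<in>K. \<Union>c\<in>A i. flat X K ` ?D i c)"
      using K A(1) finite_transversal_flats[OF K Suc hyp] by auto
    ultimately show ?thesis by (rule finite_subset)
  qed
  moreover have "{x. x - a \<in> coord_space K \<and> ?dim x < Suc d} =
    {x. x - a \<in> coord_space K \<and> ?dim x < d} \<union> {x\<in>?H. ?dim x = d}" by auto
  ultimately show ?case using finite_UnI[OF Suc] by (simp only: image_Un)
qed

text \<open>The hyperplane \<open>x i = c\<close> of a section is the section through
  \<open>a(i := c)\<close> with free components \<open>K - {i}\<close>; arbitrary \<open>a\<close>
  makes the induction hypothesis available for every \<open>c\<close>.\<close>

theorem finite_flats:
  assumes "finite K"
    and "\<And>L b. L \<subseteq> K \<Longrightarrow> b - a \<in> coord_space K \<Longrightarrow>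
      finite {x. x - b \<in> coord_space L \<and> strata X L x = {0}}"
  shows "finite (flat X K ` {x. x - a \<in> coord_space K})"
  using assms
proof (induction K arbitrary: a rule: finite_psubset_induct)
  case (psubset K)
  note K = \<open>finite K\<close>
  have "finite (flat X (K - {i}) ` {x. x - a \<in> coord_space K \<and> x i = c})" if i: "i \<in> K" for i c
  proof -
    let ?b = "a(i := c)"
    have "finite (flat X (K - {i}) ` {x. x - ?b \<in> coord_space (K - {i})})"
    proof (rule psubset.IH)
      fix L b assume L: "L \<subseteq> K - {i}" and b: "b - ?b \<in> coord_space (K - {i})"
      show "finite {x. x - b \<in> coord_space L \<and> strata X L x = {0}}"
      proof (rule psubset.prems)
        show "L \<subseteq> K" using L by blast
        show "b - a \<in> coord_space K"
          using b i by (auto simp: coord_space_def split: if_splits)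
      qed
    qed (use i in blast)
    moreover have "{x. x - a \<in> coord_space K \<and> x i = c} \<subseteq> {x. x - ?b \<in> coord_space (K - {i})}"
      by (auto simp: coord_space_def)
    ultimately show ?thesis by (meson finite_subset image_mono)
  qed
  then have "finite (flat X K ` {x. x - a \<in> coord_space K \<and> card (pivots (strata X K x)) < Suc (card K)})"
    by (intro finite_flats_step[OF K psubset.prems[OF order_refl]]) (simp add: coord_space_def)
  moreover have "card (pivots (strata X K x)) < Suc (card K)" for x
    using card_mono[OF K pivots_subset[OF strata_subset_coord_space]] by (simp add: less_Suc_eq_le)
  ultimately show ?case by (simp only: simp_thms)
qed

text \<open>Between two points of one sign class the difference is a stratum at every point of the
  segment, so the germ does not change. The kind of equations is left open in \<open>\<Phi>\<close>
  because both real and rational ones are used.\<close>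

theorem finite_flats_sign_invariant:
  assumes K: "finite K" and fin: "finite (flat X K ` coord_space K)"
    and affine: "\<And>g. \<Phi> g \<Longrightarrow> affine_form g"
    and equations: "\<And>z. z \<in> coord_space K \<Longrightarrow> \<exists>G. finite G \<and> (\<forall>g\<in>G. \<Phi> g) \<and>
      (\<forall>x. x \<in> coord_space K \<longrightarrow> (x \<in> flat X K z \<longleftrightarrow> (\<forall>g\<in>G. g x = 0)))"
  obtains F where "finite F" "\<And>g. g \<in> F \<Longrightarrow> \<Phi> g" "sign_invariant F (coord_space K) X"
proof -
  have Z: "coord_space K \<subseteq> {z. z - 0 \<in> coord_space K}" by simp
  obtain F where F: "finite F" "\<And>g. g \<in> F \<Longrightarrow> \<Phi> g"
    "\<forall>x w t. x - 0 \<in> coord_space K \<longrightarrow> w \<in> coord_space K \<longrightarrow>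
      (\<forall>g\<in>F. sgn (g x) = sgn (g (x + w))) \<longrightarrow> 0 \<le> t \<longrightarrow> t \<le> 1 \<longrightarrow>
      x + t *\<^sub>R w \<in> coord_space K \<longrightarrow> w \<in> strata X K (x + t *\<^sub>R w)"
    by (rule flats_sign_forms[where \<Phi> = \<Phi>, OF K fin Z])
      (use affine in blast, use equations in simp, rule that)
  have "x \<in> X \<longleftrightarrow> y \<in> X" if x: "x \<in> coord_space K" and y: "y \<in> coord_space K"
    and sgn: "\<forall>g\<in>F. sgn (g x) = sgn (g y)" for x y
  proof -
    define w where "w = y - x"
    have w: "w \<in> coord_space K" "x + w = y" using coord_space_diff[OF y x] by (auto simp: w_def)
    have "germ_eq X K (x + 0 *\<^sub>R w) (x + 1 *\<^sub>R w)"
    proof (rule germ_eq_segment[OF K w(1)])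
      fix t :: real assume "0 \<le> t" "t \<le> 1"
      then show "w \<in> strata X K (x + t *\<^sub>R w)"
        using x sgn coord_space_add[OF x coord_space_scale[OF w(1)]]
        by (intro F(3)[rule_format, OF _ w(1)]) (auto simp: w(2))
    qed simp
    then show ?thesis using germ_eq_mem by (fastforce simp: w(2))
  qed
  then show thesis using that[OF F(1,2)] unfolding sign_invariant_def by blast
qed

section \<open>Local cones\<close>

lemma affine_form_translate:
  assumes "affine_form g"
  shows "g (x + u) - g x = g (y + u) - g y"
proof -
  obtain k c a where g: "g = (\<lambda>e. c + (\<Sum>i<k. a i * e i))"
    using assms by (rule affine_formE)
  have "g (x + u) - g x = (\<Sum>i<k. a i * u i)" for x
    by (simp only: g plus_fun_apply distrib_left sum.distrib)
  then show ?thesis by simp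
qed

lemma ex_sign_stable_radius:
  assumes "finite F" "\<And>g. g \<in> F \<Longrightarrow> affine_form g"
  obtains R where "R > 0"
    "\<And>g u. g \<in> F \<Longrightarrow> g x \<noteq> 0 \<Longrightarrow> small R u \<Longrightarrow> sgn (g (x + u)) = sgn (g x)"
proof -
  have "\<exists>R>0. \<forall>g\<in>F. \<forall>u. g x \<noteq> 0 \<longrightarrow> small R u \<longrightarrow> sgn (g (x + u)) = sgn (g x)"
    using assms
  proof (induction F rule: finite_induct)
    case empty
    then show ?case by (intro exI[of _ 1]) simp
  next
    case (insert f F)
    then have "\<exists>R>0. \<forall>g\<in>F. \<forall>u. g x \<noteq> 0 \<longrightarrow> small R u \<longrightarrow> sgn (g (x + u)) = sgn (g x)"
      by blast
    then obtain R where R: "R > 0"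
      "\<forall>g\<in>F. \<forall>u. g x \<noteq> 0 \<longrightarrow> small R u \<longrightarrow> sgn (g (x + u)) = sgn (g x)" by blast
    have f: "affine_form f" using insert.prems by simp
    obtain M where M: "M > 0" "\<And>x u e. small e u \<Longrightarrow> \<bar>f (x + u) - f x\<bar> \<le> M * e"
      by (rule affine_form_lipschitz[OF f]) (rule that)
    show ?case
    proof (cases "f x = 0")
      case True
      then show ?thesis using R by blast
    next
      case False
      \<comment> \<open>With Lipschitz constant \<open>M\<close>, this radius lets \<open>f\<close>
        change by at most half of its absolute value at \<open>x\<close>.\<close>
      define R' where "R' = min R (\<bar>f x\<bar> / (2 * M))"
      have "R' > 0" using R(1) False M(1) by (simp add: R'_def)
      moreover have "sgn (f (x + u)) = sgn (f x)" if "small R' u" for u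
      proof -
        have "M * R' \<le> M * (\<bar>f x\<bar> / (2 * M))" using M(1) by (intro mult_left_mono) (auto simp: R'_def)
        then have "\<bar>f (x + u) - f x\<bar> \<le> \<bar>f x\<bar> / 2" using M(2)[OF that, of x] M(1) by simp
        then show ?thesis using False by (auto simp: sgn_real_def abs_if split: if_splits)
      qed
      moreover have "small R u" if "small R' u" for u
        using that by (rule small_mono) (simp add: R'_def)
      ultimately show ?thesis using R(2) by (intro exI[of _ R']) blast
    qed
  qed
  then show thesis using that by blast
qed

definition cone_at :: "vec set \<Rightarrow> nat set \<Rightarrow> vec \<Rightarrow> real \<Rightarrow> bool" where
  "cone_at X K x R \<longleftrightarrow> R > 0 \<and> (\<forall>u\<in>coord_space K. \<forall>c>0.
     small R u \<longrightarrow> small R (c *\<^sub>R u) \<longrightarrow> (x + u \<in> X \<longleftrightarrow> x + c *\<^sub>R u \<in> X))"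

lemma cone_atD:
  "cone_at X K x R \<Longrightarrow> u \<in> coord_space K \<Longrightarrow> c > 0 \<Longrightarrow> small R u \<Longrightarrow> small R (c *\<^sub>R u) \<Longrightarrow>
    x + u \<in> X \<longleftrightarrow> x + c *\<^sub>R u \<in> X"
  unfolding cone_at_def by blast

text \<open>Near \<open>x\<close> the forms not vanishing at \<open>x\<close> keep their sign, while
  those vanishing at \<open>x\<close> are multiplied by \<open>c > 0\<close>.\<close>

lemma sign_invariant_cone_at:
  assumes F: "finite F" "\<And>g. g \<in> F \<Longrightarrow> affine_form g" "sign_invariant F (coord_space K) X"
    and x: "x \<in> coord_space K"
  obtains R where "cone_at X K x R"
proof -
  obtain R where R: "R > 0"
    "\<And>g u. g \<in> F \<Longrightarrow> g x \<noteq> 0 \<Longrightarrow> small R u \<Longrightarrow> sgn (g (x + u)) = sgn (g x)"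
    by (rule ex_sign_stable_radius[OF F(1,2)]) (assumption, rule that)
  have "x + u \<in> X \<longleftrightarrow> x + c *\<^sub>R u \<in> X"
    if u: "u \<in> coord_space K" "c > 0" "small R u" "small R (c *\<^sub>R u)" for u c
  proof -
    have "sgn (g (x + u)) = sgn (g (x + c *\<^sub>R u))" if g: "g \<in> F" for g
    proof (cases "g x = 0")
      case True
      then have "g (x + c *\<^sub>R u) = c * g (x + u)" by (simp add: affine_form_line[OF F(2)[OF g]])
      then show ?thesis using u(2) by (simp add: sgn_mult)
    next
      case False
      then show ?thesis using R(2)[OF g] u(3,4) by simp
    qed
    moreover have "x + u \<in> coord_space K" "x + c *\<^sub>R u \<in> coord_space K"
      using x u(1) by (auto intro: coord_space_add coord_space_scale)
    ultimately show ?thesis using F(3) unfolding sign_invariant_def by blast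
  qed
  then show thesis using that R(1) unfolding cone_at_def by blast
qed

text \<open>In a cone with apex \<open>x\<close>, shrinking a translation by \<open>v\<close> towards the apex makes it
  arbitrarily small, so that local invariance under one \<open>v\<close> and under all small multiples of \<open>v\<close>
  are equivalent.\<close>

lemma cone_strata_iff:
  assumes K: "finite K" and cone: "cone_at X K x R"
    and xq: "x \<in> coord_space K" "q \<in> coord_space K"
    and ball: "\<And>y. small r (y - q) \<Longrightarrow> small R (y - x)"
    and m: "small m (x - q)" "m + s < r"
    and v: "v \<in> coord_space K" "\<And>i. \<bar>v i\<bar> \<le> s"
  shows "v \<in> strata X K x \<longleftrightarrow>
    (\<forall>y\<in>coord_space K. small r (y - q) \<longrightarrow> small r (y + v - q) \<longrightarrow> (y \<in> X \<longleftrightarrow> y + v \<in> X))"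
proof
  assume vs: "v \<in> strata X K x"
  obtain e where e: "e > 0" "\<And>u t. u \<in> coord_space K \<Longrightarrow> small e u \<Longrightarrow> \<bar>t\<bar> < e \<Longrightarrow>
    x + u \<in> X \<longleftrightarrow> x + u + t *\<^sub>R v \<in> X" using strataE[OF vs] by blast
  show "\<forall>y\<in>coord_space K. small r (y - q) \<longrightarrow> small r (y + v - q) \<longrightarrow> (y \<in> X \<longleftrightarrow> y + v \<in> X)"
  proof (intro ballI impI)
    fix y assume y: "y \<in> coord_space K" "small r (y - q)" "small r (y + v - q)"
    define u where "u = y - x"
    have u: "u \<in> coord_space K" "small R u" "small R (u + v)"
      using ball[OF y(2)] ball[OF y(3)] y(1) xq(1)
      by (auto simp: u_def algebra_simps intro: coord_space_diff)
    obtain d where d: "d > 0" "\<And>t. \<bar>t\<bar> < d \<Longrightarrow> small e (t *\<^sub>R u)"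
      using ex_small_scale[OF K u(1) e(1)] by blast
    \<comment> \<open>Shrinking by \<open>c\<close> towards \<open>x\<close> brings \<open>u\<close>
      into the box of the stratum and turns the translation by \<open>v\<close> into one by
      \<open>c v\<close>.\<close>
    define c where "c = min 1 (min d e) / 2"
    have c: "c > 0" "\<bar>c\<bar> < d" "\<bar>c\<bar> < e" "\<bar>c\<bar> \<le> 1" using d(1) e(1) by (auto simp: c_def)
    have "x + u \<in> X \<longleftrightarrow> x + c *\<^sub>R u \<in> X"
      by (rule cone_atD[OF cone u(1) c(1) u(2) small_scale[OF u(2) c(4)]])
    also have "\<dots> \<longleftrightarrow> x + c *\<^sub>R u + c *\<^sub>R v \<in> X"
      by (rule e(2)[OF coord_space_scale[OF u(1)] d(2)[OF c(2)] c(3)])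
    also have "x + c *\<^sub>R u + c *\<^sub>R v = x + c *\<^sub>R (u + v)" by (simp add: scaleR_add_right add.assoc)
    also have "\<dots> \<in> X \<longleftrightarrow> x + (u + v) \<in> X"
      by (rule cone_atD[OF cone coord_space_add[OF u(1) v(1)] c(1) u(3) small_scale[OF u(3) c(4)], symmetric])
    finally show "y \<in> X \<longleftrightarrow> y + v \<in> X" by (simp add: u_def algebra_simps)
  qed
next
  assume inv: "\<forall>y\<in>coord_space K. small r (y - q) \<longrightarrow> small r (y + v - q) \<longrightarrow> (y \<in> X \<longleftrightarrow> y + v \<in> X)"
  have R: "R > 0" using cone by (simp add: cone_at_def)
  obtain d where d: "d > 0" "\<And>t. \<bar>t\<bar> < d \<Longrightarrow> small (R/2) (t *\<^sub>R v)"
    using ex_small_scale[OF K v(1), of "R/2"] R by auto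
  define e where "e = min d (min (R/2) (1/2))"
  \<comment> \<open>The room left in the ball around \<open>q\<close> by the offset \<open>m\<close>
    of the apex and a translation of size \<open>s\<close>.\<close>
  define \<eta> where "\<eta> = r - s - m"
  have "\<eta> > 0" using m(2) by (simp add: \<eta>_def)
  have shift: "x + z \<in> X \<longleftrightarrow> x + (z + v) \<in> X" "small R (z + v)"
    if z: "z \<in> coord_space K" "small \<eta> z" for z
  proof -
    have s0: "0 \<le> s" using v(2)[of 0] by linarith
    have bound: "\<bar>x i - q i\<bar> < m" "\<bar>z i\<bar> < \<eta>" "\<bar>v i\<bar> \<le> s" for i
      using m(1) z(2) v(2) by (auto simp: small_def)
    have "\<bar>(x + z - q) i\<bar> < r" "\<bar>(x + z + v - q) i\<bar> < r" for i
      using bound[of i] s0 by (auto simp: \<eta>_def abs_less_iff abs_le_iff)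
    then have "small r (x + z - q)" "small r (x + z + v - q)" unfolding small_def by blast+
    moreover have "x + z \<in> coord_space K" using xq(1) z(1) by (rule coord_space_add)
    ultimately show "x + z \<in> X \<longleftrightarrow> x + (z + v) \<in> X" "small R (z + v)"
      using inv ball[of "x + z + v"] by (auto simp: algebra_simps)
  qed
  show "v \<in> strata X K x"
  proof (rule strataI[OF v(1)])
    show "e > 0" using d(1) R by (simp add: e_def)
    fix u t assume u: "u \<in> coord_space K" "small e u" and t: "\<bar>t\<bar> < e"
    define z where "z = u + t *\<^sub>R v"
    have z: "z \<in> coord_space K" using u(1) v(1) by (auto simp: z_def intro: coord_space_closed)
    have uR: "small R u" using u(2) by (rule small_mono) (use R in \<open>simp add: e_def\<close>)
    have zR: "small R z" unfolding z_def
      by (rule small_add[OF small_mono[OF u(2), of "R/2"] d(2)]) (use t in \<open>auto simp: e_def\<close>)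
    have t2: "\<bar>t\<bar> < 1/2" using t by (simp add: e_def)
    obtain d1 where d1: "d1 > 0" "\<And>a. \<bar>a\<bar> < d1 \<Longrightarrow> small \<eta> (a *\<^sub>R u)"
      using ex_small_scale[OF K u(1) \<open>\<eta> > 0\<close>] by blast
    obtain d2 where d2: "d2 > 0" "\<And>a. \<bar>a\<bar> < d2 \<Longrightarrow> small \<eta> (a *\<^sub>R z)"
      using ex_small_scale[OF K z \<open>\<eta> > 0\<close>] by blast
    define c where "c = min (1/2) (min (d1/3) (d2/2))"
    have c: "0 < c" "c \<le> 1/2" "c < d2" "2 * c < d1" using d1(1) d2(1) by (auto simp: c_def)
    have "\<bar>c * t\<bar> \<le> \<bar>t\<bar>" using c(1,2) by (simp add: abs_mult mult_left_le_one_le)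
    then have k: "1 + c * t \<ge> 1/2" using t2 by linarith
    \<comment> \<open>Chosen so that scaling \<open>c' u + v\<close> by \<open>1 + c t\<close> about
      \<open>x\<close> gives \<open>c z + v\<close> with \<open>z = u + t v\<close>. Thus two
      translations by \<open>v\<close> with a scaling in between replace the translation by
      \<open>t v\<close>.\<close>
    define c' where "c' = c / (1 + c * t)"
    have "c' > 0" using c(1) k by (simp add: c'_def)
    have "c' * (1/2) \<le> c' * (1 + c * t)" using k \<open>c' > 0\<close> by (intro mult_left_mono) auto
    also have "\<dots> = c" using k by (simp add: c'_def)
    finally have c': "0 < c'" "c' \<le> 2 * c" using \<open>c' > 0\<close> by auto
    have cz: "small \<eta> (c *\<^sub>R z)" using c by (intro d2(2)) simp
    have c'u: "small \<eta> (c' *\<^sub>R u)" using c c' by (intro d1(2)) simp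
    have eq: "(1 + c * t) *\<^sub>R (c' *\<^sub>R u + v) = c *\<^sub>R z + v"
    proof -
      have kc: "(1 + c * t) * c' = c" using k by (simp add: c'_def)
      have "(1 + c * t) *\<^sub>R (c' *\<^sub>R u + v) = ((1 + c * t) * c') *\<^sub>R u + (v + (c * t) *\<^sub>R v)"
        by (simp only: scaleR_add_right scaleR_scaleR scaleR_add_left[of 1 _ v] scaleR_one)
      then show ?thesis
        unfolding kc by (simp only: z_def scaleR_add_right scaleR_scaleR add.commute[of v] add.assoc)
    qed
    have "x + u \<in> X \<longleftrightarrow> x + c' *\<^sub>R u \<in> X"
      by (rule cone_atD[OF cone u(1) c'(1) uR small_scale[OF uR]]) (use c c' in simp)
    also have "\<dots> \<longleftrightarrow> x + (c' *\<^sub>R u + v) \<in> X"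
      by (rule shift(1)[OF coord_space_scale[OF u(1)] c'u])
    also have "\<dots> \<longleftrightarrow> x + (1 + c * t) *\<^sub>R (c' *\<^sub>R u + v) \<in> X"
    proof (rule cone_atD[OF cone])
      show "c' *\<^sub>R u + v \<in> coord_space K" using u(1) v(1) by (intro coord_space_add coord_space_scale)
      show "small R (c' *\<^sub>R u + v)" by (rule shift(2)[OF coord_space_scale[OF u(1)] c'u])
      show "small R ((1 + c * t) *\<^sub>R (c' *\<^sub>R u + v))"
        unfolding eq by (rule shift(2)[OF coord_space_scale[OF z] cz])
    qed (use k in simp)
    also have "\<dots> \<longleftrightarrow> x + c *\<^sub>R z \<in> X"
      unfolding eq by (rule shift(1)[OF coord_space_scale[OF z] cz, symmetric])
    also have "\<dots> \<longleftrightarrow> x + z \<in> X"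
      by (rule cone_atD[OF cone z c(1) zR small_scale[OF zR], symmetric]) (use c in simp)
    finally show "x + u \<in> X \<longleftrightarrow> x + u + t *\<^sub>R v \<in> X" by (simp add: z_def add.assoc)
  qed
qed

section \<open>Quasi-strata in terms of \<open>small\<close> boxes, and quasi-singularity in local
  cones\<close>

lemma max_norm_less_iff: "0 < r \<Longrightarrow> max_norm m x < r \<longleftrightarrow> (\<forall>i<m. \<bar>x i\<bar> < r)"
  unfolding max_norm_def by (subst Max_less_iff) auto

lemma max_norm_le_iff: "0 \<le> s \<Longrightarrow> max_norm m x \<le> s \<longleftrightarrow> (\<forall>i<m. \<bar>x i\<bar> \<le> s)"
  unfolding max_norm_def by (subst Max_le_iff) auto

lemma coord_space_all_bound:
  assumes "v \<in> coord_space {..<n}" "0 \<le> s"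
  shows "(\<forall>i<n. \<bar>v i\<bar> \<le> s) \<longleftrightarrow> (\<forall>i. \<bar>v i\<bar> \<le> s)"
proof -
  have "\<bar>v i\<bar> \<le> s" if "\<not> i < n" for i using assms that by (auto simp: coord_space_def)
  then show ?thesis by blast
qed

lemma max_ball_eq:
  assumes "0 < r" "x \<in> coord_space {..<n}"
  shows "max_ball n x r = {y \<in> coord_space {..<n}. small r (y - x)}"
proof -
  have "(\<forall>i<n. \<bar>y i - x i\<bar> < r) \<longleftrightarrow> small r (y - x)" if "y \<in> coord_space {..<n}" for y
  proof -
    have "\<bar>y i - x i\<bar> < r" if "\<not> i < n" for i
      using assms \<open>y \<in> _\<close> that by (auto simp: coord_space_def)
    then show ?thesis unfolding small_def by auto
  qed
  then show ?thesis
    using assms(1) by (auto simp: max_ball_def max_norm_less_iff Rvec_eq_coord_space)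
qed

lemma quasi_strata_eq:
  assumes "0 < s" "s < r" "x \<in> coord_space {..<n}"
  shows "quasi_strata n Y x r s = {v \<in> coord_space {..<n}. (\<forall>i. \<bar>v i\<bar> \<le> s) \<and>
    (\<forall>y\<in>coord_space {..<n}. small r (y - x) \<longrightarrow> small r (y + v - x) \<longrightarrow> (y \<in> Y \<longleftrightarrow> y + v \<in> Y))}"
proof -
  have plus: "(\<lambda>i. y i + v i) = y + v" for y v :: vec by (simp add: fun_eq_iff)
  show ?thesis
    unfolding quasi_strata_def plus Rvec_eq_coord_space
    using assms by (auto simp: max_ball_eq max_norm_le_iff coord_space_all_bound coord_space_add)
qed

lemma cone_quasi_strata:
  assumes cone: "cone_at Y {..<n} x R" and x: "x \<in> coord_space {..<n}" and r: "0 < s" "s < r" "r \<le> R"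
  shows "quasi_strata n Y x r s = {v \<in> strata Y {..<n} x. \<forall>i. \<bar>v i\<bar> \<le> s}"
proof -
  have "v \<in> strata Y {..<n} x \<longleftrightarrow> (\<forall>y\<in>coord_space {..<n}. small r (y - x) \<longrightarrow>
      small r (y + v - x) \<longrightarrow> (y \<in> Y \<longleftrightarrow> y + v \<in> Y))"
    if "v \<in> coord_space {..<n}" "\<forall>i. \<bar>v i\<bar> \<le> s" for v
  proof (rule cone_strata_iff[OF _ cone x x])
    \<comment> \<open>With the apex as center, the offset may be any positive number below
      \<open>r - s\<close>.\<close>
    show "small ((r - s) / 2) (x - x)" using r by (simp add: small_def)
    show "(r - s) / 2 + s < r" using r by (simp add: field_simps)
  qed (use that r(3) small_mono in auto)
  then show ?thesis unfolding quasi_strata_eq[OF r(1,2) x] using strata_coord_space by blast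
qed

lemma affine_form_continuous:
  assumes "affine_form g"
  shows "continuous_on UNIV g"
proof -
  obtain k c a where g: "g = (\<lambda>e. c + (\<Sum>i<k. a i * e i))"
    using assms by (rule affine_formE)
  show ?thesis unfolding g by (intro continuous_intros continuous_on_product_coordinates)
qed

text \<open>In the product topology each single condition is closed since it involves finitely many
  coordinates: vanishing outside \<open>K\<close>, the equations of \<open>V\<close>, and the
  bounds.\<close>

lemma closed_subspace_box:
  assumes V: "subspace V" "V \<subseteq> coord_space K" "finite K"
  shows "closed {v \<in> V. \<forall>i. \<bar>v i\<bar> \<le> s}"
proof -
  obtain F where F: "finite F" "\<And>g. g \<in> F \<Longrightarrow> affine_form g"
    "\<And>x. x - 0 \<in> coord_space K \<Longrightarrow> x - 0 \<in> V \<longleftrightarrow> (\<forall>g\<in>F. g x = 0)"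
    by (rule subspace_equations[OF V]) (rule that)
  have mem: "v \<in> V \<longleftrightarrow> (\<forall>i. i \<in> K \<or> v i = 0) \<and> (\<forall>g\<in>F. g v = 0)" for v
    using F(3)[of v] V(2) unfolding coord_space_def diff_zero by blast
  have eq: "{v \<in> V. \<forall>i. \<bar>v i\<bar> \<le> s} =
    (\<Inter>i. {v. i \<in> K \<or> v i = 0}) \<inter> (\<Inter>g\<in>F. {v. g v = 0}) \<inter> (\<Inter>i. {v. \<bar>v i\<bar> \<le> s})"
    unfolding mem by blast
  have "closed {v :: vec. i \<in> K \<or> v i = 0}" for i
    by (cases "i \<in> K") (auto intro: closed_Collect_eq continuous_on_product_coordinates)
  moreover have "closed {v. g v = 0}" if "g \<in> F" for g
    using affine_form_continuous[OF F(2)[OF that]] by (intro closed_Collect_eq) auto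
  moreover have "closed {v :: vec. \<bar>v i\<bar> \<le> s}" for i
    by (intro closed_Collect_le continuous_on_rabs continuous_on_product_coordinates continuous_on_const)
  ultimately show ?thesis unfolding eq by (intro closed_Int closed_INT) auto
qed

text \<open>In a cone the quasi-strata for the radii \<open>R\<close> and \<open>R / 2\<close> are
  the elements of a subspace bounded by \<open>R / 2\<close>, a closed set stable under halving; a
  short multiple of \<open>v\<close> is the nonzero member.\<close>

lemma not_quasi_singular_cone:
  assumes cone: "cone_at Y {..<n} x R" and x: "x \<in> coord_space {..<n}"
    and v: "v \<in> strata Y {..<n} x" "v \<noteq> 0"
  shows "\<not> quasi_singular n Y x"
proof -
  have R: "R > 0" using cone by (simp add: cone_at_def)
  define s where "s = R / 2"
  have s: "0 < s" "s < R" using R by (auto simp: s_def)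
  note eq = cone_quasi_strata[OF cone x s order_refl]
  note sub = subspace_strata[of "{..<n}" Y x]
  have "\<exists>w\<in>quasi_strata n Y x R s. w \<noteq> (\<lambda>i. 0)"
  proof -
    obtain d where d: "d > 0" "\<And>t. \<bar>t\<bar> < d \<Longrightarrow> small s (t *\<^sub>R v)"
      using ex_small_scale[OF _ strata_coord_space[OF v(1)] s(1)] by blast
    let ?w = "(d/2) *\<^sub>R v"
    have "small s ?w" using d(1) by (intro d(2)) simp
    then have "?w \<in> quasi_strata n Y x R s"
      unfolding eq using subspace_scale[OF sub v(1)] by (auto simp: small_def intro: less_imp_le)
    moreover have "?w \<noteq> (\<lambda>i. 0)"
    proof
      assume "?w = (\<lambda>i. 0)"
      then have "?w = 0" unfolding zero_fun_def .
      then show False using d(1) v(2) by simp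
    qed
    ultimately show ?thesis by blast
  qed
  moreover have "closedin (Euclidean_space n) (quasi_strata n Y x R s)"
    unfolding closedin_Euclidean_space_iff
  proof
    show "closed (quasi_strata n Y x R s)"
      unfolding eq by (rule closed_subspace_box[OF sub strata_subset_coord_space]) auto
    show "quasi_strata n Y x R s \<subseteq> Rvec n" by (auto simp: quasi_strata_def)
  qed
  moreover have "(\<lambda>i. w i / 2) \<in> quasi_strata n Y x R s" if w: "w \<in> quasi_strata n Y x R s" for w
  proof -
    have "(\<lambda>i. w i / 2) = (1/2) *\<^sub>R w" by (simp add: fun_eq_iff)
    moreover have "(1/2) *\<^sub>R w \<in> strata Y {..<n} x"
      using w unfolding eq by (intro subspace_scale[OF sub]) auto
    moreover have "\<bar>w i / 2\<bar> \<le> s" for i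
    proof -
      have "\<bar>w i\<bar> \<le> s" using w unfolding eq by blast
      then show ?thesis using s(1) by simp
    qed
    ultimately show ?thesis unfolding eq by simp
  qed
  ultimately show ?thesis unfolding quasi_singular_def using s by blast
qed

text \<open>A point with trivial strata is determined by the set \<open>Z x\<close> of forms
  vanishing there: if \<open>Z x = Z y\<close>, these forms are constant along \<open>y - x\<close>
  and the others keep their sign near \<open>x\<close>, so \<open>y - x\<close> is a stratum at
  \<open>x\<close>.\<close>

lemma sign_invariant_finite_quasi_singular:
  assumes F: "finite F" "\<And>g. g \<in> F \<Longrightarrow> affine_form g" "sign_invariant F (coord_space {..<n}) Y"
  shows "finite {x \<in> Rvec n. quasi_singular n Y x}"
proof -
  define Z where "Z x = {g \<in> F. g x = 0}" for x
  let ?S = "{x \<in> coord_space {..<n}. strata Y {..<n} x = {0}}"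
  have "x = y" if xy: "x \<in> ?S" "y \<in> ?S" "Z x = Z y" for x y
  proof -
    let ?v = "y - x"
    have x: "x \<in> coord_space {..<n}" and v: "?v \<in> coord_space {..<n}"
      using xy by (auto intro: coord_space_diff)
    obtain R where R: "R > 0"
      "\<And>g u. g \<in> F \<Longrightarrow> g x \<noteq> 0 \<Longrightarrow> small R u \<Longrightarrow> sgn (g (x + u)) = sgn (g x)"
      by (rule ex_sign_stable_radius[OF F(1,2)]) (assumption, rule that)
    obtain d where d: "d > 0" "\<And>t. \<bar>t\<bar> < d \<Longrightarrow> small (R/2) (t *\<^sub>R ?v)"
      using ex_small_scale[OF _ v, of "R/2"] R(1) by auto
    define e where "e = min d (R/2)"
    have "?v \<in> strata Y {..<n} x"
    proof (rule strataI[OF v])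
      show "e > 0" using d(1) R(1) by (simp add: e_def)
      fix u t assume u: "u \<in> coord_space {..<n}" "small e u" and t: "\<bar>t\<bar> < e"
      have su: "small (R/2) u" "small R u"
        using u(2) R(1) by (auto intro: small_mono simp: e_def)
      have st: "small R (u + t *\<^sub>R ?v)"
        using t by (intro small_add[OF su(1) d(2)]) (auto simp: e_def)
      have "sgn (g (x + u)) = sgn (g (x + u + t *\<^sub>R ?v))" if g: "g \<in> F" for g
      proof (cases "g x = 0")
        case True
        then have "g y = 0" using xy(3) g by (auto simp: Z_def)
        have "g (x + u + ?v) - g (x + u) = g (x + ?v) - g x"
          by (rule affine_form_translate[OF F(2)[OF g]])
        then have "g (x + u + ?v) = g (x + u)" using True \<open>g y = 0\<close> by simp
        then show ?thesis using affine_form_line[OF F(2)[OF g], of "x + u" t ?v] by simp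
      next
        case False
        then show ?thesis using R(2)[OF g _ su(2)] R(2)[OF g _ st] by (simp add: add.assoc)
      qed
      moreover have "x + u \<in> coord_space {..<n}" "x + u + t *\<^sub>R ?v \<in> coord_space {..<n}"
        using x u(1) v by (auto intro!: coord_space_add coord_space_scale simp del: scaleR_diff_right)
      ultimately show "x + u \<in> Y \<longleftrightarrow> x + u + t *\<^sub>R ?v \<in> Y"
        using F(3) unfolding sign_invariant_def by blast
    qed
    then have "?v = 0" using xy(1) by auto
    then show "x = y" by simp
  qed
  then have "inj_on Z ?S" by (rule inj_onI)
  moreover have "finite (Z ` ?S)" using F(1) by (rule finite_subset[rotated, OF finite_Pow_iff[THEN iffD2]]) (auto simp: Z_def)
  ultimately have "finite ?S" by (rule finite_imageD[rotated])
  moreover have "{x \<in> Rvec n. quasi_singular n Y x} \<subseteq> ?S"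
  proof
    fix x assume "x \<in> {x \<in> Rvec n. quasi_singular n Y x}"
    then have x: "x \<in> coord_space {..<n}" "quasi_singular n Y x" by (auto simp: Rvec_eq_coord_space)
    obtain R where R: "cone_at Y {..<n} x R" by (rule sign_invariant_cone_at[OF F x(1)])
    have "v = 0" if "v \<in> strata Y {..<n} x" for v
      using not_quasi_singular_cone[OF R x(1) that] x(2) by blast
    moreover have "0 \<in> strata Y {..<n} x" by (rule subspace_0[OF subspace_strata]) simp
    ultimately show "x \<in> ?S" using x(1) by blast
  qed
  ultimately show ?thesis by (rule finite_subset[rotated])
qed

section \<open>Quantifier elimination\<close>

lemma affine_form_eval_tm: "affine_form (\<lambda>e. eval_tm e t)"
  by (induction t) (simp_all add: affine_form_add)

lemma affine_form_case_nat:
  assumes "affine_form g"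
  obtains \<alpha> h where "affine_form h" "\<And>a e. g (case_nat a e) = \<alpha> * a + h e"
proof -
  obtain k c b where g: "g = (\<lambda>e. c + (\<Sum>i<k. b i * e i))"
    using assms by (rule affine_formE)
  show thesis
  proof (cases k)
    case 0
    then show ?thesis using that[of "\<lambda>_. c" 0] by (simp add: g)
  next
    case (Suc l)
    let ?h = "\<lambda>e. c + (\<Sum>i<l. b (Suc i) * e i)"
    have "affine_form ?h"
      unfolding affine_form_def by (intro exI[of _ l] exI[of _ c] exI[of _ "\<lambda>i. b (Suc i)"] refl)
    moreover have "g (case_nat a e) = b 0 * a + ?h e" for a e
      unfolding g Suc sum.lessThan_Suc_shift by simp
    ultimately show ?thesis by (rule that)
  qed
qed

lemma ex_between_finite_sets:
  fixes A B :: "real set"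
  assumes "finite A" "finite B" "\<And>x y. x \<in> A \<Longrightarrow> y \<in> B \<Longrightarrow> x < y"
  obtains z where "\<And>x. x \<in> A \<Longrightarrow> x < z" "\<And>y. y \<in> B \<Longrightarrow> z < y"
proof (cases "A = {}")
  case True
  show thesis
  proof (cases "B = {}")
    case False
    have "Min B - 1 < y" if "y \<in> B" for y using Min_le[OF assms(2) that] by linarith
    then show ?thesis using that True by blast
  qed (use that True in blast)
next
  case A: False
  show thesis
  proof (cases "B = {}")
    case True
    have "x < Max A + 1" if "x \<in> A" for x using Max_ge[OF assms(1) that] by linarith
    then show ?thesis using that True by blast
  next
    case False
    have "Max A < Min B" using A False assms by (intro assms(3) Max_in Min_in)
    then have "x < (Max A + Min B) / 2" if "x \<in> A" for x
      using Max_ge[OF assms(1) that] \<open>Max A < Min B\<close> by (simp add: field_simps)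
    moreover have "(Max A + Min B) / 2 < y" if "y \<in> B" for y
      using Min_le[OF assms(2) that] \<open>Max A < Min B\<close> by (simp add: field_simps)
    ultimately show ?thesis by (rule that)
  qed
qed

text \<open>Either \<open>a\<close> is some \<open>\<xi> i\<close> and \<open>\<xi>' i\<close>
  serves as \<open>a'\<close>, or \<open>a\<close> lies in a gap; the order hypothesis keeps the
  points on its two sides separated, and \<open>a'\<close> is put between them.\<close>

lemma same_order_type_position:
  fixes \<xi> \<xi>' :: "'i \<Rightarrow> real"
  assumes "finite I" and ord: "\<And>i j. i \<in> I \<Longrightarrow> j \<in> I \<Longrightarrow> sgn (\<xi> i - \<xi> j) = sgn (\<xi>' i - \<xi>' j)"
  obtains a' where "\<And>i. i \<in> I \<Longrightarrow> sgn (a - \<xi> i) = sgn (a' - \<xi>' i)"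
proof (cases "\<exists>i\<in>I. a = \<xi> i")
  case True
  then show ?thesis using that ord by metis
next
  case False
  have "\<xi>' i < \<xi>' j" if "i \<in> I" "\<xi> i < a" "j \<in> I" "\<xi> j > a" for i j
    using ord[OF that(1,3)] that(2,4) by (auto simp: sgn_real_def split: if_splits)
  then have sep: "x < y" if "x \<in> \<xi>' ` {i\<in>I. \<xi> i < a}" "y \<in> \<xi>' ` {i\<in>I. \<xi> i > a}" for x y
    using that by auto
  have fin: "finite (\<xi>' ` {i\<in>I. \<xi> i < a})" "finite (\<xi>' ` {i\<in>I. \<xi> i > a})"
    using assms(1) by auto
  obtain a' where a': "\<And>x. x \<in> \<xi>' ` {i\<in>I. \<xi> i < a} \<Longrightarrow> x < a'"
    "\<And>y. y \<in> \<xi>' ` {i\<in>I. \<xi> i > a} \<Longrightarrow> a' < y"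
    by (rule ex_between_finite_sets[OF fin sep]) (assumption, assumption, rule that)
  have "sgn (a - \<xi> i) = sgn (a' - \<xi>' i)" if i: "i \<in> I" for i
  proof (cases "\<xi> i < a")
    case True
    then have "\<xi>' i < a'" using a'(1) i by blast
    then show ?thesis using True by simp
  next
    case nless: False
    then have "\<xi> i > a" using False i by force
    moreover from this have "a' < \<xi>' i" using a'(2) i by blast
    ultimately show ?thesis by simp
  qed
  then show ?thesis by (rule that)
qed

text \<open>The values of \<open>a\<close> for which \<open>case_nat a e\<close> lies in a given sign class are determined by
  the order type of the roots of the forms in \<open>a\<close>, that is, by the signs of the differences of
  these roots, which are affine forms in \<open>e\<close>.\<close>

lemma sign_invariant_projection:
  assumes F: "finite F" "\<And>g. g \<in> F \<Longrightarrow> affine_form g" "sign_invariant F UNIV S"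
  obtains F' where "finite F'" "\<And>g. g \<in> F' \<Longrightarrow> affine_form g"
    "sign_invariant F' UNIV {e. \<exists>a. case_nat a e \<in> S}"
proof -
  have "\<exists>\<alpha> h. affine_form h \<and> (\<forall>a e. g (case_nat a e) = \<alpha> * a + h e)" if "g \<in> F" for g
    using affine_form_case_nat[OF F(2)[OF that]] by metis
  then obtain \<alpha> h where h: "\<And>g. g \<in> F \<Longrightarrow> affine_form (h g)"
    "\<And>g a e. g \<in> F \<Longrightarrow> g (case_nat a e) = \<alpha> g * a + h g e" by metis
  \<comment> \<open>The forms that involve the quantified variable; \<open>\<xi> g e\<close> is the
    value at which such a form vanishes.\<close>
  define I where "I = {g \<in> F. \<alpha> g \<noteq> 0}"
  define \<xi> where "\<xi> g e = - (1 / \<alpha> g) * h g e" for g e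
  define F' where "F' = h ` F \<union> (\<lambda>(f, g) e. \<xi> f e - \<xi> g e) ` (I \<times> I)"
  have "finite I" using F(1) by (simp add: I_def)
  have "finite F'" using F(1) \<open>finite I\<close> by (simp add: F'_def)
  moreover have "affine_form (\<lambda>e. \<xi> f e - \<xi> g e)" if "f \<in> F" "g \<in> F" for f g
    unfolding \<xi>_def using h(1) that by (intro affine_form_diff affine_form_scale)
  then have "affine_form g" if "g \<in> F'" for g using that h(1) unfolding F'_def I_def by auto
  moreover have lift: "\<exists>a'. case_nat a' e' \<in> S"
    if sgn: "\<forall>g\<in>F'. sgn (g e) = sgn (g e')" and a: "case_nat a e \<in> S" for e e' a
  proof -
    have "sgn (\<xi> f e - \<xi> g e) = sgn (\<xi> f e' - \<xi> g e')" if "f \<in> I" "g \<in> I" for f g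
    proof -
      have mem: "(\<lambda>e. \<xi> f e - \<xi> g e) \<in> F'"
        unfolding F'_def using that by (intro UnI2 image_eqI[of _ _ "(f, g)"]) auto
      show ?thesis using bspec[OF sgn mem] .
    qed
    then obtain a' where a': "\<And>g. g \<in> I \<Longrightarrow> sgn (a - \<xi> g e) = sgn (a' - \<xi> g e')"
      using same_order_type_position[OF \<open>finite I\<close>, of "\<lambda>g. \<xi> g e" "\<lambda>g. \<xi> g e'" a] by metis
    have "sgn (g (case_nat a e)) = sgn (g (case_nat a' e'))" if g: "g \<in> F" for g
    proof (cases "\<alpha> g = 0")
      case True
      have "h g \<in> F'" using g by (simp add: F'_def)
      then show ?thesis using sgn True by (simp add: h(2)[OF g])
    next
      case False
      then have "g \<in> I" using g by (simp add: I_def)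
      have "g (case_nat b d) = \<alpha> g * (b - \<xi> g d)" for b d
        using False by (simp add: h(2)[OF g] \<xi>_def algebra_simps)
      then show ?thesis using a'[OF \<open>g \<in> I\<close>] by (simp add: sgn_mult)
    qed
    then have "case_nat a' e' \<in> S" using F(3) a unfolding sign_invariant_def by blast
    then show ?thesis ..
  qed
  have "sign_invariant F' UNIV {e. \<exists>a. case_nat a e \<in> S}"
    unfolding sign_invariant_def mem_Collect_eq
  proof (intro ballI impI iffI; elim exE)
    fix e e' a assume "\<forall>g\<in>F'. sgn (g e) = sgn (g e')" "case_nat a e \<in> S"
    then show "\<exists>a. case_nat a e' \<in> S" by (rule lift)
  next
    fix e e' a assume "\<forall>g\<in>F'. sgn (g e) = sgn (g e')" "case_nat a e' \<in> S"
    then show "\<exists>a. case_nat a e \<in> S" by (intro lift[of e' e]) auto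
  qed
  ultimately show thesis by (rule that)
qed

text \<open>Quantifier elimination in semantic form: connectives only collect forms,
  \<open>Ex\<close> is \<open>sign_invariant_projection\<close>, and the hypothesis excludes the
  relation atom.\<close>

lemma sat_sign_invariant:
  assumes "rel_arities p = {}"
  shows "\<exists>F. finite F \<and> (\<forall>g\<in>F. affine_form g) \<and> sign_invariant F UNIV {e. sat X e p}"
  using assms
proof (induction p)
  case (Eq t u)
  let ?g = "\<lambda>e. eval_tm e t - eval_tm e u"
  have "affine_form ?g" by (intro affine_form_diff affine_form_eval_tm)
  moreover have "sign_invariant {?g} UNIV {e. sat X e (Eq t u)}"
    unfolding sign_invariant_def by (auto simp: sgn_real_def split: if_splits)
  ultimately show ?case by (intro exI[of _ "{?g}"]) blast
next
  case (Less t u)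
  let ?g = "\<lambda>e. eval_tm e t - eval_tm e u"
  have "affine_form ?g" by (intro affine_form_diff affine_form_eval_tm)
  moreover have "sign_invariant {?g} UNIV {e. sat X e (Less t u)}"
    unfolding sign_invariant_def by (auto simp: sgn_real_def split: if_splits)
  ultimately show ?case by (intro exI[of _ "{?g}"]) blast
next
  case (Neg p)
  then show ?case unfolding sign_invariant_def by simp
next
  case (Conj p q)
  then obtain F G where *: "finite F" "\<forall>g\<in>F. affine_form g" "sign_invariant F UNIV {e. sat X e p}"
    "finite G" "\<forall>g\<in>G. affine_form g" "sign_invariant G UNIV {e. sat X e q}" by auto
  then have "sign_invariant (F \<union> G) UNIV {e. sat X e (Conj p q)}"
    unfolding sign_invariant_def by (simp add: ball_Un) blast
  then show ?case using * by (intro exI[of _ "F \<union> G"]) blast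
next
  case (Ex p)
  then obtain F where F: "finite F" "\<And>g. g \<in> F \<Longrightarrow> affine_form g" "sign_invariant F UNIV {e. sat X e p}"
    by auto
  from sign_invariant_projection[OF F]
  have "\<exists>F'. finite F' \<and> (\<forall>g\<in>F'. affine_form g) \<and>
    sign_invariant F' UNIV {e. \<exists>a. case_nat a e \<in> {e. sat X e p}}" by metis
  then show ?case by simp
qed simp

lemma definable_sign_invariant:
  assumes "definable n X"
  obtains F where "finite F" "\<And>g. g \<in> F \<Longrightarrow> affine_form g" "sign_invariant F (coord_space {..<n}) X"
proof -
  obtain p where p: "rel_arities p = {}" "X = {x \<in> Rvec n. sat {} x p}"
    using assms unfolding definable_def by blast
  obtain F where F: "finite F" "\<forall>g\<in>F. affine_form g" "sign_invariant F UNIV {e. sat {} e p}"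
    using sat_sign_invariant[OF p(1)] by blast
  have "sign_invariant F (coord_space {..<n}) X"
    using F(3) unfolding sign_invariant_def p(2) Rvec_eq_coord_space by simp
  then show thesis using that F(1,2) by blast
qed

section \<open>Points that are not quasi-singular\<close>

lemma small_convex:
  assumes "small r z" "small r (z + w)" "0 \<le> t" "t \<le> 1"
  shows "small r (z + t *\<^sub>R w)"
  unfolding small_def
proof
  fix i
  have "(1 - t) * \<bar>z i\<bar> + t * \<bar>z i + w i\<bar> < r"
    using assms by (intro convex_bound_lt) (auto simp: small_def)
  moreover have "\<bar>(1 - t) * z i + t * (z i + w i)\<bar> \<le> (1 - t) * \<bar>z i\<bar> + t * \<bar>z i + w i\<bar>"
    using assms(3,4) abs_triangle_ineq[of "(1 - t) * z i" "t * (z i + w i)"] by (simp add: abs_mult)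
  moreover have "(z + t *\<^sub>R w) i = (1 - t) * z i + t * (z i + w i)" by (simp add: algebra_simps)
  ultimately show "\<bar>(z + t *\<^sub>R w) i\<bar> < r" by simp
qed

text \<open>Halving turns one quasi-stratum \<open>v\<close> into all its dyadic multiples in \<open>[0, 1]\<close>, because a
  translation by a multiple of \<open>v / 2 ^ k\<close> can be split into steps inside the convex ball;
  closedness then gives all real multiples.\<close>

lemma not_quasi_singular_stratum:
  assumes ns: "\<not> quasi_singular n Y x" and x: "x \<in> coord_space {..<n}"
  obtains v where "v \<in> strata Y {..<n} x" "v \<noteq> 0"
proof -
  obtain r s v where rs: "0 < s" "s < r"
    and v: "v \<in> quasi_strata n Y x r s" "v \<noteq> (\<lambda>i. 0)"
    and cl: "closedin (Euclidean_space n) (quasi_strata n Y x r s)"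
    and half: "\<And>v. v \<in> quasi_strata n Y x r s \<Longrightarrow> (\<lambda>i. v i / 2) \<in> quasi_strata n Y x r s"
    using ns unfolding quasi_singular_def by blast
  define Q where "Q = quasi_strata n Y x r s"
  have Q: "Q = {v \<in> coord_space {..<n}. (\<forall>i. \<bar>v i\<bar> \<le> s) \<and>
    (\<forall>y\<in>coord_space {..<n}. small r (y - x) \<longrightarrow> small r (y + v - x) \<longrightarrow> (y \<in> Y \<longleftrightarrow> y + v \<in> Y))}"
    unfolding Q_def by (rule quasi_strata_eq[OF rs x])
  have vQ: "v \<in> Q" using v(1) by (simp add: Q_def)
  have vK: "v \<in> coord_space {..<n}" and vs: "\<And>i. \<bar>v i\<bar> \<le> s" using vQ unfolding Q by blast+
  have halves: "(1 / 2 ^ k) *\<^sub>R v \<in> Q" for k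
  proof (induction k)
    case (Suc k)
    have "(\<lambda>i. ((1 / 2 ^ k) *\<^sub>R v) i / 2) \<in> Q" using half[folded Q_def] Suc by blast
    moreover have "(\<lambda>i. ((1 / 2 ^ k) *\<^sub>R v) i / 2) = (1 / 2 ^ Suc k) *\<^sub>R v" by (simp add: fun_eq_iff)
    ultimately show ?case by (simp only:)
  qed (use vQ in simp)
  have dyadic: "(real j / 2 ^ k) *\<^sub>R v \<in> Q" if j: "j \<le> 2 ^ k" for j k
  proof -
    have "y \<in> Y \<longleftrightarrow> y + (real j / 2 ^ k) *\<^sub>R v \<in> Y"
      if y: "y \<in> coord_space {..<n}" "small r (y - x)" "small r (y + (real j / 2 ^ k) *\<^sub>R v - x)" for y
    proof (cases "j = 0")
      case False
      \<comment> \<open>The intermediate points lie on the segment between two points of the ball,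
        so every single step is covered by the quasi-stratum \<open>v / 2 ^ k\<close>.\<close>
      have ball: "small r (y + (real i / 2 ^ k) *\<^sub>R v - x)" if "i \<le> j" for i
      proof -
        have eq: "(real i / real j) *\<^sub>R ((real j / 2 ^ k) *\<^sub>R v) = (real i / 2 ^ k) *\<^sub>R v"
          using False by simp
        have "small r ((y - x) + (real i / real j) *\<^sub>R ((real j / 2 ^ k) *\<^sub>R v))"
        proof (rule small_convex[OF y(2)])
          show "small r ((y - x) + (real j / 2 ^ k) *\<^sub>R v)"
            using y(3) by (simp only: diff_add_eq)
        qed (use that False in auto)
        then show ?thesis unfolding eq by (simp add: diff_add_eq)
      qed
      have "i \<le> j \<Longrightarrow> y \<in> Y \<longleftrightarrow> y + (real i / 2 ^ k) *\<^sub>R v \<in> Y" for i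
      proof (induction i)
        case (Suc i)
        let ?z = "y + (real i / 2 ^ k) *\<^sub>R v"
        have eq: "?z + (1 / 2 ^ k) *\<^sub>R v = y + (real (Suc i) / 2 ^ k) *\<^sub>R v"
          by (simp add: add_divide_distrib scaleR_add_left add.commute)
        have "?z \<in> coord_space {..<n}" using y(1) vK by (intro coord_space_add coord_space_scale)
        moreover have "small r (?z - x)" "small r (?z + (1 / 2 ^ k) *\<^sub>R v - x)"
          unfolding eq using Suc.prems by (intro ball; simp)+
        ultimately have "?z \<in> Y \<longleftrightarrow> ?z + (1 / 2 ^ k) *\<^sub>R v \<in> Y"
          using halves[of k] unfolding Q by blast
        moreover have "y \<in> Y \<longleftrightarrow> ?z \<in> Y" by (rule Suc.IH) (use Suc.prems in simp)
        ultimately show ?case unfolding eq by blast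
      qed simp
      then show ?thesis by blast
    qed simp
    moreover have "\<bar>((real j / 2 ^ k) *\<^sub>R v) i\<bar> \<le> s" for i
    proof -
      have "real j \<le> 2 ^ k" using j by (metis of_nat_le_iff of_nat_numeral of_nat_power)
      then have "\<bar>(real j / 2 ^ k)\<bar> * \<bar>v i\<bar> \<le> 1 * s" using vs[of i] by (intro mult_mono) auto
      then show ?thesis by (simp add: abs_mult)
    qed
    ultimately show ?thesis unfolding Q using vK coord_space_scale by blast
  qed
  have "closed Q" using cl by (simp add: Q_def closedin_Euclidean_space_iff)
  moreover have "continuous_on UNIV (\<lambda>t :: real. t *\<^sub>R v)"
    by (rule continuous_on_coordinatewise_then_product) (auto intro!: continuous_intros)
  ultimately have clT: "closed ((\<lambda>t. t *\<^sub>R v) -` Q)" by (rule closed_vimage)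
  have mult: "t *\<^sub>R v \<in> Q" if t: "0 \<le> t" "t \<le> 1" for t
  proof (rule ccontr)
    assume "t *\<^sub>R v \<notin> Q"
    then have "t \<in> - ((\<lambda>t. t *\<^sub>R v) -` Q)" by simp
    then obtain e where e: "e > 0" "\<And>t'. dist t' t < e \<Longrightarrow> t' \<in> - ((\<lambda>t. t *\<^sub>R v) -` Q)"
      using clT unfolding closed_def open_dist by blast
    \<comment> \<open>A dyadic mesh below \<open>e\<close>; rounding \<open>t\<close> down to it
      gives a dyadic number in the open set that avoids \<open>Q\<close>.\<close>
    obtain k where k: "(1/2) ^ k < e" using real_arch_pow_inv[OF e(1), of "1/2"] by auto
    define j where "j = nat \<lfloor>t * 2 ^ k\<rfloor>"
    have j: "real j \<le> t * 2 ^ k" "t * 2 ^ k < real j + 1"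
      using t(1) by (auto simp: j_def of_nat_nat)
    have "t * 2 ^ k \<le> 1 * 2 ^ k" using t(2) by (intro mult_right_mono) auto
    then have "real j \<le> 2 ^ k" using j(1) by linarith
    then have "real j \<le> real (2 ^ k)" by (simp only: of_nat_power of_nat_numeral)
    then have "j \<le> 2 ^ k" by (simp only: of_nat_le_iff)
    have "real j / 2 ^ k \<le> t" "t < real j / 2 ^ k + 1 / 2 ^ k"
      using j by (auto simp: field_simps)
    then have "dist (real j / 2 ^ k) t < e"
      using k by (auto simp: dist_real_def power_one_over)
    then show False using e(2) dyadic[OF \<open>j \<le> 2 ^ k\<close>] by blast
  qed
  obtain d where d: "d > 0" "\<And>t. \<bar>t\<bar> < d \<Longrightarrow> small (r/2) (t *\<^sub>R v)"
    using ex_small_scale[OF _ vK, of "r/2"] rs by auto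
  define e where "e = min (min 1 d) (r/2)"
  have "v \<in> strata Y {..<n} x"
  proof (rule strataI[OF vK])
    show "e > 0" using d(1) rs by (simp add: e_def)
    fix u t assume u: "u \<in> coord_space {..<n}" "small e u" and t: "\<bar>t\<bar> < e"
    have su: "small (r/2) u" "small r u" using u(2) rs by (auto intro: small_mono simp: e_def)
    have st: "small r (u + t *\<^sub>R v)"
      using t by (intro small_add[OF su(1) d(2)]) (auto simp: e_def)
    have tQ: "\<bar>t\<bar> *\<^sub>R v \<in> Q" using t by (intro mult) (auto simp: e_def)
    have inv: "\<And>y. y \<in> coord_space {..<n} \<Longrightarrow> small r (y - x) \<Longrightarrow>
      small r (y + \<bar>t\<bar> *\<^sub>R v - x) \<Longrightarrow> (y \<in> Y \<longleftrightarrow> y + \<bar>t\<bar> *\<^sub>R v \<in> Y)"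
      using tQ unfolding Q by blast
    let ?y = "x + u" and ?z = "x + u + t *\<^sub>R v"
    have K: "?y \<in> coord_space {..<n}" "?z \<in> coord_space {..<n}"
      using x u(1) vK by (auto intro!: coord_space_add coord_space_scale)
    have ball: "small r (?y - x)" "small r (?z - x)" using su(2) st by (simp_all add: add.assoc)
    show "?y \<in> Y \<longleftrightarrow> ?z \<in> Y"
    \<comment> \<open>\<open>mult\<close> gives only nonnegative multiples of \<open>v\<close>; for
      negative \<open>t\<close> the translation by \<open>\<bar>t\<bar> v\<close> is read from
      \<open>?z\<close> to \<open>?y\<close>.\<close>
    proof (cases "t \<ge> 0")
      case True
      then have eq: "?y + \<bar>t\<bar> *\<^sub>R v = ?z" by simp
      show ?thesis using inv[OF K(1) ball(1), unfolded eq, OF ball(2)] by blast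
    next
      case False
      then have eq: "?z + \<bar>t\<bar> *\<^sub>R v = ?y" by simp
      show ?thesis using inv[OF K(2) ball(2), unfolded eq, OF ball(1)] by blast
    qed
  qed
  moreover have "v \<noteq> 0" using v(2) unfolding zero_fun_def .
  ultimately show thesis by (rule that)
qed

section \<open>Generalized projections\<close>

text \<open>A sum rather than a lookup: it is linear in \<open>v\<close> for any list, and for
  distinct \<open>l\<close> at most one term is nonzero. It places the entries of a shorter vector
  at the indices in \<open>l\<close>, for fixed and free components alike.\<close>

definition spread :: "nat list \<Rightarrow> vec \<Rightarrow> vec" where
  "spread l v = (\<lambda>i. \<Sum>k<length l. if l ! k = i then v k else 0)"

lemma spread_nth:
  assumes "distinct l" "k < length l"
  shows "spread l v (l ! k) = v k"
proof -
  have "spread l v (l ! k) = (\<Sum>j<length l. if j = k then v j else 0)"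
    unfolding spread_def using assms by (intro sum.cong) (auto simp: nth_eq_iff_index_eq)
  then show ?thesis using assms(2) by simp
qed

lemma spread_notin: "i \<notin> set l \<Longrightarrow> spread l v i = 0"
  unfolding spread_def by (intro sum.neutral) auto

lemma spread_add: "spread l (u + v) = spread l u + spread l v"
  unfolding spread_def fun_eq_iff plus_fun_apply sum.distrib[symmetric]
  by (intro allI sum.cong) auto

lemma spread_scale: "spread l (c *\<^sub>R v) = c *\<^sub>R spread l v"
  unfolding spread_def fun_eq_iff scaleR_fun_apply real_scaleR_def sum_distrib_left
  by (intro allI sum.cong) auto

lemma spread_coord_space: "spread l v \<in> coord_space (set l)"
  by (simp add: coord_space_def spread_notin)

lemma affine_form_spread: "affine_form (\<lambda>v. spread l v i)"
proof -
  have "affine_form (\<lambda>v. if l ! k = i then v k else 0)" for k by (cases "l ! k = i") auto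
  then show ?thesis unfolding spread_def by (intro affine_form_sum)
qed

definition gather :: "nat list \<Rightarrow> vec \<Rightarrow> vec" where
  "gather l x = vec_of_list (map x l)"

lemma gather_apply: "gather l x k = (if k < length l then x (l ! k) else 0)"
  by (simp add: gather_def vec_of_list_def)

lemma gather_add: "gather l (x + y) = gather l x + gather l y"
  by (simp add: fun_eq_iff gather_apply)

lemma gather_coord_space: "gather l x \<in> coord_space {..<length l}"
  by (simp add: coord_space_def gather_apply)

lemma gather_spread:
  assumes "distinct l" "v \<in> coord_space {..<length l}"
  shows "gather l (spread l v) = v"
proof
  fix k show "gather l (spread l v) k = v k"
    using assms by (auto simp: gather_apply spread_nth coord_space_def)
qed

lemma spread_gather:
  assumes "distinct l" "w \<in> coord_space (set l)"
  shows "spread l (gather l w) = w"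
proof
  fix i show "spread l (gather l w) i = w i"
  proof (cases "i \<in> set l")
    case True
    then obtain k where "k < length l" "i = l ! k" by (auto simp: in_set_conv_nth)
    then show ?thesis using spread_nth[OF assms(1), of k] by (simp add: gather_apply)
  next
    case False
    then show ?thesis using assms(2) by (simp add: spread_notin coord_space_def)
  qed
qed

lemma small_gather: "small e u \<Longrightarrow> small e (gather l u)"
  using small_pos[of e u] by (simp add: small_def gather_apply)

definition free_indices :: "nat \<Rightarrow> nat list \<Rightarrow> nat list" where
  "free_indices n s = filter (\<lambda>i. i \<notin> set s) [0..<n]"

lemma free_indices: "distinct (free_indices n s)" "set (free_indices n s) = {..<n} - set s"
  by (auto simp: free_indices_def)

lemma length_free_indices:
  assumes "distinct s" "set s \<subseteq> {..<n}"
  shows "length (free_indices n s) = n - length s"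
proof -
  have "length (free_indices n s) = card ({..<n} - set s)"
    using distinct_card[OF free_indices(1)] by (simp add: free_indices(2))
  also have "\<dots> = n - card (set s)" using assms(2) by (simp add: card_Diff_subset)
  finally show ?thesis using distinct_card[OF assms(1)] by simp
qed

text \<open>Turns the image under the removal of components into a preimage: one summand carries the
  fixed values, the other the free ones, and their supports are disjoint.\<close>

lemma mem_generalized_projection:
  assumes X: "X \<subseteq> coord_space {..<n}" and s: "distinct s" "set s \<subseteq> {..<n}" "length a = length s"
    and y: "y \<in> coord_space {..<length (free_indices n s)}"
  shows "y \<in> generalized_projection n X s a \<longleftrightarrow>
    spread s (vec_of_list a) + spread (free_indices n s) y \<in> X"
proof -
  let ?l = "free_indices n s"
  define b where "b = spread s (vec_of_list a)"
  have bs: "b (s ! j) = a ! j" if "j < length s" for j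
    using that s by (simp add: b_def spread_nth vec_of_list_def)
  have b0: "b i = 0" if "i \<notin> set s" for i using that by (simp add: b_def spread_notin)
  have remove: "remove_components n s x = gather ?l x" for x
    by (simp add: remove_components_def gather_def free_indices_def)
  have gb: "gather ?l b = 0"
  proof
    fix k show "gather ?l b k = 0 k"
      using nth_mem[of k ?l] b0 by (auto simp: gather_apply free_indices(2))
  qed
  show ?thesis unfolding b_def[symmetric]
  proof
    assume "y \<in> generalized_projection n X s a"
    then obtain x where x: "x \<in> X" "\<forall>j<length s. x (s ! j) = a ! j" "y = gather ?l x"
      unfolding generalized_projection_def generalized_section_def remove by blast
    have "x - b \<in> coord_space (set ?l)"
      unfolding coord_space_def
    proof (intro CollectI allI impI)
      fix i assume i: "i \<notin> set ?l"
      show "(x - b) i = 0"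
      proof (cases "i \<in> set s")
        case True
        then obtain j where "j < length s" "i = s ! j" by (auto simp: in_set_conv_nth)
        then show ?thesis using x(2) bs by simp
      next
        case False
        then have "i \<notin> {..<n}" using i by (auto simp: free_indices(2))
        then have "x i = 0" using x(1) X unfolding coord_space_def by blast
        then show ?thesis using b0[OF False] by simp
      qed
    qed
    then have "spread ?l (gather ?l (x - b)) = x - b" by (rule spread_gather[OF free_indices(1)])
    moreover have "gather ?l (x - b) = y"
      using gather_add[of ?l "x - b" b] by (simp add: gb x(3))
    ultimately show "b + spread ?l y \<in> X" using x(1) by simp
  next
    assume mem: "b + spread ?l y \<in> X"
    have "(b + spread ?l y) (s ! j) = a ! j" if "j < length s" for j
    proof -
      have "s ! j \<notin> set ?l" using nth_mem[OF that] by (simp add: free_indices(2))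
      then show ?thesis using bs[OF that] by (simp add: spread_notin)
    qed
    moreover have "gather ?l (b + spread ?l y) = y"
      using gather_spread[OF free_indices(1) y] by (simp add: gather_add gb)
    ultimately show "y \<in> generalized_projection n X s a"
      unfolding generalized_projection_def generalized_section_def remove
      using mem by (intro image_eqI[of _ _ "b + spread ?l y"]) auto
  qed
qed

lemma affine_form_compose:
  assumes "affine_form g" "\<And>i. affine_form (\<lambda>e. \<phi> e i)"
  shows "affine_form (\<lambda>e. g (\<phi> e))"
proof -
  obtain k c a where g: "g = (\<lambda>e. c + (\<Sum>i<k. a i * e i))"
    using assms(1) by (rule affine_formE)
  show ?thesis unfolding g
    by (intro affine_form_add affine_form_const affine_form_sum affine_form_scale assms(2))
qed

text \<open>The generalized projection is the preimage of \<open>X\<close> under an affine map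
  \<open>\<phi>\<close>, so the forms of \<open>X\<close> composed with \<open>\<phi>\<close> are
  forms for it.\<close>

lemma definable_imp_finite_quasi_singular:
  assumes "definable n X" and s: "distinct s" "set s \<subseteq> {..<n}" "length a = length s"
  shows "finite {x \<in> Rvec (n - length s).
    quasi_singular (n - length s) (generalized_projection n X s a) x}"
proof -
  have X: "X \<subseteq> coord_space {..<n}"
    using assms(1) unfolding definable_def Rvec_eq_coord_space by blast
  obtain F where F: "finite F" "\<And>g. g \<in> F \<Longrightarrow> affine_form g" "sign_invariant F (coord_space {..<n}) X"
    by (rule definable_sign_invariant[OF assms(1)]) (rule that)
  let ?m = "length (free_indices n s)"
  define \<phi> where "\<phi> y = spread s (vec_of_list a) + spread (free_indices n s) y" for y
  have \<phi>: "\<phi> y \<in> coord_space {..<n}" for y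
    unfolding \<phi>_def
  proof (rule coord_space_add)
    show "spread s (vec_of_list a) \<in> coord_space {..<n}"
      using spread_coord_space coord_space_mono[OF s(2)] by blast
    have "set (free_indices n s) \<subseteq> {..<n}" by (auto simp: free_indices(2))
    then show "spread (free_indices n s) y \<in> coord_space {..<n}"
      using spread_coord_space coord_space_mono by blast
  qed
  have aff: "affine_form (\<lambda>y. \<phi> y i)" for i
    unfolding \<phi>_def plus_fun_apply by (intro affine_form_add affine_form_const affine_form_spread)
  have "finite ((\<lambda>g y. g (\<phi> y)) ` F)" using F(1) by simp
  moreover have "affine_form g" if g: "g \<in> (\<lambda>g y. g (\<phi> y)) ` F" for g
  proof -
    obtain f where "f \<in> F" "g = (\<lambda>y. f (\<phi> y))" using g by blast
    then show ?thesis using affine_form_compose[OF F(2) aff] by simp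
  qed
  moreover have "sign_invariant ((\<lambda>g y. g (\<phi> y)) ` F) (coord_space {..<?m}) (generalized_projection n X s a)"
    unfolding sign_invariant_def
  proof (intro ballI impI)
    fix x y assume xy: "x \<in> coord_space {..<?m}" "y \<in> coord_space {..<?m}"
      and "\<forall>g\<in>(\<lambda>g y. g (\<phi> y)) ` F. sgn (g x) = sgn (g y)"
    then have "\<forall>g\<in>F. sgn (g (\<phi> x)) = sgn (g (\<phi> y))" unfolding ball_simps by simp
    then have "\<phi> x \<in> X \<longleftrightarrow> \<phi> y \<in> X" using F(3) \<phi> unfolding sign_invariant_def by blast
    then show "x \<in> generalized_projection n X s a \<longleftrightarrow> y \<in> generalized_projection n X s a"
      using mem_generalized_projection[OF X s] xy by (simp add: \<phi>_def)
  qed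
  ultimately show ?thesis
    unfolding length_free_indices[OF s(1,2)] by (rule sign_invariant_finite_quasi_singular)
qed

text \<open>At a point that is not quasi-singular, a nonzero stratum of the projection spreads to
  one of the section. So the points in question are sent, injectively, to quasi-singular points of
  the projection that fixes the components outside \<open>K\<close> as in \<open>b0\<close>.\<close>

lemma finite_relative_singular:
  assumes X: "X \<subseteq> coord_space {..<n}" and K: "K \<subseteq> {..<n}" and b0: "b0 \<in> coord_space {..<n}"
    and fin: "\<And>s a. sorted_wrt (<) s \<Longrightarrow> set s \<subseteq> {..<n} \<Longrightarrow> length a = length s \<Longrightarrow>
       finite {x \<in> Rvec (n - length s). quasi_singular (n - length s) (generalized_projection n X s a) x}"
  shows "finite {x. x - b0 \<in> coord_space K \<and> strata X K x = {0}}"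
proof -
  define s where "s = filter (\<lambda>i. i \<notin> K) [0..<n]"
  define a where "a = map b0 s"
  define l where "l = free_indices n s"
  define b where "b = spread s (vec_of_list a)"
  define m where "m = n - length s"
  define Y where "Y = generalized_projection n X s a"
  have s: "sorted_wrt (<) s" "distinct s" "set s = {..<n} - K" "set s \<subseteq> {..<n}" "length a = length s"
    by (auto simp: s_def a_def sorted_wrt_filter)
  have l: "distinct l" "set l = K" "length l = m"
    using K length_free_indices[OF s(2,4)] free_indices[of n s] by (auto simp: l_def m_def s(3))
  have "finite K" using K finite_subset by blast
  have memY: "y \<in> Y \<longleftrightarrow> b + spread l y \<in> X" if "y \<in> coord_space {..<m}" for y
    unfolding Y_def b_def l_def
    by (rule mem_generalized_projection[OF X s(2,4,5)]) (use that l(3) in \<open>simp add: l_def\<close>)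
  have "b i = b0 i" if "i \<notin> K" for i
  proof (cases "i \<in> set s")
    case True
    then obtain j where "j < length s" "i = s ! j" by (auto simp: in_set_conv_nth)
    then show ?thesis using s(2) by (simp add: b_def spread_nth vec_of_list_def a_def)
  next
    case False
    then show ?thesis using b0 that by (simp add: b_def spread_notin s(3) coord_space_def)
  qed
  then have bK: "b0 - b \<in> coord_space K" by (simp add: coord_space_def)
  have decomp: "x - b = spread l (gather l (x - b))" if "x - b0 \<in> coord_space K" for x
  proof -
    have "(x - b0) + (b0 - b) \<in> coord_space K" using that bK by (rule coord_space_add)
    then show ?thesis using spread_gather[OF l(1)] l(2) by simp
  qed
  let ?S = "{x. x - b0 \<in> coord_space K \<and> strata X K x = {0}}"
  have "inj_on (\<lambda>x. gather l (x - b)) ?S"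
  proof (rule inj_onI)
    fix x y assume "x \<in> ?S" "y \<in> ?S" and eq: "gather l (x - b) = gather l (y - b)"
    then have "x - b = y - b" using decomp[of x] decomp[of y] by simp
    then show "x = y" by simp
  qed
  moreover have "(\<lambda>x. gather l (x - b)) ` ?S \<subseteq> {y \<in> Rvec m. quasi_singular m Y y}"
  proof (rule image_subsetI)
    fix x assume "x \<in> ?S"
    then have x: "x - b0 \<in> coord_space K" "strata X K x = {0}" by auto
    define y where "y = gather l (x - b)"
    have y: "y \<in> coord_space {..<m}" using gather_coord_space[of l "x - b"] l(3) by (simp add: y_def)
    have xy: "x = b + spread l y" using decomp[OF x(1)] by (simp add: y_def algebra_simps)
    have "quasi_singular m Y y"
    proof (rule ccontr)
      assume "\<not> quasi_singular m Y y"
      then obtain v where v: "v \<in> strata Y {..<m} y" "v \<noteq> 0"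
        using not_quasi_singular_stratum[OF _ y] by blast
      have vm: "v \<in> coord_space {..<m}" using v(1) by (rule strata_coord_space)
      obtain e where e: "e > 0" "\<And>u t. u \<in> coord_space {..<m} \<Longrightarrow> small e u \<Longrightarrow> \<bar>t\<bar> < e \<Longrightarrow>
        y + u \<in> Y \<longleftrightarrow> y + u + t *\<^sub>R v \<in> Y" using strataE[OF v(1)] by blast
      have "spread l v \<in> strata X K x"
      proof (rule strataI)
        show "spread l v \<in> coord_space K" using spread_coord_space[of l v] l(2) by simp
        fix u t assume u: "u \<in> coord_space K" "small e u" and t: "\<bar>t\<bar> < e"
        define w where "w = gather l u"
        have w: "w \<in> coord_space {..<m}" "small e w" "spread l w = u"
          using gather_coord_space[of l u] l small_gather[OF u(2)] spread_gather[OF l(1)] u(1)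
          by (auto simp: w_def)
        have yw: "y + w \<in> coord_space {..<m}" using y w(1) by (rule coord_space_add)
        then have ywv: "y + w + t *\<^sub>R v \<in> coord_space {..<m}"
          by (rule coord_space_add[OF _ coord_space_scale[OF vm]])
        have eq1: "x + u = b + spread l (y + w)" by (simp add: xy spread_add w(3) add.assoc)
        have eq2: "x + u + t *\<^sub>R spread l v = b + spread l (y + w + t *\<^sub>R v)"
          by (simp add: xy spread_add spread_scale w(3) add.assoc)
        show "x + u \<in> X \<longleftrightarrow> x + u + t *\<^sub>R spread l v \<in> X"
          unfolding eq2 unfolding eq1 using e(2)[OF w(1,2) t] memY[OF yw] memY[OF ywv] by blast
      qed (rule e(1))
      then have "spread l v = 0" using x(2) by blast
      then have "v k = 0" if "k < m" for k
        using spread_nth[OF l(1), of k v] l(3) that by simp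
      then have "v = 0" using vm by (auto simp: coord_space_def fun_eq_iff)
      then show False using v(2) by blast
    qed
    then show "gather l (x - b) \<in> {y \<in> Rvec m. quasi_singular m Y y}"
      using y unfolding Rvec_eq_coord_space y_def by blast
  qed
  moreover have "finite {y \<in> Rvec m. quasi_singular m Y y}"
    unfolding Y_def m_def by (rule fin[OF s(1,4,5)])
  ultimately show ?thesis by (meson finite_imageD finite_subset)
qed

section \<open>First-order definability\<close>

fun rename_tm :: "(nat \<Rightarrow> nat) \<Rightarrow> tm \<Rightarrow> tm" where
  "rename_tm \<sigma> (Var i) = Var (\<sigma> i)"
| "rename_tm \<sigma> One = One"
| "rename_tm \<sigma> (Plus t u) = Plus (rename_tm \<sigma> t) (rename_tm \<sigma> u)"

fun rename :: "(nat \<Rightarrow> nat) \<Rightarrow> fm \<Rightarrow> fm" where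
  "rename \<sigma> (Eq t u) = Eq (rename_tm \<sigma> t) (rename_tm \<sigma> u)"
| "rename \<sigma> (Less t u) = Less (rename_tm \<sigma> t) (rename_tm \<sigma> u)"
| "rename \<sigma> (Rel ts) = Rel (map (rename_tm \<sigma>) ts)"
| "rename \<sigma> (Neg p) = Neg (rename \<sigma> p)"
| "rename \<sigma> (Conj p q) = Conj (rename \<sigma> p) (rename \<sigma> q)"
| "rename \<sigma> (Ex p) = Ex (rename (case_nat 0 (\<lambda>i. Suc (\<sigma> i))) p)"

lemma eval_rename_tm: "eval_tm e (rename_tm \<sigma> t) = eval_tm (\<lambda>i. e (\<sigma> i)) t"
  by (induction t) auto

lemma sat_rename: "sat X e (rename \<sigma> p) \<longleftrightarrow> sat X (\<lambda>i. e (\<sigma> i)) p"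
proof (induction p arbitrary: e \<sigma>)
  case (Rel ts)
  have "eval_tm e \<circ> rename_tm \<sigma> = eval_tm (\<lambda>i. e (\<sigma> i))" by (simp add: fun_eq_iff eval_rename_tm)
  then show ?case by simp
next
  case (Ex p)
  have "(\<lambda>i. case_nat a e (case_nat 0 (\<lambda>i. Suc (\<sigma> i)) i)) = case_nat a (\<lambda>i. e (\<sigma> i))" for a
    by (simp add: fun_eq_iff split: nat.split)
  then show ?case using Ex by simp
qed (auto simp: eval_rename_tm)

lemma rel_arities_rename [simp]: "rel_arities (rename \<sigma> p) = rel_arities p"
  by (induction p arbitrary: \<sigma>) auto

lemma tm_vars_rename_tm: "tm_vars (rename_tm \<sigma> t) = \<sigma> ` tm_vars t"
  by (induction t) auto

lemma free_vars_rename: "free_vars (rename \<sigma> p) \<subseteq> \<sigma> ` free_vars p"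
proof (induction p arbitrary: \<sigma>)
  case (Ex p)
  show ?case
  proof
    fix i assume "i \<in> free_vars (rename \<sigma> (Ex p))"
    then have "Suc i \<in> case_nat 0 (\<lambda>i. Suc (\<sigma> i)) ` free_vars p" using Ex by auto
    then obtain j where "j \<in> free_vars p" "Suc i = case_nat 0 (\<lambda>i. Suc (\<sigma> i)) j" by blast
    then show "i \<in> \<sigma> ` free_vars (Ex p)" by (cases j) auto
  qed
next
  case (Rel ts)
  then show ?case by (auto simp: tm_vars_rename_tm)
next
  case (Conj p q)
  then show ?case by fastforce
qed (auto simp: tm_vars_rename_tm)

lemma eval_tm_cong: "(\<And>i. i \<in> tm_vars t \<Longrightarrow> e i = e' i) \<Longrightarrow> eval_tm e t = eval_tm e' t"
  by (induction t) auto

lemma sat_cong: "(\<And>i. i \<in> free_vars p \<Longrightarrow> e i = e' i) \<Longrightarrow> sat X e p \<longleftrightarrow> sat X e' p"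
proof (induction p arbitrary: e e')
  case (Rel ts)
  then have "map (eval_tm e) ts = map (eval_tm e') ts"
    by (intro map_cong refl eval_tm_cong) auto
  then show ?case by (simp only: sat.simps)
next
  case (Conj p q)
  have "sat X e p \<longleftrightarrow> sat X e' p" "sat X e q \<longleftrightarrow> sat X e' q"
    using Conj.prems by (auto intro!: Conj.IH)
  then show ?case by simp
next
  case (Ex p)
  have "sat X (case_nat a e) p \<longleftrightarrow> sat X (case_nat a e') p" for a
    using Ex.prems by (intro Ex.IH) (auto split: nat.split)
  then show ?case by simp
next
  case (Eq t u)
  then show ?case using eval_tm_cong[of t e e'] eval_tm_cong[of u e e'] by simp
next
  case (Less t u)
  then show ?case using eval_tm_cong[of t e e'] eval_tm_cong[of u e e'] by simp
next
  case (Neg p)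
  have "sat X e p \<longleftrightarrow> sat X e' p" using Neg.prems by (intro Neg.IH) auto
  then show ?case by simp
qed

lemma finite_free_vars: "finite (free_vars p)"
proof (induction p)
  case (Ex p)
  have "free_vars (Ex p) \<subseteq> (\<lambda>i. i - 1) ` free_vars p" by force
  then show ?case using Ex finite_surj by blast
next
  case (Rel ts)
  have "finite (tm_vars t)" for t by (induction t) auto
  then show ?case by simp
next
  case (Eq t u)
  have "finite (tm_vars t)" for t by (induction t) auto
  then show ?case by simp
next
  case (Less t u)
  have "finite (tm_vars t)" for t by (induction t) auto
  then show ?case by simp
qed auto

text \<open>Predicates on whole environments, with no bound on the free variables, have closure
  properties without de Bruijn bookkeeping. \<open>N\<close> is \<open>{n}\<close> for the language
  with \<open>X\<close> and \<open>{}\<close> for the one without.\<close>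

definition first_order :: "nat set \<Rightarrow> vec set \<Rightarrow> (vec \<Rightarrow> bool) \<Rightarrow> bool" where
  "first_order N X P \<longleftrightarrow> (\<exists>p. rel_arities p \<subseteq> N \<and> (\<forall>e. P e \<longleftrightarrow> sat X e p))"

lemma first_orderI: "rel_arities p \<subseteq> N \<Longrightarrow> (\<And>e. P e \<longleftrightarrow> sat X e p) \<Longrightarrow> first_order N X P"
  unfolding first_order_def by blast

lemma first_order_True: "first_order N X (\<lambda>e. True)"
  by (rule first_orderI[of "Eq One One"]) auto

lemma first_order_not: "first_order N X P \<Longrightarrow> first_order N X (\<lambda>e. \<not> P e)"
  unfolding first_order_def by (metis rel_arities.simps(4) sat.simps(4))

lemma first_order_conj:
  assumes "first_order N X P" "first_order N X Q"
  shows "first_order N X (\<lambda>e. P e \<and> Q e)"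
proof -
  obtain p q where "rel_arities p \<subseteq> N" "\<forall>e. P e \<longleftrightarrow> sat X e p" "rel_arities q \<subseteq> N" "\<forall>e. Q e \<longleftrightarrow> sat X e q"
    using assms unfolding first_order_def by blast
  then show ?thesis by (intro first_orderI[of "Conj p q"]) auto
qed

lemma first_order_imp:
  assumes "first_order N X P" "first_order N X Q"
  shows "first_order N X (\<lambda>e. P e \<longrightarrow> Q e)"
  using first_order_not[OF first_order_conj[OF assms(1) first_order_not[OF assms(2)]]] by simp

lemma first_order_iff:
  assumes "first_order N X P" "first_order N X Q"
  shows "first_order N X (\<lambda>e. P e \<longleftrightarrow> Q e)"
  using first_order_conj[OF first_order_imp[OF assms] first_order_imp[OF assms(2,1)]]
  by (simp add: iff_conv_conj_imp)

lemma first_order_ball: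
  assumes "finite I" "\<And>i. i \<in> I \<Longrightarrow> first_order N X (P i)"
  shows "first_order N X (\<lambda>e. \<forall>i\<in>I. P i e)"
  using assms
proof (induction I rule: finite_induct)
  case (insert i I)
  then have "first_order N X (\<lambda>e. P i e \<and> (\<forall>i\<in>I. P i e))" by (intro first_order_conj) auto
  then show ?case by simp
qed (simp add: first_order_True)

lemma first_order_bex:
  assumes "finite I" "\<And>i. i \<in> I \<Longrightarrow> first_order N X (P i)"
  shows "first_order N X (\<lambda>e. \<exists>i\<in>I. P i e)"
  using first_order_not[OF first_order_ball[OF assms(1) first_order_not[OF assms(2)]]] by simp

text \<open>Quantification over a variable given by its index: \<open>\<sigma>\<close> sends
  \<open>j\<close> to the bound index 0 and shifts the other variables.\<close>

lemma first_order_all_update: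
  assumes "first_order N X P"
  shows "first_order N X (\<lambda>e. \<forall>a. P (e(j := a)))"
proof -
  obtain p where p: "rel_arities p \<subseteq> N" "\<And>e. P e \<longleftrightarrow> sat X e p"
    using assms unfolding first_order_def by blast
  define \<sigma> where "\<sigma> i = (if i = j then 0 else Suc i)" for i
  have "(\<lambda>i. case_nat a e (\<sigma> i)) = e(j := a)" for a :: real and e
    by (simp add: fun_eq_iff \<sigma>_def)
  then show ?thesis
    by (intro first_orderI[of "Neg (Ex (Neg (rename \<sigma> p)))"]) (simp_all add: p sat_rename)
qed

lemma first_order_all_block:
  assumes "finite J" "first_order N X P"
  shows "first_order N X (\<lambda>e. \<forall>e'. (\<forall>i. i \<notin> J \<longrightarrow> e' i = e i) \<longrightarrow> P e')"
  using assms(1)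
proof (induction J rule: finite_induct)
  case empty
  have "(\<forall>e'. (\<forall>i. i \<notin> {} \<longrightarrow> e' i = e i) \<longrightarrow> P e') \<longleftrightarrow> P e" for e
    by (simp add: fun_eq_iff[symmetric])
  then show ?case using assms(2) by (simp only:)
next
  case (insert j J)
  have "(\<forall>e'. (\<forall>i. i \<notin> insert j J \<longrightarrow> e' i = e i) \<longrightarrow> P e') \<longleftrightarrow>
    (\<forall>a e'. (\<forall>i. i \<notin> J \<longrightarrow> e' i = (e(j := a)) i) \<longrightarrow> P e')" for e
  proof
    assume l: "\<forall>e'. (\<forall>i. i \<notin> insert j J \<longrightarrow> e' i = e i) \<longrightarrow> P e'"
    show "\<forall>a e'. (\<forall>i. i \<notin> J \<longrightarrow> e' i = (e(j := a)) i) \<longrightarrow> P e'"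
      by (intro allI impI l[rule_format]) auto
  next
    assume r: "\<forall>a e'. (\<forall>i. i \<notin> J \<longrightarrow> e' i = (e(j := a)) i) \<longrightarrow> P e'"
    show "\<forall>e'. (\<forall>i. i \<notin> insert j J \<longrightarrow> e' i = e i) \<longrightarrow> P e'"
    proof (intro allI impI)
      fix e' assume "\<forall>i. i \<notin> insert j J \<longrightarrow> e' i = e i"
      then show "P e'" by (intro r[rule_format, of e' "e' j"]) auto
    qed
  qed
  then show ?case using first_order_all_update[OF insert.IH, of j] by (simp only:)
qed

section \<open>Rational points, and affine forms expressible by terms\<close>

definition has_rational_points :: "nat \<Rightarrow> vec set \<Rightarrow> bool" where
  "has_rational_points n X \<longleftrightarrow>
     (\<forall>k S. definable_with n X k S \<longrightarrow> S \<noteq> {} \<longrightarrow> (\<exists>x\<in>S. \<forall>i<k. x i \<in> \<rat>))"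

text \<open>A formula has finitely many free variables, so the environment may be cut off at some
  \<open>k\<close>; the coordinates beyond are 0 and thus rational as well.\<close>

lemma rational_point:
  assumes hyp: "has_rational_points n X"
    and P: "first_order {n} X P" "P e0"
  obtains e where "P e" "\<And>i. e i \<in> \<rat>"
proof -
  obtain p where p: "rel_arities p \<subseteq> {n}" "\<And>e. P e \<longleftrightarrow> sat X e p"
    using P(1) unfolding first_order_def by blast
  obtain k where k: "free_vars p \<subseteq> {..<k}"
    using finite_free_vars finite_nat_iff_bounded by blast
  let ?S = "{x \<in> Rvec k. sat X x p}"
  have "(\<lambda>i. if i < k then e0 i else 0) \<in> ?S"
  proof -
    have "sat X (\<lambda>i. if i < k then e0 i else 0) p \<longleftrightarrow> sat X e0 p"
      using k by (intro sat_cong) auto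
    then show ?thesis using P(2) p(2) by (simp add: topspace_Euclidean_space)
  qed
  moreover have "definable_with n X k ?S" unfolding definable_with_def using p(1) k by blast
  ultimately obtain x where x: "x \<in> ?S" "\<forall>i<k. x i \<in> \<rat>"
    using hyp unfolding has_rational_points_def by blast
  have "x i \<in> \<rat>" for i
    using x by (cases "i < k") (auto simp: topspace_Euclidean_space)
  then show thesis using that x(1) p(2) by blast
qed

text \<open>The language has neither subtraction nor division, so that a rational affine form is a
  difference of two terms up to an integer factor.\<close>

definition rational_form :: "(vec \<Rightarrow> real) \<Rightarrow> bool" where
  "rational_form g \<longleftrightarrow>
     (\<exists>t u N. N > 0 \<and> (\<forall>e. real N * g e = eval_tm e t - eval_tm e u))"

lemma rational_formI:
  "N > 0 \<Longrightarrow> (\<And>e. real N * g e = eval_tm e t - eval_tm e u) \<Longrightarrow> rational_form g"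
  unfolding rational_form_def by blast

lemma rational_formE:
  assumes "rational_form g"
  obtains t u N where "N > 0" "\<And>e. real N * g e = eval_tm e t - eval_tm e u"
  using assms unfolding rational_form_def by blast

lemma ex_tm_multiple:
  assumes "N > 0"
  obtains t' where "\<And>e. eval_tm e t' = real N * eval_tm e t"
proof -
  \<comment> \<open>The base case is one copy of \<open>t\<close>, since no term is 0 in every
    environment.\<close>
  have "\<exists>t'. \<forall>e. eval_tm e t' = real (Suc M) * eval_tm e t" for M
  proof (induction M)
    case (Suc M)
    then obtain t' where "\<forall>e. eval_tm e t' = real (Suc M) * eval_tm e t" by blast
    then show ?case by (intro exI[of _ "Plus t' t"]) (simp add: algebra_simps)
  qed (auto intro: exI[of _ t])
  from this[of "N - 1"] show thesis using assms that by auto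
qed

lemma rational_form_coord: "rational_form (\<lambda>e. e i)"
  \<comment> \<open>In the absence of a term for 0, \<open>One\<close> is added and
    subtracted.\<close>
  by (rule rational_formI[of 1 _ "Plus (Var i) One" One]) auto

lemma rational_form_neg:
  assumes "rational_form f"
  shows "rational_form (\<lambda>e. - f e)"
proof -
  obtain t u N where "N > 0" "\<And>e. real N * f e = eval_tm e t - eval_tm e u"
    using assms by (rule rational_formE) (rule that)
  then show ?thesis by (intro rational_formI[of N _ u t]) auto
qed

lemma rational_form_add:
  assumes "rational_form f" "rational_form g"
  shows "rational_form (\<lambda>e. f e + g e)"
proof -
  obtain t u N where f: "N > 0" "\<And>e. real N * f e = eval_tm e t - eval_tm e u"
    using assms(1) by (rule rational_formE) (rule that)
  obtain t' u' N' where g: "N' > 0" "\<And>e. real N' * g e = eval_tm e t' - eval_tm e u'"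
    using assms(2) by (rule rational_formE) (rule that)
  obtain s1 where s1: "\<And>e. eval_tm e s1 = real N' * eval_tm e t" using ex_tm_multiple[OF g(1)] by metis
  obtain s2 where s2: "\<And>e. eval_tm e s2 = real N * eval_tm e t'" using ex_tm_multiple[OF f(1)] by metis
  obtain w1 where w1: "\<And>e. eval_tm e w1 = real N' * eval_tm e u" using ex_tm_multiple[OF g(1)] by metis
  obtain w2 where w2: "\<And>e. eval_tm e w2 = real N * eval_tm e u'" using ex_tm_multiple[OF f(1)] by metis
  show ?thesis
  proof (rule rational_formI[of "N * N'" _ "Plus s1 s2" "Plus w1 w2"])
    fix e
    have "real (N * N') * (f e + g e) = real N' * (real N * f e) + real N * (real N' * g e)"
      by (simp add: algebra_simps)
    also have "\<dots> = eval_tm e (Plus s1 s2) - eval_tm e (Plus w1 w2)"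
      unfolding f(2) g(2) by (simp add: s1 s2 w1 w2 algebra_simps)
    finally show "real (N * N') * (f e + g e) = eval_tm e (Plus s1 s2) - eval_tm e (Plus w1 w2)" .
  qed (use f(1) g(1) in simp)
qed

lemma rational_form_diff:
  "rational_form f \<Longrightarrow> rational_form g \<Longrightarrow> rational_form (\<lambda>e. f e - g e)"
  using rational_form_add[OF _ rational_form_neg] by fastforce

lemma rational_form_zero: "rational_form (\<lambda>e. 0)"
  by (rule rational_formI[of 1 _ One One]) auto

lemma rational_form_scale:
  assumes "rational_form f" "r \<in> \<rat>"
  shows "rational_form (\<lambda>e. r * f e)"
proof -
  have pos: "rational_form (\<lambda>e. (real k / real l) * f e)" if kl: "k > 0" "l > 0" for k l
  proof -
    obtain t u N where f: "N > 0" "\<And>e. real N * f e = eval_tm e t - eval_tm e u"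
      using assms(1) by (rule rational_formE) (rule that)
    obtain t' where t': "\<And>e. eval_tm e t' = real k * eval_tm e t" using ex_tm_multiple[OF kl(1)] by metis
    obtain u' where u': "\<And>e. eval_tm e u' = real k * eval_tm e u" using ex_tm_multiple[OF kl(1)] by metis
    show ?thesis
    proof (rule rational_formI[of "N * l" _ t' u'])
      fix e
      have "real (N * l) * ((real k / real l) * f e) = real k * (real N * f e)"
        using kl(2) by simp
      also have "\<dots> = eval_tm e t' - eval_tm e u'"
        unfolding f(2) by (simp add: t' u' algebra_simps)
      finally show "real (N * l) * ((real k / real l) * f e) = eval_tm e t' - eval_tm e u'" .
    qed (use f(1) kl(2) in simp)
  qed
  obtain k l where kl: "l \<noteq> 0" "\<bar>r\<bar> = real k / real l"
    using Rats_abs_nat_div_natE[OF assms(2)] by metis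
  show ?thesis
  proof (cases "k = 0")
    case True
    then show ?thesis using kl(2) rational_form_zero by simp
  next
    case False
    then have abs: "rational_form (\<lambda>e. \<bar>r\<bar> * f e)" unfolding kl(2) using kl(1) by (intro pos) auto
    show ?thesis
    proof (cases "r \<ge> 0")
      case True
      then show ?thesis using abs by simp
    next
      case False
      then show ?thesis using rational_form_neg[OF abs] by simp
    qed
  qed
qed

lemma rational_form_const:
  assumes "r \<in> \<rat>"
  shows "rational_form (\<lambda>e. r)"
proof -
  have "rational_form (\<lambda>e. 1)" by (rule rational_formI[of 1 _ "Plus One One" One]) auto
  then show ?thesis using rational_form_scale[OF _ assms, of "\<lambda>e. 1"] by simp
qed

lemma rational_form_sum:
  assumes "\<And>j. j \<in> J \<Longrightarrow> rational_form (f j)"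
  shows "rational_form (\<lambda>e. \<Sum>j\<in>J. f j e)"
  using assms
proof (induction J rule: infinite_finite_induct)
  case (insert j J)
  then have "rational_form (\<lambda>e. f j e + (\<Sum>j\<in>J. f j e))" by (intro rational_form_add) auto
  then show ?case using insert(1,2) by simp
qed (simp_all add: rational_form_zero)

lemmas rational_form_intros = rational_form_coord rational_form_add rational_form_diff
  rational_form_neg rational_form_zero rational_form_sum

lemma rational_form_affine_form:
  assumes "rational_form g"
  shows "affine_form g"
proof -
  obtain t u N where g: "N > 0" "\<And>e. real N * g e = eval_tm e t - eval_tm e u"
    using assms by (rule rational_formE) (rule that)
  have "g = (\<lambda>e. (1 / real N) * (eval_tm e t - eval_tm e u))"
    using g(1) by (simp add: fun_eq_iff flip: g(2))
  then show ?thesis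
    using affine_form_scale[OF affine_form_diff[OF affine_form_eval_tm affine_form_eval_tm]]
    by (simp only:)
qed

lemma first_order_less:
  assumes "rational_form f" "rational_form g"
  shows "first_order N X (\<lambda>e. f e < g e)"
proof -
  obtain t u M where h: "M > 0" "\<And>e. real M * (f e - g e) = eval_tm e t - eval_tm e u"
    using rational_form_diff[OF assms] by (rule rational_formE) (rule that)
  show ?thesis
  proof (rule first_orderI[of "Less t u"])
    fix e
    have "f e < g e \<longleftrightarrow> real M * (f e - g e) < 0" using h(1) by (simp add: mult_less_0_iff)
    then show "f e < g e \<longleftrightarrow> sat X e (Less t u)" unfolding h(2) by simp
  qed simp
qed

lemma first_order_le:
  assumes "rational_form f" "rational_form g"
  shows "first_order N X (\<lambda>e. f e \<le> g e)"
  using first_order_not[OF first_order_less[OF assms(2,1)]] by (simp add: not_less)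

lemma first_order_eq:
  assumes "rational_form f" "rational_form g"
  shows "first_order N X (\<lambda>e. f e = g e)"
  using first_order_conj[OF first_order_le[OF assms] first_order_le[OF assms(2,1)]]
  by (simp add: eq_iff)

section \<open>Rationality of the flats\<close>

text \<open>Layout of the environments: blocks 0, 1 and 2 hold a base point, a translation vector
  and the quantified point, and variable \<open>3 * n\<close> holds the radius.\<close>

definition block :: "nat \<Rightarrow> nat \<Rightarrow> vec \<Rightarrow> vec" where
  "block n k e = (\<lambda>i. if i < n then e (k * n + i) else 0)"

lemma block_coord_space: "block n k e \<in> coord_space {..<n}"
  by (simp add: block_def coord_space_def)

lemma rational_form_block: "rational_form (\<lambda>e. block n k e i)"
  by (cases "i < n") (simp_all add: block_def rational_form_intros)

lemma first_order_small:
  assumes "rational_form \<rho>" "\<And>i. rational_form (\<lambda>e. w e i)" "\<And>e. w e \<in> coord_space {..<n}"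
  shows "first_order N X (\<lambda>e. small (\<rho> e) (w e))"
proof -
  have "small (\<rho> e) (w e) \<longleftrightarrow> 0 < \<rho> e \<and> (\<forall>i\<in>{..<n}. w e i < \<rho> e \<and> - w e i < \<rho> e)" for e
  proof
    assume "small (\<rho> e) (w e)"
    then show "0 < \<rho> e \<and> (\<forall>i\<in>{..<n}. w e i < \<rho> e \<and> - w e i < \<rho> e)"
      using small_pos by (auto simp: small_def abs_less_iff)
  next
    assume r: "0 < \<rho> e \<and> (\<forall>i\<in>{..<n}. w e i < \<rho> e \<and> - w e i < \<rho> e)"
    have "\<bar>w e i\<bar> < \<rho> e" for i
      using r assms(3)[of e] by (cases "i < n") (auto simp: coord_space_def abs_less_iff)
    then show "small (\<rho> e) (w e)" by (simp add: small_def)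
  qed
  moreover have "first_order N X (\<lambda>e. 0 < \<rho> e \<and> (\<forall>i\<in>{..<n}. w e i < \<rho> e \<and> - w e i < \<rho> e))"
    by (intro first_order_conj first_order_ball first_order_less rational_form_zero
        rational_form_neg assms(1,2)) simp
  ultimately show ?thesis by (simp only:)
qed

lemma first_order_mem:
  "first_order {n} X (\<lambda>e. block n k e \<in> X)"
  "first_order {n} X (\<lambda>e. block n k e + block n l e \<in> X)"
proof -
  have "block n k e = vec_of_list (map (eval_tm e) (map (\<lambda>i. Var (k * n + i)) [0..<n]))" for e
    by (simp add: fun_eq_iff block_def vec_of_list_def)
  then show "first_order {n} X (\<lambda>e. block n k e \<in> X)"
    by (intro first_orderI[of "Rel (map (\<lambda>i. Var (k * n + i)) [0..<n])"]) simp_all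
  have "block n k e + block n l e =
    vec_of_list (map (eval_tm e) (map (\<lambda>i. Plus (Var (k * n + i)) (Var (l * n + i))) [0..<n]))" for e
    by (simp add: fun_eq_iff block_def vec_of_list_def)
  then show "first_order {n} X (\<lambda>e. block n k e + block n l e \<in> X)"
    by (intro first_orderI[of "Rel (map (\<lambda>i. Plus (Var (k * n + i)) (Var (l * n + i))) [0..<n])"]) simp_all
qed

text \<open>The condition on a quasi-stratum, for one box. Unlike the definition of
  \<open>strata\<close> it has no product of two variables, so it is first-order in
  \<open>r\<close>, \<open>q\<close> and \<open>v\<close> together.\<close>

definition translation_invariant :: "vec set \<Rightarrow> nat \<Rightarrow> real \<Rightarrow> vec \<Rightarrow> vec \<Rightarrow> bool" where
  "translation_invariant X n r q v \<longleftrightarrow> (\<forall>y\<in>coord_space {..<n}.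
     small r (y - q) \<longrightarrow> small r (y + v - q) \<longrightarrow> (y \<in> X \<longleftrightarrow> y + v \<in> X))"

lemma first_order_translation_invariant:
  "first_order {n} X (\<lambda>e. translation_invariant X n (e (3 * n)) (block n 0 e) (block n 1 e))"
proof -
  define P where "P e \<longleftrightarrow> small (e (3 * n)) (block n 2 e - block n 0 e) \<longrightarrow>
    small (e (3 * n)) (block n 2 e + block n 1 e - block n 0 e) \<longrightarrow>
    (block n 2 e \<in> X \<longleftrightarrow> block n 2 e + block n 1 e \<in> X)" for e
  \<comment> \<open>Block 2, the variables of the universally quantified \<open>y\<close>.\<close>
  define J where "J = {2 * n..<3 * n}"
  have "first_order {n} X P"
    unfolding P_def
    by (intro first_order_imp first_order_iff first_order_mem first_order_small[where n = n]
        coord_space_add coord_space_diff block_coord_space rational_form_coord)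
      (simp_all add: rational_form_diff rational_form_add rational_form_block)
  then have "first_order {n} X (\<lambda>e. \<forall>e'. (\<forall>i. i \<notin> J \<longrightarrow> e' i = e i) \<longrightarrow> P e')"
    by (intro first_order_all_block) (simp_all add: J_def)
  moreover have "translation_invariant X n (e (3 * n)) (block n 0 e) (block n 1 e) \<longleftrightarrow>
    (\<forall>e'. (\<forall>i. i \<notin> J \<longrightarrow> e' i = e i) \<longrightarrow> P e')" (is "?l \<longleftrightarrow> ?r") for e
  proof
    assume l: ?l
    show ?r
    proof (intro allI impI)
      fix e' assume e': "\<forall>i. i \<notin> J \<longrightarrow> e' i = e i"
      have "block n 0 e' = block n 0 e" "block n 1 e' = block n 1 e" "e' (3 * n) = e (3 * n)"
        using e' by (auto simp: block_def J_def fun_eq_iff)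
      then show "P e'" using l block_coord_space[of n 2 e'] unfolding P_def translation_invariant_def by simp
    qed
  next
    assume r: ?r
    show ?l
      unfolding translation_invariant_def
    proof
      fix y assume y: "y \<in> coord_space {..<n}"
      define e' where "e' i = (if i \<in> J then y (i - 2 * n) else e i)" for i
      have "block n 0 e' = block n 0 e" "block n 1 e' = block n 1 e" "e' (3 * n) = e (3 * n)"
        "block n 2 e' = y"
        using y by (auto simp: block_def J_def e'_def fun_eq_iff coord_space_def)
      moreover have "P e'" using r by (simp add: e'_def)
      ultimately show "small (e (3 * n)) (y - block n 0 e) \<longrightarrow>
        small (e (3 * n)) (y + block n 1 e - block n 0 e) \<longrightarrow> (y \<in> X \<longleftrightarrow> y + block n 1 e \<in> X)"
        unfolding P_def by (simp only:)
    qed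
  qed
  ultimately show ?thesis by (simp only:)
qed

lemma ex_rational_ball:
  assumes "R > 0" "x \<in> coord_space {..<n}"
  obtains q r s m M where "q \<in> coord_space {..<n}" "\<And>i. q i \<in> \<rat>" "r \<in> \<rat>" "s \<in> \<rat>" "0 < s" "0 < r" "r < R"
    "M < R" "\<And>y. small r (y - q) \<Longrightarrow> small M (y - x)" "small m (x - q)" "m + s < r"
proof -
  \<comment> \<open>All radii are multiples of a rational \<open>R0 < R\<close>: offset
    \<open>R0 / 4\<close>, ball \<open>R0 / 2\<close>, translations up to \<open>R0 / 8\<close>;
    points of the ball are then within \<open>3 * R0 / 4\<close> of \<open>x\<close>.\<close>
  obtain R0 where R0: "R0 \<in> \<rat>" "0 < R0" "R0 < R" using Rats_dense_in_real[OF assms(1)] by blast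
  have "\<exists>c\<in>\<rat>. x i - R0 / 4 < c \<and> c < x i + R0 / 4" for i
    using R0(2) by (intro Rats_dense_in_real) simp
  then obtain c where c: "\<And>i. c i \<in> \<rat>" "\<And>i. x i - R0 / 4 < c i" "\<And>i. c i < x i + R0 / 4" by metis
  define q where "q i = (if i < n then c i else 0)" for i
  have near: "\<bar>x i - q i\<bar> < R0 / 4" for i
  proof (cases "i < n")
    case True
    then show ?thesis using c(2,3)[of i] by (simp only: q_def if_True abs_less_iff) linarith
  next
    case False
    then show ?thesis using assms(2) R0(2) by (simp add: q_def coord_space_def)
  qed
  show thesis
  proof
    show "q \<in> coord_space {..<n}" by (simp add: q_def coord_space_def)
    show "q i \<in> \<rat>" for i using c(1) by (simp add: q_def)
    show "R0 / 2 \<in> \<rat>" "R0 / 8 \<in> \<rat>" using R0(1) by auto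
    show "0 < R0 / 8" "0 < R0 / 2" "R0 / 2 < R" "3 * R0 / 4 < R" "R0 / 4 + R0 / 8 < R0 / 2"
      using R0(2,3) by simp_all
    show "small (R0 / 4) (x - q)" using near by (simp add: small_def)
    show "small (3 * R0 / 4) (y - x)" if "small (R0 / 2) (y - q)" for y
      unfolding small_def
    proof
      fix i
      have "\<bar>y i - q i\<bar> < R0 / 2" using that by (simp add: small_def)
      moreover have "\<bar>y i - x i\<bar> \<le> \<bar>y i - q i\<bar> + \<bar>x i - q i\<bar>" by simp
      ultimately show "\<bar>(y - x) i\<bar> < 3 * R0 / 4" using near[of i] by simp
    qed
  qed
qed

text \<open>Scaling by \<open>1 + t\<close> about the apex \<open>x\<close> moves \<open>y\<close>
  to \<open>y + t w\<close>, and the dilation that this causes around \<open>y\<close> is undone by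
  the cone at \<open>y\<close>.\<close>

lemma cone_stratum:
  assumes "finite K" and cx: "cone_at X K x R" and cy: "cone_at X K y R'"
    and xy: "y - x \<in> coord_space K" "small M (y - x)" "M < R"
  shows "y - x \<in> strata X K y"
proof -
  define w where "w = y - x"
  have wK: "w \<in> coord_space K" and wM: "small M w" using xy by (auto simp: w_def)
  define \<eta> where "\<eta> = R - M"
  have \<eta>: "\<eta> > 0" using xy(3) by (simp add: \<eta>_def)
  have R': "R' > 0" using cy by (simp add: cone_at_def)
  obtain d where d: "d > 0" "\<And>t. \<bar>t\<bar> < d \<Longrightarrow> small (\<eta>/2) (t *\<^sub>R w)"
    using ex_small_scale[OF assms(1) wK, of "\<eta>/2"] \<eta> by auto
  define e where "e = min (min d (1/2)) (min (\<eta>/4) (R'/2))"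
  have "w \<in> strata X K y"
  proof (rule strataI[OF wK])
    show "e > 0" using d(1) \<eta> R' by (simp add: e_def)
    fix u t assume u: "u \<in> coord_space K" "small e u" and t: "\<bar>t\<bar> < e"
    have t2: "\<bar>t\<bar> < 1/2" "\<bar>t\<bar> < d" using t by (auto simp: e_def)
    have su: "small (\<eta>/4) u" "small (R'/2) u" "small R' u" "small (\<eta>/2) u"
      using u(2) R' \<eta> by (auto intro: small_mono simp: e_def)
    \<comment> \<open>The inverse of the scaling factor; it is at most 2, which the halved boxes
      absorb.\<close>
    define c where "c = 1 / (1 + t)"
    have t1: "1 + t \<ge> 1/2" using t2(1) by linarith
    have c: "0 < c" "\<bar>c / 2\<bar> \<le> 1" using t1 by (auto simp: c_def field_simps)
    have cu: "small \<rho> (c *\<^sub>R u)" if "small (\<rho>/2) u" for \<rho>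
    proof -
      have "small (\<rho>/2) ((c / 2) *\<^sub>R u)" by (rule small_scale[OF that c(2)])
      from small_add[OF this this, of \<rho>] show ?thesis by (simp flip: scaleR_add_left)
    qed
    have cuK: "c *\<^sub>R u \<in> coord_space K" by (rule coord_space_scale[OF u(1)])
    have eq: "(1 + t) *\<^sub>R (w + c *\<^sub>R u) = w + (u + t *\<^sub>R w)"
    proof -
      have ct: "(1 + t) * c = 1" using t1 by (simp add: c_def)
      have "(1 + t) *\<^sub>R (w + c *\<^sub>R u) = (w + t *\<^sub>R w) + ((1 + t) * c) *\<^sub>R u"
        by (simp only: scaleR_add_right scaleR_scaleR scaleR_add_left[of 1 t w] scaleR_one)
      then show ?thesis unfolding ct by (simp add: add.assoc add.commute)
    qed
    have y: "y + z = x + (w + z)" for z by (simp add: w_def)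
    have "y + u \<in> X \<longleftrightarrow> y + c *\<^sub>R u \<in> X"
      by (rule cone_atD[OF cy u(1) c(1) su(3) cu[OF su(2)]])
    also have "\<dots> \<longleftrightarrow> x + (w + c *\<^sub>R u) \<in> X" unfolding y ..
    also have "\<dots> \<longleftrightarrow> x + (1 + t) *\<^sub>R (w + c *\<^sub>R u) \<in> X"
    proof (rule cone_atD[OF cx coord_space_add[OF wK cuK]])
      show "small R (w + c *\<^sub>R u)"
        by (rule small_add[OF wM cu[of "\<eta>/2"]]) (use su(1) \<eta> in \<open>simp_all add: \<eta>_def field_simps\<close>)
      show "small R ((1 + t) *\<^sub>R (w + c *\<^sub>R u))"
        unfolding eq by (rule small_add[OF wM small_add[OF su(4) d(2)[OF t2(2)] order_refl]])
          (simp add: \<eta>_def)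
    qed (use t1 in simp)
    also have "\<dots> \<longleftrightarrow> y + (u + t *\<^sub>R w) \<in> X" unfolding eq y ..
    finally show "y + u \<in> X \<longleftrightarrow> y + u + t *\<^sub>R w \<in> X" by (simp only: add.assoc)
  qed
  then show ?thesis by (simp add: w_def)
qed

lemma cone_translation_invariant_iff:
  assumes cone: "cone_at X {..<n} x R"
    and xq: "x \<in> coord_space {..<n}" "q \<in> coord_space {..<n}"
    and ball: "\<forall>y. small r (y - q) \<longrightarrow> small R (y - x)"
    and m: "small m (x - q)" "m + s < r"
    and v: "v \<in> coord_space {..<n}" "\<And>i. \<bar>v i\<bar> \<le> s"
  shows "translation_invariant X n r q v \<longleftrightarrow> v \<in> strata X {..<n} x"
  unfolding translation_invariant_def
  by (rule cone_strata_iff[OF _ cone xq _ m v, symmetric]) (simp, use ball in blast)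

text \<open>For a rational ball around \<open>q\<close> in which \<open>X\<close> is a cone with apex \<open>x\<close>, the small elements
  of the stratum at \<open>x\<close> are first-order definable. Each vector of its echelon basis is
  determined by its coordinates at the pivots, so up to scaling it is the only point of a
  definable set.\<close>

lemma rational_strata_basis:
  assumes hyp: "has_rational_points n X"
    and cone: "cone_at X {..<n} x R" and x: "x \<in> coord_space {..<n}"
  defines "V \<equiv> strata X {..<n} x"
  obtains b where "\<And>j. b j \<in> V" "\<And>i j. j \<in> pivots V \<Longrightarrow> b j i \<in> \<rat>"
    "\<And>v. v \<in> V \<longleftrightarrow> v = (\<Sum>j\<in>pivots V. v j *\<^sub>R b j)"
proof -
  have V: "subspace V" "V \<subseteq> coord_space {..<n}" "finite {..<n}"
    by (auto simp: V_def subspace_strata strata_coord_space)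
  obtain b where b: "\<And>j. b j \<in> V" "\<And>i j. i \<in> pivots V \<Longrightarrow> b j i = (if i = j then 1 else 0)"
    "\<And>v. v \<in> V \<longleftrightarrow> v = (\<Sum>j\<in>pivots V. v j *\<^sub>R b j)"
    by (rule pivots_basis[OF V]) (rule that)
  have R: "R > 0" using cone by (simp add: cone_at_def)
  obtain q r s m M where q: "q \<in> coord_space {..<n}" "\<And>i. q i \<in> \<rat>"
    and r: "r \<in> \<rat>" "s \<in> \<rat>" "0 < s" "0 < r" "r < R" "M < R"
    and near: "\<And>y. small r (y - q) \<Longrightarrow> small M (y - x)" and m: "small m (x - q)" "m + s < r"
    by (rule ex_rational_ball[OF R x]) (rule that)
  have ball: "\<forall>y. small r (y - q) \<longrightarrow> small R (y - x)"
    using near small_mono[OF _ less_imp_le[OF r(6)]] by blast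
  note inv_iff = cone_translation_invariant_iff[OF cone x q(1) ball m]
  have piv: "pivots V \<subseteq> {..<n}" by (rule pivots_subset[OF V(2)])
  have rat: "b j i \<in> \<rat>" if j: "j \<in> pivots V" for i j
  proof -
    have bK: "b j \<in> coord_space {..<n}" using b(1) V(2) by blast
    obtain d where d: "d > 0" "\<And>t. \<bar>t\<bar> < d \<Longrightarrow> small s (t *\<^sub>R b j)"
      using ex_small_scale[OF V(3) bK r(3)] by blast
    \<comment> \<open>A multiple of \<open>b j\<close> short enough for the box of size
      \<open>s\<close>; being rational, \<open>c\<close> can be expressed in the formula and divided
      out at the end.\<close>
    obtain c where c: "c \<in> \<rat>" "0 < c" "c < d" using Rats_dense_in_real[OF d(1)] by blast
    define P where "P e \<longleftrightarrow> (\<forall>i\<in>{..<n}. e i = q i) \<and> e (3 * n) = r \<and>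
      (\<forall>i\<in>{..<n}. - s \<le> e (n + i) \<and> e (n + i) \<le> s) \<and>
      (\<forall>i\<in>pivots V. e (n + i) = (if i = j then c else 0)) \<and>
      translation_invariant X n (e (3 * n)) (block n 0 e) (block n 1 e)" for e
    have "first_order {n} X P"
      unfolding P_def
      using q(2) r(1,2) c(1) piv
      by (intro first_order_conj first_order_ball first_order_eq first_order_le
          first_order_translation_invariant rational_form_coord rational_form_const)
        (auto intro: finite_subset)
    moreover have "P (\<lambda>k. if k < n then q k else if k < 2 * n then (c *\<^sub>R b j) (k - n) else r)"
      (is "P ?e")
    proof -
      have blocks: "block n 0 ?e = q" "block n 1 ?e = c *\<^sub>R b j"
        using q(1) bK by (auto simp: block_def fun_eq_iff coord_space_def)
      have sm: "small s (c *\<^sub>R b j)" using c by (intro d(2)) simp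
      have le: "\<bar>(c *\<^sub>R b j) i\<bar> \<le> s" for i using sm by (simp only: small_def less_imp_le)
      have "translation_invariant X n r q (c *\<^sub>R b j)"
        using inv_iff[OF coord_space_scale[OF bK] le] subspace_scale[OF V(1) b(1)]
        unfolding V_def by blast
      moreover have "- s \<le> c * b j i \<and> c * b j i \<le> s" for i using le[of i] by (simp add: abs_le_iff)
      moreover have "?e (n + i) = c * b j i" if "i < n" for i using that by simp
      moreover have "c * b j i = (if i = j then c else 0)" if "i \<in> pivots V" for i
        using b(2)[OF that] by simp
      moreover have "?e (3 * n) = r" using q(1) by (auto simp: coord_space_def)
      ultimately show ?thesis
        unfolding P_def blocks using piv by (auto simp: subset_iff)
    qed
    ultimately obtain e where e: "P e" "\<And>i. e i \<in> \<rat>" by (rule rational_point[OF hyp]) (rule that)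
    define v where "v = block n 1 e"
    have "block n 0 e = q" using e(1) q(1) by (auto simp: P_def block_def fun_eq_iff coord_space_def)
    moreover have "e (3 * n) = r" "translation_invariant X n (e (3 * n)) (block n 0 e) v"
      using e(1) unfolding P_def v_def by blast+
    ultimately have "translation_invariant X n r q v" by (simp only:)
    moreover have "\<bar>v i\<bar> \<le> s" for i
    proof -
      have "\<forall>i\<in>{..<n}. - s \<le> e (n + i) \<and> e (n + i) \<le> s" using e(1) unfolding P_def by blast
      then show ?thesis using r(3) by (auto simp: v_def block_def abs_le_iff minus_le_iff)
    qed
    moreover have "v \<in> coord_space {..<n}" by (simp add: v_def block_coord_space)
    ultimately have "v \<in> V" using inv_iff by (simp add: V_def)
    then have "v - c *\<^sub>R b j \<in> V" using b(1) V(1) by (intro subspace_diff subspace_scale)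
    \<comment> \<open>An element of \<open>V\<close> is determined by its pivot coordinates, so the
      rational solution \<open>v\<close> is \<open>c b j\<close> itself.\<close>
    moreover have "(v - c *\<^sub>R b j) i = 0" if "i \<in> pivots V" for i
      using e(1) that piv b(2)[OF that, of j] by (auto simp: P_def v_def block_def)
    ultimately have "v - c *\<^sub>R b j = 0" by (rule pivots_zero[OF _ V(2,3)])
    then have "v i = c * b j i" by (simp add: fun_eq_iff)
    then have "b j i = v i / c" using c(2) by simp
    moreover have "v i \<in> \<rat>" using e(2) by (simp add: v_def block_def)
    ultimately show ?thesis using c(1) by simp
  qed
  show thesis by (rule that[OF b(1) rat b(3)])
qed

text \<open>\<open>P\<close> says of a point in the rational ball that all its short translation
  invariances lie in \<open>V\<close>. It holds for \<open>x\<close>, where they are short strata. A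
  rational point \<open>x'\<close> with \<open>P\<close> has its strata inside \<open>V\<close>;
  being in the cone of \<open>x\<close>, it has \<open>x' - x\<close> among them and so lies on the
  flat of \<open>x\<close>.\<close>

lemma rational_point_in_flat:
  assumes hyp: "has_rational_points n X"
    and cone: "\<forall>x\<in>coord_space {..<n}. \<exists>R. cone_at X {..<n} x R"
    and x: "x \<in> coord_space {..<n}"
    and V: "first_order {n} X (\<lambda>e. block n 1 e \<in> strata X {..<n} x)"
  obtains x' where "x' \<in> flat X {..<n} x" "\<And>i. x' i \<in> \<rat>"
proof -
  define V where "V = strata X {..<n} x"
  obtain R where R: "cone_at X {..<n} x R" using cone x by blast
  then have "R > 0" by (simp add: cone_at_def)
  obtain q r s m M where q: "q \<in> coord_space {..<n}" "\<And>i. q i \<in> \<rat>"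
    and r: "r \<in> \<rat>" "s \<in> \<rat>" "0 < s" "0 < r" "r < R" "M < R"
    and near: "\<And>y. small r (y - q) \<Longrightarrow> small M (y - x)" and m: "small m (x - q)" "m + s < r"
    by (rule ex_rational_ball[OF \<open>R > 0\<close> x]) (rule that)
  \<comment> \<open>Translation vector and radius are quantified; the base point in block 0 stays
    free.\<close>
  define J where "J = {n..<2 * n} \<union> {3 * n}"
  \<comment> \<open>The doubled entries bound the vector by half of the radius without dividing; the
    other half leaves room for \<open>cone_translation_invariant_iff\<close> at
    \<open>x\<close>.\<close>
  define Q where "Q e \<longleftrightarrow> 0 < e (3 * n) \<longrightarrow> e (3 * n) < r \<longrightarrow>
    (\<forall>i\<in>{..<n}. - e (3 * n) \<le> e (n + i) + e (n + i) \<and> e (n + i) + e (n + i) \<le> e (3 * n)) \<longrightarrow>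
    translation_invariant X n (e (3 * n)) (block n 0 e) (block n 1 e) \<longrightarrow> block n 1 e \<in> V" for e
  define P where "P e \<longleftrightarrow> small r (block n 0 e - q) \<and>
    (\<forall>e'. (\<forall>i. i \<notin> J \<longrightarrow> e' i = e i) \<longrightarrow> Q e')" for e
  have "first_order {n} X Q"
    unfolding Q_def
    by (intro first_order_imp first_order_ball first_order_conj first_order_less first_order_le
        first_order_translation_invariant V[folded V_def] rational_form_intros
        rational_form_const r(1)) simp
  then have "first_order {n} X P"
    unfolding P_def
  proof (intro first_order_conj first_order_all_block)
    show "first_order {n} X (\<lambda>e. small r (block n 0 e - q))"
      using q r(1) by (intro first_order_small[where n = n] coord_space_diff block_coord_space)
        (simp_all add: rational_form_diff rational_form_block rational_form_const)
  qed (simp_all add: J_def)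
  moreover have "P x"
  proof -
    have blk: "block n 0 x = x" using x by (auto simp: block_def coord_space_def fun_eq_iff)
    have "Q e" if e: "\<forall>i. i \<notin> J \<longrightarrow> e i = x i" for e
      unfolding Q_def
    proof (intro impI)
      define \<rho> where "\<rho> = e (3 * n)"
      have 0: "block n 0 e = x" using e x by (auto simp: block_def fun_eq_iff J_def coord_space_def)
      assume \<rho>: "0 < e (3 * n)" "e (3 * n) < r"
        and v: "\<forall>i\<in>{..<n}. - e (3 * n) \<le> e (n + i) + e (n + i) \<and> e (n + i) + e (n + i) \<le> e (3 * n)"
        and inv: "translation_invariant X n (e (3 * n)) (block n 0 e) (block n 1 e)"
      have "translation_invariant X n \<rho> x (block n 1 e) \<longleftrightarrow> block n 1 e \<in> strata X {..<n} x"
      proof (rule cone_translation_invariant_iff[OF R x x _ _ _ block_coord_space])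
        have "\<rho> \<le> R" using \<rho> r by (simp add: \<rho>_def)
        then show "\<forall>y. small \<rho> (y - x) \<longrightarrow> small R (y - x)" using small_mono by blast
        show "small (\<rho> / 4) (x - x)" using \<rho> by (simp add: \<rho>_def)
        show "\<rho> / 4 + \<rho> / 2 < \<rho>" using \<rho> by (simp add: \<rho>_def)
        show "\<bar>block n 1 e i\<bar> \<le> \<rho> / 2" for i
        proof (cases "i < n")
          case True
          then have "- \<rho> \<le> e (n + i) + e (n + i)" "e (n + i) + e (n + i) \<le> \<rho>"
            using v by (auto simp: \<rho>_def)
          then have "\<bar>e (n + i)\<bar> \<le> \<rho> / 2" by linarith
          then show ?thesis using True by (simp add: block_def)
        qed (use \<rho> in \<open>simp add: block_def \<rho>_def\<close>)
      qed
      then show "block n 1 e \<in> V" using inv unfolding 0 \<rho>_def V_def by blast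
    qed
    moreover have "small r (x - q)" using m(1) by (rule small_mono) (use m(2) r(3) in simp)
    ultimately show ?thesis unfolding P_def blk by blast
  qed
  ultimately obtain e where e: "P e" "\<And>i. e i \<in> \<rat>" by (rule rational_point[OF hyp]) (rule that)
  define x' where "x' = block n 0 e"
  have x': "x' \<in> coord_space {..<n}" by (simp add: x'_def block_coord_space)
  have sub: "strata X {..<n} x' \<subseteq> V"
  proof
    fix w assume w: "w \<in> strata X {..<n} x'"
    have wK: "w \<in> coord_space {..<n}" using w by (rule strata_coord_space)
    obtain \<epsilon> where \<epsilon>: "\<epsilon> > 0" "\<And>u t. u \<in> coord_space {..<n} \<Longrightarrow> small \<epsilon> u \<Longrightarrow> \<bar>t\<bar> < \<epsilon> \<Longrightarrow>
      x' + u \<in> X \<longleftrightarrow> x' + u + t *\<^sub>R w \<in> X" using strataE[OF w] by blast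
    define \<rho> where "\<rho> = min \<epsilon> r / 2"
    have \<rho>: "0 < \<rho>" "\<rho> < r" "\<rho> \<le> \<epsilon>" using \<epsilon>(1) r(4) by (auto simp: \<rho>_def)
    obtain d where d: "d > 0" "\<And>t. \<bar>t\<bar> < d \<Longrightarrow> small (\<rho>/2) (t *\<^sub>R w)"
      using ex_small_scale[OF _ wK, of "\<rho>/2"] \<rho>(1) by auto
    define t where "t = min d \<epsilon> / 2"
    have t: "0 < t" "\<bar>t\<bar> < d" "\<bar>t\<bar> < \<epsilon>" using d(1) \<epsilon>(1) by (auto simp: t_def)
    define e' where "e' i = (if i \<in> {n..<2 * n} then t * w (i - n) else if i = 3 * n then \<rho> else e i)" for i
    have "Q e'" using e(1) unfolding P_def by (auto simp: e'_def J_def)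
    have n3: "e' (3 * n) = \<rho>" using wK by (simp add: e'_def)
    have blocks: "block n 0 e' = x'" "block n 1 e' = t *\<^sub>R w"
      using wK by (auto simp: block_def e'_def x'_def fun_eq_iff coord_space_def)
    have "translation_invariant X n \<rho> x' (t *\<^sub>R w)"
      unfolding translation_invariant_def
    proof (intro ballI impI)
      fix y assume y: "y \<in> coord_space {..<n}" "small \<rho> (y - x')"
      have "x' + (y - x') \<in> X \<longleftrightarrow> x' + (y - x') + t *\<^sub>R w \<in> X"
        by (rule \<epsilon>(2)[OF coord_space_diff[OF y(1) x'] small_mono[OF y(2) \<rho>(3)] t(3)])
      then show "y \<in> X \<longleftrightarrow> y + t *\<^sub>R w \<in> X" by simp
    qed
    moreover have "\<forall>i\<in>{..<n}. - \<rho> \<le> e' (n + i) + e' (n + i) \<and> e' (n + i) + e' (n + i) \<le> \<rho>"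
    proof
      fix i assume "i \<in> {..<n}"
      then have "e' (n + i) = (t *\<^sub>R w) i" by (simp add: e'_def)
      moreover have "\<bar>(t *\<^sub>R w) i\<bar> < \<rho> / 2" using d(2)[OF t(2)] unfolding small_def by blast
      ultimately show "- \<rho> \<le> e' (n + i) + e' (n + i) \<and> e' (n + i) + e' (n + i) \<le> \<rho>"
        by (simp only: abs_less_iff) linarith
    qed
    ultimately have tw: "t *\<^sub>R w \<in> V" using \<open>Q e'\<close> \<rho> unfolding Q_def n3 blocks by blast
    have "subspace V" unfolding V_def by (rule subspace_strata) simp
    then have "(1 / t) *\<^sub>R (t *\<^sub>R w) \<in> V" using tw by (rule subspace_scale)
    then show "w \<in> V" using t(1) by simp
  qed
  obtain R' where R': "cone_at X {..<n} x' R'" using cone x' by blast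
  have "small M (x' - x)" using e(1) near unfolding P_def x'_def by blast
  then have "x' - x \<in> strata X {..<n} x'"
    using coord_space_diff[OF x' x] r(6) by (intro cone_stratum[OF _ R R']) auto
  then have "x' \<in> flat X {..<n} x" using sub unfolding mem_flat_iff V_def by blast
  moreover have "x' i \<in> \<rat>" for i using e(2) by (simp add: x'_def block_def)
  ultimately show thesis by (rule that)
qed

text \<open>The second condition allows evaluation in environments with arbitrary values from index
  \<open>n\<close> on.\<close>

definition coordinate_form :: "nat \<Rightarrow> (vec \<Rightarrow> real) \<Rightarrow> bool" where
  "coordinate_form n g \<longleftrightarrow> rational_form g \<and> (\<forall>e e'. (\<forall>i<n. e i = e' i) \<longrightarrow> g e = g e')"

text \<open>The direction has a rational echelon basis and the flat contains a rational point
  \<open>x'\<close>, so equations as in \<open>subspace_equations\<close> get rational coefficients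
  and constants.\<close>

lemma rational_flat_equations:
  assumes hyp: "has_rational_points n X"
    and cone: "\<forall>x\<in>coord_space {..<n}. \<exists>R. cone_at X {..<n} x R"
    and z: "z \<in> coord_space {..<n}"
  shows "\<exists>G. finite G \<and> (\<forall>g\<in>G. coordinate_form n g) \<and>
    (\<forall>x. x \<in> coord_space {..<n} \<longrightarrow> (x \<in> flat X {..<n} z \<longleftrightarrow> (\<forall>g\<in>G. g x = 0)))"
proof -
  define V where "V = strata X {..<n} z"
  have V: "subspace V" "V \<subseteq> coord_space {..<n}"
    by (auto simp: V_def subspace_strata strata_coord_space)
  obtain R where R: "cone_at X {..<n} z R" using cone z by blast
  obtain b where b: "\<And>j. b j \<in> V" "\<And>i j. j \<in> pivots V \<Longrightarrow> b j i \<in> \<rat>"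
    "\<And>v. v \<in> V \<longleftrightarrow> v = (\<Sum>j\<in>pivots V. v j *\<^sub>R b j)"
    using rational_strata_basis[OF hyp R z] unfolding V_def by metis
  have piv: "pivots V \<subseteq> {..<n}" by (rule pivots_subset[OF V(2)])
  have memV: "v \<in> V \<longleftrightarrow> (\<forall>i\<in>{..<n}. v i = (\<Sum>j\<in>pivots V. b j i * v j))"
    if "v \<in> coord_space {..<n}" for v
  proof -
    have "v i = (\<Sum>j\<in>pivots V. b j i * v j)" if "\<not> i < n" for i
    proof -
      have "b j i = 0" for j using b(1)[of j] V(2) that by (auto simp: coord_space_def)
      then show ?thesis using \<open>v \<in> _\<close> that by (simp add: coord_space_def)
    qed
    then show ?thesis unfolding b(3)[of v] by (auto simp: fun_eq_iff mult.commute)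
  qed
  \<comment> \<open>Rationality of the basis makes \<open>V\<close> definable, as
    \<open>rational_point_in_flat\<close> presupposes.\<close>
  have "first_order {n} X (\<lambda>e. \<forall>i\<in>{..<n}. block n 1 e i = (\<Sum>j\<in>pivots V. b j i * block n 1 e j))"
    using b(2) by (intro first_order_ball first_order_eq rational_form_sum rational_form_scale
        rational_form_block) auto
  then have "first_order {n} X (\<lambda>e. block n 1 e \<in> V)"
    using memV[OF block_coord_space] by (simp only:)
  then obtain x' where x': "x' \<in> flat X {..<n} z" "\<And>i. x' i \<in> \<rat>"
    unfolding V_def by (rule rational_point_in_flat[OF hyp cone z]) (rule that)
  define f where "f i x = (x i - x' i) - (\<Sum>j\<in>pivots V. b j i * (x j - x' j))" for i and x :: vec
  have x'V: "x' - z \<in> V" using x'(1) by (simp add: mem_flat_iff V_def)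
  have x'K: "x' \<in> coord_space {..<n}" using x'V V(2) coord_space_add[OF _ z, of "x' - z"] by auto
  have "coordinate_form n (f i)" if "i < n" for i
    unfolding coordinate_form_def
  proof
    show "rational_form (f i)"
      unfolding f_def using b(2) x'(2)
      by (intro rational_form_diff rational_form_sum rational_form_scale rational_form_coord
          rational_form_const) auto
    have "f i e = f i e'" if "\<forall>i<n. e i = e' i" for e e'
      unfolding f_def using that \<open>i < n\<close> piv by (intro arg_cong2[where f = "(-)"] sum.cong) auto
    then show "\<forall>e e'. (\<forall>i<n. e i = e' i) \<longrightarrow> f i e = f i e'" by blast
  qed
  then have "\<forall>g\<in>f ` {..<n}. coordinate_form n g" by blast
  moreover have "x \<in> flat X {..<n} z \<longleftrightarrow> (\<forall>g\<in>f ` {..<n}. g x = 0)" if "x \<in> coord_space {..<n}" for x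
  proof -
    have "x \<in> flat X {..<n} z \<longleftrightarrow> x - x' \<in> V"
      using subspace_add[OF V(1), of "x - x'" "x' - z"] subspace_diff[OF V(1), of "x - z" "x' - z"] x'V
      by (auto simp: mem_flat_iff V_def)
    also have "\<dots> \<longleftrightarrow> (\<forall>g\<in>f ` {..<n}. g x = 0)"
      unfolding memV[OF coord_space_diff[OF that x'K]] by (simp add: f_def)
    finally show ?thesis .
  qed
  ultimately show ?thesis by (intro exI[of _ "f ` {..<n}"]) simp
qed

text \<open>\<open>X\<close> is the union of finitely many realized sign patterns, each a finite
  conjunction of sign conditions on rational forms.\<close>

lemma sign_invariant_definable:
  assumes n: "n \<ge> 1" and X: "X \<subseteq> coord_space {..<n}"
    and F: "finite F" "\<And>g. g \<in> F \<Longrightarrow> coordinate_form n g" "sign_invariant F (coord_space {..<n}) X"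
  shows "definable n X"
proof -
  define \<tau> where "\<tau> = block n 0"
  define pat where "pat x = restrict (\<lambda>g. sgn (g x)) F" for x :: vec
  have fin: "finite (pat ` X)"
    unfolding pat_def by (rule finite_subset[OF _ finite_sign_patterns[OF F(1)]]) blast
  have \<tau>: "\<tau> x \<in> coord_space {..<n}" "\<And>i. i < n \<Longrightarrow> \<tau> x i = x i" for x
    by (simp_all add: \<tau>_def block_coord_space) (simp add: block_def)
  have "\<tau> e \<in> X \<longleftrightarrow> (\<exists>p\<in>pat ` X. \<forall>g\<in>F. sgn (g e) = p g)" for e
  proof -
    have g: "g (\<tau> e) = g e" if "g \<in> F" for g
      using F(2)[OF that] \<tau>(2) unfolding coordinate_form_def by blast
    show ?thesis
    proof
      assume "\<tau> e \<in> X"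
      then show "\<exists>p\<in>pat ` X. \<forall>g\<in>F. sgn (g e) = p g"
        by (intro bexI[of _ "pat (\<tau> e)"]) (auto simp: pat_def g)
    next
      assume "\<exists>p\<in>pat ` X. \<forall>g\<in>F. sgn (g e) = p g"
      then obtain x where "x \<in> X" "\<forall>g\<in>F. sgn (g e) = sgn (g x)" by (auto simp: pat_def)
      then show "\<tau> e \<in> X" using F(3) \<tau>(1) X g unfolding sign_invariant_def by (metis subsetD)
    qed
  qed
  moreover have "first_order {} {} (\<lambda>e. \<exists>p\<in>pat ` X. \<forall>g\<in>F. sgn (g e) = p g)"
  proof (intro first_order_bex first_order_ball fin F(1))
    fix p :: "(vec \<Rightarrow> real) \<Rightarrow> real" and g assume "g \<in> F"
    then have g: "rational_form g" using F(2) by (simp add: coordinate_form_def)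
    \<comment> \<open>The conditions on \<open>c\<close> become constant truth values in the
      formula, so \<open>c\<close> need not be a rational number or a value of
      \<open>sgn\<close>.\<close>
    have "sgn r = c \<longleftrightarrow> (0 < r \<longrightarrow> c = 1) \<and> (r = 0 \<longrightarrow> c = 0) \<and> (r < 0 \<longrightarrow> c = -1)" for r c :: real
      by (cases r "0::real" rule: linorder_cases) auto
    moreover have const: "first_order {} {} (\<lambda>e. b)" for b
      using first_order_True first_order_not[OF first_order_True] by (cases b) auto
    then have "first_order {} {} (\<lambda>e. (0 < g e \<longrightarrow> p g = 1) \<and> (g e = 0 \<longrightarrow> p g = 0) \<and> (g e < 0 \<longrightarrow> p g = -1))"
      by (intro first_order_conj first_order_imp[OF _ const] first_order_less first_order_eq g
          rational_form_zero)
    ultimately show "first_order {} {} (\<lambda>e. sgn (g e) = p g)" by (simp only:)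
  qed
  ultimately have "first_order {} {} (\<lambda>e. \<tau> e \<in> X)" by (simp only:)
  then obtain p where p: "rel_arities p \<subseteq> {}" "\<And>e. \<tau> e \<in> X \<longleftrightarrow> sat {} e p"
    unfolding first_order_def by blast
  \<comment> \<open>Variables from \<open>n\<close> on do not affect the truth of \<open>p\<close>,
    since \<open>\<tau>\<close> cuts them off; they are renamed to 0, a legal index because
    \<open>n \<ge> 1\<close>.\<close>
  define \<sigma> where "\<sigma> i = (if i < n then i else 0)" for i
  have "sat {} x (rename \<sigma> p) \<longleftrightarrow> x \<in> X" if x: "x \<in> coord_space {..<n}" for x
  proof -
    have "\<tau> (\<lambda>i. x (\<sigma> i)) = x"
      using x by (auto simp: \<tau>_def block_def \<sigma>_def coord_space_def fun_eq_iff)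
    then show ?thesis using p(2)[of "\<lambda>i. x (\<sigma> i)"] by (simp add: sat_rename)
  qed
  moreover have "free_vars (rename \<sigma> p) \<subseteq> {..<n}"
    using free_vars_rename[of \<sigma> p] n by (auto simp: \<sigma>_def split: if_splits)
  ultimately show ?thesis
    unfolding definable_def Rvec_eq_coord_space using p(1) X by (intro exI[of _ "rename \<sigma> p"]) auto
qed

section \<open>The characterization\<close>

theorem proposition5p7:
  fixes n :: nat and X :: "(nat \<Rightarrow> real) set"
  assumes "n \<ge> 1"
    and "X \<subseteq> Rvec n"
    and "\<And>k S. definable_with n X k S \<Longrightarrow> S \<noteq> {} \<Longrightarrow> \<exists>x\<in>S. \<forall>i<k. x i \<in> \<rat>"
  shows "definable n X \<longleftrightarrow>
    (\<forall>s a. sorted_wrt (<) s \<and> set s \<subseteq> {..<n} \<and> length a = length s \<longrightarrow>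
       finite {x \<in> Rvec (n - length s).
         quasi_singular (n - length s) (generalized_projection n X s a) x})"
proof
  assume "definable n X"
  then show "\<forall>s a. sorted_wrt (<) s \<and> set s \<subseteq> {..<n} \<and> length a = length s \<longrightarrow>
       finite {x \<in> Rvec (n - length s).
         quasi_singular (n - length s) (generalized_projection n X s a) x}"
    using definable_imp_finite_quasi_singular strict_sorted_iff by blast
next
  assume fin: "\<forall>s a. sorted_wrt (<) s \<and> set s \<subseteq> {..<n} \<and> length a = length s \<longrightarrow>
       finite {x \<in> Rvec (n - length s).
         quasi_singular (n - length s) (generalized_projection n X s a) x}"
  let ?E = "coord_space {..<n}"
  have X: "X \<subseteq> ?E" using assms(2) by (simp add: Rvec_eq_coord_space)
  have "finite (flat X {..<n} ` {x. x - 0 \<in> ?E})"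
    using fin by (intro finite_flats finite_relative_singular[OF X]) auto
  then have flats: "finite (flat X {..<n} ` ?E)" by simp
  \<comment> \<open>Real equations of the flats; only the local cones are drawn from this
    \<open>F\<close>.\<close>
  obtain F where F: "finite F" "\<And>g. g \<in> F \<Longrightarrow> affine_form g" "sign_invariant F ?E X"
  proof (rule finite_flats_sign_invariant[where \<Phi> = affine_form, OF _ flats])
    show "\<exists>G. finite G \<and> (\<forall>g\<in>G. affine_form g) \<and>
      (\<forall>x. x \<in> ?E \<longrightarrow> (x \<in> flat X {..<n} z \<longleftrightarrow> (\<forall>g\<in>G. g x = 0)))" if "z \<in> ?E" for z
      using flat_equations[of "{..<n}" z 0 X] that by simp
  qed auto
  have cone: "\<forall>x\<in>?E. \<exists>R. cone_at X {..<n} x R"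
  proof
    fix x assume x: "x \<in> ?E"
    obtain R where "cone_at X {..<n} x R" by (rule sign_invariant_cone_at[OF F x])
    then show "\<exists>R. cone_at X {..<n} x R" ..
  qed
  have rat: "has_rational_points n X" using assms(3) unfolding has_rational_points_def by blast
  \<comment> \<open>The same argument with the rational equations that the cones have made
    available.\<close>
  obtain G where G: "finite G" "\<And>g. g \<in> G \<Longrightarrow> coordinate_form n g" "sign_invariant G ?E X"
  proof (rule finite_flats_sign_invariant[where \<Phi> = "coordinate_form n", OF _ flats])
    show "affine_form g" if "coordinate_form n g" for g
      using that rational_form_affine_form by (simp add: coordinate_form_def)
    show "\<exists>G. finite G \<and> (\<forall>g\<in>G. coordinate_form n g) \<and>
      (\<forall>x. x \<in> ?E \<longrightarrow> (x \<in> flat X {..<n} z \<longleftrightarrow> (\<forall>g\<in>G. g x = 0)))" if "z \<in> ?E" for z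
      by (rule rational_flat_equations[OF rat cone that])
  qed auto
  show "definable n X" by (rule sign_invariant_definable[OF assms(1) X G])
qed

end
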